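(* Let $c_0=1/(102400\,\pi)\approx3.1\times10^{-6}$. Assume that for all $j\in[d]$, $h_j\le 1/\{2\psi_{\max}(Q_{j,j})\}$ and $h_j^2\le1/\{10\,\operatorname{tr}(Q_{j,j}^2)\}$. Define $\lambda_0:=\max_{j\in[d]}\bigl(1-c_0h_j\psi_{\min}(Q_{j,j})\bigr)$. Then $$\|P_{\mathrm{DCW}}-\Pi\|\le 1-\frac{(1-\lambda_0)^3}{8(d+1)(1+\lambda_0)}\,\frac{1-\psi_{\max}(I_N-DQ)}{d},$$ where $D=\operatorname{diag}(Q_{1,1}^{-1},\dots,Q_{d,d}^{-1})$ (block diagonal).
   Context: Let $\Pi=\mathcal N(\mu,Q^{-1})$ on $\mathbb R^N$ with density $\pi$, where $Q$ is a symmetric positive definite precision matrix. Coordinates are split into $d$ blocks of sizes $N_1,\dots,N_d$ with $\sum_jN_j=N$; write $x=(x_1,\dots,x_d)$, $x_j\in\mathbb R^{N_j}$, $x_{-j}=(x_k)_{k\ne j}$, and $Q=(Q_{j,k})_{j,k\in[d]}$ with $Q_{j,k}\in\mathbb R^{N_j\times N_k}$, where $[d]=\{1,\dots,d\}$. $\psi_{\max}$ and $\psi_{\min}$ denote largest and smallest eigenvalues (the matrix $I_N-DQ$ has real eigenvalues). Block MALA update $K_j$ with step size $h_j>0$: from $x$, propose $y=(y_j,x_{-j})$ with $y_j\mid x\sim\mathcal N(x_j+h_j\nabla_j\log\pi(x),\,2h_jI_{N_j})$, where $\nabla_j$ is the gradient in $x_j$; accept $y$ with probability $\min\{1,\pi(y)r_j(y,x)/(\pi(x)r_j(x,y))\}$,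 where $r_j(x,y)$ is the proposal density of $y_j$ given $x$; otherwise stay at $x$. $K_j$ is the resulting Markov kernel on $\mathbb R^N$, acting on $L^2(\Pi)$ by $(K_jf)(x)=\int f(y)K_j(x,\mathrm dy)$. The deterministic-scan component-wise MALA kernel is $P_{\mathrm{DCW}}=K_d\cdots K_1$. $\Pi$ also denotes the operator on $L^2(\Pi)$ sending $f$ to the constant $\int f\,\mathrm d\Pi$, and $\|\cdot\|$ is the operator norm on $L^2(\Pi)$. *)

theory Defs
  imports "HOL-Probability.Probability"
begin

section \<open>Block matrices\<close>

text \<open>
  The coordinates are the elements of a finite type \<open>'n\<close>, and a block is a set \<open>J\<close> of
  coordinates. The space \<open>\<real>\<^sup>J\<close> is represented by the vectors of \<open>real ^ 'n\<close> that vanish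
  outside \<open>J\<close>, and a matrix with rows in \<open>J\<close> and columns in \<open>K\<close> by the matrix of type
  \<open>real ^ 'n ^ 'n\<close> that is zero outside \<open>J \<times> K\<close>. Sums, products and traces of blocks
  are those of the zero-padded matrices; eigenvalues and inverses must refer to the block,
  as padding would add the eigenvalue 0 and destroy invertibility.
\<close>

definition block :: "'n::finite set \<Rightarrow> 'n set \<Rightarrow> real ^ 'n ^ 'n \<Rightarrow> real ^ 'n ^ 'n" where
  "block J K A = (\<chi> i k. if i \<in> J \<and> k \<in> K then A $ i $ k else 0)"

definition eigenvalue_on :: "'n::finite set \<Rightarrow> real ^ 'n ^ 'n \<Rightarrow> real \<Rightarrow> bool" where
  "eigenvalue_on J A a \<longleftrightarrow>
     (\<exists>v. v \<noteq> 0 \<and> (\<forall>i. i \<notin> J \<longrightarrow> v $ i = 0) \<and> A *v v = a *\<^sub>R v)"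

definition psi_max_on :: "'n::finite set \<Rightarrow> real ^ 'n ^ 'n \<Rightarrow> real" where
  "psi_max_on J A = Max {a. eigenvalue_on J A a}"

definition psi_min_on :: "'n::finite set \<Rightarrow> real ^ 'n ^ 'n \<Rightarrow> real" where
  "psi_min_on J A = Min {a. eigenvalue_on J A a}"

definition inverse_on :: "'n::finite set \<Rightarrow> real ^ 'n ^ 'n \<Rightarrow> real ^ 'n ^ 'n" where
  "inverse_on J A =
     (THE B. block J J B = B \<and> A ** B = block J J (mat 1) \<and> B ** A = block J J (mat 1))"

text \<open>
  A partition into \<open>d\<close> blocks is given by a map \<open>b\<close> from coordinates onto \<open>{1..d}\<close>;
  the block with number \<open>j\<close> is \<open>b -` {j}\<close>, so blocks are nonempty but need not be contiguous.
\<close>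

definition diag_block :: "('n::finite \<Rightarrow> nat) \<Rightarrow> nat \<Rightarrow> real ^ 'n ^ 'n \<Rightarrow> real ^ 'n ^ 'n" where
  "diag_block b j Q = block (b -` {j}) (b -` {j}) Q"

definition diag_block_inverse :: "('n::finite \<Rightarrow> nat) \<Rightarrow> nat \<Rightarrow> real ^ 'n ^ 'n \<Rightarrow> real ^ 'n ^ 'n" where
  "diag_block_inverse b d Q = (\<Sum>j\<in>{1..d}. inverse_on (b -` {j}) (diag_block b j Q))"

section \<open>The Gaussian target\<close>

definition sym_pos_def :: "real ^ 'n ^ 'n \<Rightarrow> bool" where
  "sym_pos_def Q \<longleftrightarrow> transpose Q = Q \<and> (\<forall>x. x \<noteq> 0 \<longrightarrow> 0 < x \<bullet> (Q *v x))"

definition gauss_density :: "real ^ 'n \<Rightarrow> real ^ 'n ^ 'n \<Rightarrow> real ^ 'n \<Rightarrow> real" where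
  "gauss_density \<mu> Q x =
     sqrt (det Q / (2 * pi) ^ CARD('n)) * exp (- ((x - \<mu>) \<bullet> (Q *v (x - \<mu>))) / 2)"

definition gauss_measure :: "real ^ 'n \<Rightarrow> real ^ 'n ^ 'n \<Rightarrow> (real ^ 'n) measure" where
  "gauss_measure \<mu> Q = density lborel (\<lambda>x. ennreal (gauss_density \<mu> Q x))"

section \<open>Block MALA\<close>

text \<open>In this section \<open>p\<close> is the target density, \<open>J\<close> the updated block, \<open>h\<close> the step size.\<close>

definition grad :: "('a::real_inner \<Rightarrow> real) \<Rightarrow> 'a \<Rightarrow> 'a" where
  "grad f x = (THE g. GDERIV f x :> g)"

definition upd_block :: "'n::finite set \<Rightarrow> real ^ 'n \<Rightarrow> ('n \<Rightarrow> real) \<Rightarrow> real ^ 'n" where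
  "upd_block J x z = (\<chi> i. if i \<in> J then z i else x $ i)"

text \<open>
  The density of \<open>\<N>(x\<^sub>J + h \<nabla>\<^sub>J log p(x), 2 h I)\<close> at \<open>y\<^sub>J\<close>. It depends on \<open>y\<close> only through
  its coordinates in \<open>J\<close>. The second parameter of \<open>normal_density\<close> is the standard deviation.
\<close>

definition mala_prop_density ::
    "(real ^ 'n \<Rightarrow> real) \<Rightarrow> 'n::finite set \<Rightarrow> real \<Rightarrow> real ^ 'n \<Rightarrow> real ^ 'n \<Rightarrow> real" where
  "mala_prop_density p J h x y =
     (\<Prod>i\<in>J. normal_density (x $ i + h * grad (\<lambda>z. ln (p z)) x $ i) (sqrt (2 * h)) (y $ i))"

definition mala_proposal ::
    "(real ^ 'n \<Rightarrow> real) \<Rightarrow> 'n::finite set \<Rightarrow> real \<Rightarrow> real ^ 'n \<Rightarrow> (real ^ 'n) measure" where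
  "mala_proposal p J h x =
     distr (density (\<Pi>\<^sub>M i\<in>J. lborel) (\<lambda>z. ennreal (mala_prop_density p J h x (upd_block J x z))))
       borel (upd_block J x)"

definition mala_accept ::
    "(real ^ 'n \<Rightarrow> real) \<Rightarrow> 'n::finite set \<Rightarrow> real \<Rightarrow> real ^ 'n \<Rightarrow> real ^ 'n \<Rightarrow> real" where
  "mala_accept p J h x y =
     min 1 ((p y * mala_prop_density p J h y x) / (p x * mala_prop_density p J h x y))"

definition mala_kernel ::
    "(real ^ 'n \<Rightarrow> real) \<Rightarrow> 'n::finite set \<Rightarrow> real \<Rightarrow> real ^ 'n \<Rightarrow> (real ^ 'n) measure" where
  "mala_kernel p J h x =
     bind (mala_proposal p J h x)
       (\<lambda>y. distr (measure_pmf (bernoulli_pmf (mala_accept p J h x y))) borel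
              (\<lambda>accept. if accept then y else x))"

text \<open>
  The kernel \<open>K\<^sub>d \<cdots> K\<^sub>1\<close>, where \<open>(K L)(x, A) = \<integral> L(y, A) K(x, dy)\<close>, so that the operator of a
  product of kernels is the composition of the operators in the same order.
\<close>

fun scan_kernel :: "(nat \<Rightarrow> 'a \<Rightarrow> 'a measure) \<Rightarrow> nat \<Rightarrow> 'a::topological_space \<Rightarrow> 'a measure" where
  "scan_kernel K 0 x = return borel x"
| "scan_kernel K (Suc j) x = bind (K (Suc j) x) (scan_kernel K j)"

definition dcw_mala_kernel ::
    "(real ^ 'n \<Rightarrow> real) \<Rightarrow> ('n::finite \<Rightarrow> nat) \<Rightarrow> nat \<Rightarrow> (nat \<Rightarrow> real) \<Rightarrow> real ^ 'n \<Rightarrow> (real ^ 'n) measure" where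
  "dcw_mala_kernel p b d h = scan_kernel (\<lambda>j. mala_kernel p (b -` {j}) (h j)) d"

section \<open>Operators on \<open>L\<^sup>2\<close>\<close>

definition kernel_op :: "('a \<Rightarrow> 'a measure) \<Rightarrow> ('a \<Rightarrow> real) \<Rightarrow> 'a \<Rightarrow> real" where
  "kernel_op K f x = (\<integral>y. f y \<partial>K x)"

definition mean_op :: "'a measure \<Rightarrow> ('a \<Rightarrow> real) \<Rightarrow> 'a \<Rightarrow> real" where
  "mean_op M f x = (\<integral>y. f y \<partial>M)"

definition L2 :: "'a measure \<Rightarrow> ('a \<Rightarrow> real) set" where
  "L2 M = {f \<in> borel_measurable M. integrable M (\<lambda>x. (f x)\<^sup>2)}"

text \<open>
  The norms take values in \<open>ereal\<close>, so that an operator that is unbounded or does not map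
  into \<open>L\<^sup>2\<close> has norm \<open>\<infinity>\<close> instead of an unspecified real number.
\<close>

definition L2_norm :: "'a measure \<Rightarrow> ('a \<Rightarrow> real) \<Rightarrow> ereal" where
  "L2_norm M f = (if f \<in> L2 M then ereal (sqrt (\<integral>x. (f x)\<^sup>2 \<partial>M)) else \<infinity>)"

definition L2_op_norm :: "'a measure \<Rightarrow> (('a \<Rightarrow> real) \<Rightarrow> 'a \<Rightarrow> real) \<Rightarrow> ereal" where
  "L2_op_norm M T = (SUP f\<in>{f \<in> L2 M. L2_norm M f \<le> 1}. L2_norm M (T f))"

end

theory Submission imports Defs
begin

text \<open>
  Write \<open>P\<^sub>j\<close> for the Gibbs update of block \<open>j\<close>, that is, the orthogonal projection onto the
  functions of the other blocks, and \<open>K\<^sub>j\<close> for the MALA update. Put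
  \<open>\<psi> = 1 - \<psi>\<^sub>m\<^sub>a\<^sub>x(I - DQ)\<close>, \<open>\<tau> = h\<^sub>j \<psi>\<^sub>m\<^sub>i\<^sub>n(Q\<^sub>j\<^sub>j)\<close>, and let \<open>f\<^sub>j = K\<^sub>j f\<^sub>j\<^sub>-\<^sub>1\<close> be the successive images
  of a function \<open>f\<^sub>0\<close> of mean zero. Two inequalities are combined.

  The first (\<open>K_gap\<close>) says that a MALA step loses norm unless its argument is nearly a function of
  the other blocks: \<open>\<tau>\<^sup>2/9 \<parallel>f - P\<^sub>j f\<parallel>\<^sup>2 \<le> \<parallel>f\<parallel>\<^sup>2 - \<parallel>K\<^sub>j f\<parallel>\<^sup>2\<close>. The MALA proposal has the mean of the
  Ornstein--Uhlenbeck update \<open>G\<^sub>j\<close>, which is reversible without a rejection step, and covariance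
  \<open>2hI\<close> instead of \<open>2hI - h\<^sup>2 Q\<^sub>j\<^sub>j\<close>. The density \<open>\<omega>\<close> of the law of the update with respect to that
  of the proposal depends on the noise only, and the step size conditions give
  \<open>E[\<omega>\<^sup>2/\<alpha>] \<le> 4\<close> for the acceptance probability \<open>\<alpha>\<close>, uniformly in the state (\<open>chi_square_bound\<close>).
  By the Cauchy--Schwarz inequality, \<open>(G\<^sub>j f - K\<^sub>j f)\<^sup>2\<close> is at most four times the conditional
  variance of \<open>f\<close> under \<open>K\<^sub>j\<close>, whose mean is \<open>\<parallel>f\<parallel>\<^sup>2 - \<parallel>K\<^sub>j f\<parallel>\<^sup>2\<close>. As \<open>G\<^sub>j\<close> contracts \<open>f - P\<^sub>j f\<close> by
  the factor \<open>1 - \<tau>\<close>, the loss cannot be small.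

  The second (\<open>random_scan_gap\<close>) is \<open>\<psi>/2 \<parallel>f\<parallel>\<^sup>2 \<le> \<Sum>\<^sub>j \<parallel>f - P\<^sub>j f\<parallel>\<^sup>2\<close> for \<open>f\<close> of mean zero: the random-scan
  Gibbs operator \<open>(1/d) \<Sum>\<^sub>j P\<^sub>j\<close> contracts by \<open>\<surd>(1 - \<psi>/d)\<close>. Both this contraction and that of \<open>G\<^sub>j\<close> are
  first read off for Lipschitz constants, from a coupling that uses the same noise at two starting
  points. They pass to norms because the norms of the powers of a selfadjoint operator are
  log-convex, so that an asymptotic geometric rate on a dense set already holds in the first step
  (\<open>contraction_from_lipschitz_rate\<close>).

  If the scan loses little norm in total, each of its steps moves its argument little, because
  \<open>K\<^sub>j\<close> fixes \<open>P\<^sub>j f\<close> and hence \<open>\<parallel>f - K\<^sub>j f\<parallel> \<le> 2 \<parallel>f - P\<^sub>j f\<parallel>\<close>. Then \<open>f\<^sub>0\<close> itself is close to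
  \<open>P\<^sub>j f\<^sub>0\<close> for every \<open>j\<close>, which the second inequality rules out (\<open>cyclic_scan_gap\<close>). The resulting rate
  is quadratic in \<open>min\<^sub>j \<tau>\<^sub>j\<close> and therefore stronger than the cubic one of the theorem. All estimates
  are made for bounded Borel functions; truncation and Fatou's lemma extend the bound to \<open>L\<^sup>2\<close>
  (\<open>L2_op_norm_kernel_le\<close>).
\<close>

section \<open>Lebesgue measure under linear bijections\<close>

text \<open>
  The usual uniqueness argument for Haar measure: evaluating \<open>\<integral>\<integral> B(y) A(y + x) dx dy\<close> in both orders
  for the unit cube \<open>B\<close> shows that \<open>M A\<close> is a multiple of the Lebesgue measure of \<open>A\<close>. The reflected
  cube appears because one of the two shifts changes the sign of \<open>x\<close>.
\<close>
lemma translation_invariant_eq_lborel: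
  fixes M :: "'a::euclidean_space measure"
  assumes sets: "sets M = sets borel" and sf: "sigma_finite_measure M"
    and inv: "\<And>c. distr M borel ((+) c) = M"
    and U: "emeasure M (uminus -` box 0 One) < \<infinity>"
  obtains c where "0 \<le> c" "M = density lborel (\<lambda>_. ennreal c)"
proof -
  interpret M: sigma_finite_measure M by fact
  interpret pair_sigma_finite M "lborel :: 'a measure" ..
  have [measurable_cong]: "sets M = sets borel" by fact
  have shift: "(\<integral>\<^sup>+x. g (c + x) \<partial>M) = (\<integral>\<^sup>+x. g x \<partial>M)" if [measurable]: "g \<in> borel_measurable borel" for g :: "'a \<Rightarrow> ennreal" and c
    by (subst (2) inv[of c, symmetric]) (simp add: nn_integral_distr)
  have shiftl: "(\<integral>\<^sup>+x. g (c + x) \<partial>lborel) = (\<integral>\<^sup>+x. g x \<partial>lborel)" if [measurable]: "g \<in> borel_measurable borel" for g :: "'a \<Rightarrow> ennreal" and c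
    by (subst (2) lborel_distr_plus[of c, symmetric]) (simp add: nn_integral_distr)
  define B where "B = (box 0 One :: 'a set)"
  have [measurable]: "B \<in> sets borel" by (simp add: B_def)
  define c where "c = enn2real (emeasure M (uminus -` B))"
  have mU: "uminus -` B \<in> sets M"
    using measurable_sets[of uminus borel borel B] by (simp add: sets)
  have c: "emeasure M (uminus -` B) = ennreal c" using U by (simp add: c_def B_def less_top)
  have "M = density lborel (\<lambda>_. ennreal c)"
  proof (rule measure_eqI)
    show "sets M = sets (density lborel (\<lambda>_. ennreal c))" by (simp add: sets)
    fix A assume "A \<in> sets M"
    then have [measurable]: "A \<in> sets borel" by (simp add: sets)
    have "emeasure M A = (\<integral>\<^sup>+y. indicator B y * emeasure M A \<partial>lborel)"
      by (simp add: nn_integral_multc B_def)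
    also have "\<dots> = (\<integral>\<^sup>+y. (\<integral>\<^sup>+x. indicator B y * indicator A x \<partial>M) \<partial>lborel)"
      by (intro nn_integral_cong) (simp add: nn_integral_cmult)
    also have "\<dots> = (\<integral>\<^sup>+y. (\<integral>\<^sup>+x. indicator B y * indicator A (y + x) \<partial>M) \<partial>lborel)"
    proof (rule nn_integral_cong)
      fix y :: 'a
      show "(\<integral>\<^sup>+x. indicator B y * indicator A x \<partial>M) = (\<integral>\<^sup>+x. indicator B y * indicator A (y + x) \<partial>M)"
        using shift[of "\<lambda>x. indicator B y * indicator A x" y] by simp
    qed
    also have "\<dots> = (\<integral>\<^sup>+x. (\<integral>\<^sup>+y. indicator B y * indicator A (y + x) \<partial>lborel) \<partial>M)"
      by (rule Fubini') measurable
    also have "\<dots> = (\<integral>\<^sup>+x. (\<integral>\<^sup>+y. indicator B (- x + y) * indicator A y \<partial>lborel) \<partial>M)"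
    proof (rule nn_integral_cong)
      fix x :: 'a
      show "(\<integral>\<^sup>+y. indicator B y * indicator A (y + x) \<partial>lborel) = (\<integral>\<^sup>+y. indicator B (- x + y) * indicator A y \<partial>lborel)"
        using shiftl[of "\<lambda>y. indicator B y * indicator A (y + x)" "-x"] by simp
    qed
    also have "\<dots> = (\<integral>\<^sup>+y. (\<integral>\<^sup>+x. indicator B (- x + y) * indicator A y \<partial>M) \<partial>lborel)"
      by (rule Fubini'[symmetric]) measurable
    also have "\<dots> = (\<integral>\<^sup>+y. ennreal c * indicator A y \<partial>lborel)"
    proof (rule nn_integral_cong)
      fix y :: 'a
      have "(\<integral>\<^sup>+x. indicator B (- x + y) * indicator A y \<partial>M) = (\<integral>\<^sup>+x. indicator B (- x + y) \<partial>M) * indicator A y"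
        by (rule nn_integral_multc) measurable
      also have "(\<integral>\<^sup>+x. indicator B (- x + y) \<partial>M) = (\<integral>\<^sup>+x. indicator B (- x) \<partial>M)"
        using shift[of "\<lambda>x. indicator B (- x + y)" y] by simp
      also have "\<dots> = (\<integral>\<^sup>+x. indicator (uminus -` B) x \<partial>M)"
        by (intro nn_integral_cong) (simp add: indicator_def)
      also have "\<dots> = ennreal c" using mU by (simp add: c)
      finally show "(\<integral>\<^sup>+x. indicator B (- x + y) * indicator A y \<partial>M) = ennreal c * indicator A y" .
    qed
    finally show "emeasure M A = emeasure (density lborel (\<lambda>_. ennreal c)) A"
      by (simp add: emeasure_density)
  qed
  moreover have "0 \<le> c" by (simp add: c_def)
  ultimately show ?thesis using that by blast
qed

lemma measurable_linear:
  fixes f :: "'a::euclidean_space \<Rightarrow> 'b::euclidean_space"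
  assumes "linear f" shows "f \<in> borel_measurable borel"
proof -
  have "bounded_linear f" using assms linear_conv_bounded_linear by blast
  then have "continuous_on UNIV f" by (rule linear_continuous_on)
  then show ?thesis by (rule borel_measurable_continuous_onI)
qed

text \<open>
  The image of Lebesgue measure under a linear bijection is translation invariant, hence a multiple
  of Lebesgue measure. In the two cases below symmetry determines the factor.
\<close>
lemma distr_lborel_linear:
  fixes f :: "'a::euclidean_space \<Rightarrow> 'a"
  assumes lin: "linear f" and inj: "inj f"
  obtains c where "0 \<le> c" "distr lborel borel f = density lborel (\<lambda>_. ennreal c)"
proof -
  note [measurable] = measurable_linear[OF lin]
  have surj: "surj f" using lin inj by (metis linear_injective_imp_surjective)
  define g where "g = inv f"
  have ling: "linear g" using lin inj surj unfolding g_def by (metis inj_linear_imp_inv_linear)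
  have gf: "g (f x) = x" and fg: "f (g x) = x" for x
    using inj surj by (auto simp: g_def surj_f_inv_f)
  let ?M = "distr lborel borel f"
  have bdd: "emeasure ?M A < \<infinity>" if "bounded A" "A \<in> sets borel" for A
  proof -
    have "f -` A = g ` A" using gf fg by (auto simp: image_iff) metis
    moreover have "bounded (g ` A)" using ling that(1) by (simp add: bounded_linear_image linear_linear)
    ultimately show ?thesis using that(2) emeasure_bounded_finite[of "f -` A"] by (simp add: emeasure_distr)
  qed
  have "sigma_finite_measure ?M"
  proof
    show "\<exists>A. countable A \<and> A \<subseteq> sets ?M \<and> \<Union> A = space ?M \<and> (\<forall>a\<in>A. emeasure ?M a \<noteq> \<infinity>)"
    proof (intro exI[of _ "range (\<lambda>n::nat. cball 0 (real n))"] conjI ballI)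
      show "\<Union> (range (\<lambda>n::nat. cball 0 (real n))) = space ?M"
        by (auto simp: real_arch_simple)
      fix a assume "a \<in> range (\<lambda>n::nat. cball (0::'a) (real n))"
      then show "emeasure ?M a \<noteq> \<infinity>" using bdd[of a] by auto
    qed auto
  qed
  moreover have "distr ?M borel ((+) c) = ?M" for c
  proof -
    have "distr ?M borel ((+) c) = distr lborel borel (\<lambda>x. c + f x)"
      by (simp add: distr_distr o_def)
    also have "(\<lambda>x. c + f x) = (\<lambda>x. f (g c + x))"
      using lin fg by (simp add: linear_add)
    also have "distr lborel borel \<dots> = distr (distr lborel borel ((+) (g c))) borel f"
      by (simp add: distr_distr o_def)
    finally show ?thesis by (simp add: lborel_distr_plus)
  qed
  moreover have "emeasure ?M (uminus -` box 0 One) < \<infinity>"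
  proof (rule bdd)
    have "uminus -` box 0 One = uminus ` (box 0 One :: 'a set)"
      by (auto simp: image_iff) (metis minus_minus)
    then show "bounded (uminus -` box 0 (One::'a))" by (simp add: bounded_box)
    show "uminus -` box 0 (One::'a) \<in> sets borel"
      using measurable_sets[of uminus borel borel "box 0 (One::'a)"] by simp
  qed
  ultimately show ?thesis
    using translation_invariant_eq_lborel[of ?M] that by auto
qed

text \<open>
  Applying the map twice squares the factor, so it is 1. This replaces a determinant computation
  for the reversal map of a block move.
\<close>
lemma distr_lborel_involution:
  fixes f :: "'a::euclidean_space \<Rightarrow> 'a"
  assumes lin: "linear f" and inv: "\<And>x. f (f x) = x"
  shows "distr lborel borel f = lborel"
proof -
  note [measurable] = measurable_linear[OF lin]
  have "inj f" using inv by (metis injI)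
  then obtain c where c: "0 \<le> c" "distr lborel borel f = density lborel (\<lambda>_. ennreal c)"
    using distr_lborel_linear[OF lin] by blast
  have "lborel = distr (distr lborel borel f) borel f"
    by (simp add: distr_distr o_def inv distr_id2)
  also have "\<dots> = distr (density lborel (\<lambda>_. ennreal c)) borel f" by (simp add: c)
  finally have "emeasure lborel (box 0 (One::'a)) = emeasure (distr (density lborel (\<lambda>_. ennreal c)) borel f) (box 0 One)"
    by simp
  also have "\<dots> = ennreal c * emeasure lborel (f -` box 0 One)"
  proof -
    have "f -` box 0 One \<in> sets borel"
      using measurable_sets[of f borel borel "box 0 One"] by simp
    then show ?thesis by (simp add: emeasure_distr emeasure_density nn_integral_cmult_indicator)
  qed
  also have "emeasure lborel (f -` box 0 One) = emeasure (distr lborel borel f) (box 0 One)"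
    by (simp add: emeasure_distr)
  also have "\<dots> = ennreal c" by (simp add: c emeasure_density nn_integral_cmult_indicator)
  finally have "ennreal 1 = ennreal (c * c)" using c(1) by (simp add: ennreal_mult)
  then have "c * c = 1" using c(1) by (metis ennreal_inj zero_le_mult_iff zero_le_one)
  then have "c = 1" using c(1) by (metis abs_of_nonneg power2_eq_square power2_eq_1_iff abs_1 abs_minus)
  then show ?thesis using c(2) by (simp add: density_1)
qed

text \<open>The factor is 1 because the unit ball is mapped to itself.\<close>
lemma distr_lborel_orthogonal:
  fixes f :: "'a::euclidean_space \<Rightarrow> 'a"
  assumes f: "orthogonal_transformation f"
  shows "distr lborel borel f = lborel"
proof -
  have lin: "linear f" using f by (rule orthogonal_transformation_linear)
  note [measurable] = measurable_linear[OF lin]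
  obtain c where c: "0 \<le> c" "distr lborel borel f = density lborel (\<lambda>_. ennreal c)"
    using distr_lborel_linear[OF lin orthogonal_transformation_inj[OF f]] by blast
  have "f -` cball 0 1 = cball 0 1" using f by (auto simp: orthogonal_transformation_norm)
  then have "emeasure lborel (cball 0 (1::real) :: 'a set) = emeasure (distr lborel borel f) (cball 0 1)"
    by (simp add: emeasure_distr)
  also have "\<dots> = ennreal c * emeasure lborel (cball 0 1 :: 'a set)"
    by (simp add: c emeasure_density nn_integral_cmult_indicator)
  finally have eq: "emeasure lborel (cball 0 1 :: 'a set) = ennreal c * emeasure lborel (cball 0 1 :: 'a set)" .
  define v where "v = unit_ball_vol (real DIM('a))"
  have v: "v > 0" "emeasure lborel (cball 0 1 :: 'a set) = ennreal v"
    by (simp_all add: v_def emeasure_cball unit_ball_vol_pos)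
  have "ennreal v = ennreal (c * v)" using eq v c(1) by (simp add: ennreal_mult)
  then have "v = c * v" using v(1) c(1) by (metis ennreal_inj less_imp_le mult_nonneg_nonneg)
  then have "c = 1" using v(1) by simp
  then show ?thesis using c(2) by (simp add: density_1)
qed

section \<open>Eigenvalues of selfadjoint matrices\<close>

lemma inner_matrix_sym:
  fixes Q :: "real ^ 'n ^ 'n"
  assumes "transpose Q = Q" shows "x \<bullet> (Q *v y) = (Q *v x) \<bullet> y"
  by (metis assms dot_lmul_matrix inner_commute transpose_matrix_vector)

lemma sym_pos_def_one: "sym_pos_def (mat 1 :: real ^ 'n ^ 'n)"
  by (simp add: sym_pos_def_def transpose_mat)

text \<open>
  A maximiser of the Rayleigh quotient on the compact unit sphere of \<open>V\<close> is an eigenvector: at the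
  maximum, the nonnegative quadratic form \<open>q\<close> vanishes at \<open>v\<close>, so its first variation in the
  direction \<open>a v - T v\<close> vanishes as well. The inner product is the one defined by \<open>B\<close>; it is needed
  for \<open>I - DQ\<close>, which is selfadjoint for \<open>Q\<close> but not symmetric.
\<close>
lemma rayleigh_max:
  fixes B :: "real ^ 'n ^ 'n" and T :: "real ^ 'n \<Rightarrow> real ^ 'n"
  assumes B: "sym_pos_def B" and V: "subspace V" "V \<noteq> {0}" and lin: "linear T"
    and TV: "\<And>v. v \<in> V \<Longrightarrow> T v \<in> V"
    and sa: "\<And>u v. u \<in> V \<Longrightarrow> v \<in> V \<Longrightarrow> T u \<bullet> (B *v v) = u \<bullet> (B *v T v)"
  obtains v a where "v \<in> V" "v \<noteq> 0" "T v = a *\<^sub>R v"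
    "\<And>u. u \<in> V \<Longrightarrow> u \<bullet> (B *v T u) \<le> a * (u \<bullet> (B *v u))"
proof -
  have Bsym: "x \<bullet> (B *v y) = (B *v x) \<bullet> y" for x y
    using B by (intro inner_matrix_sym) (simp add: sym_pos_def_def)
  have Bpos: "x \<noteq> 0 \<Longrightarrow> 0 < x \<bullet> (B *v x)" for x using B by (simp add: sym_pos_def_def)
  define K where "K = sphere 0 1 \<inter> V"
  have K0: "x \<noteq> 0" if "x \<in> K" for x using that by (auto simp: K_def)
  have scale: "(1 / norm x) *\<^sub>R x \<in> K" if "x \<in> V" "x \<noteq> 0" for x
    using that V(1) by (auto simp: K_def subspace_scale)
  have "compact K" unfolding K_def using closed_subspace[OF V(1)] by (intro compact_Int_closed) auto
  moreover obtain v0 where "v0 \<in> V" "v0 \<noteq> 0" using V subspace_0 by blast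
  then have "K \<noteq> {}" using scale by blast
  moreover have "continuous_on K (\<lambda>u. (u \<bullet> (B *v T u)) / (u \<bullet> (B *v u)))"
  proof -
    have "linear (\<lambda>u. B *v T u)" using linear_compose[OF lin matrix_vector_mul_linear[of B]] by (simp add: o_def)
    then show ?thesis using K0 Bpos
      by (intro continuous_intros linear_continuous_on) (auto simp: linear_linear less_imp_neq[symmetric])
  qed
  ultimately obtain v where v: "v \<in> K" and
    max: "\<And>u. u \<in> K \<Longrightarrow> (u \<bullet> (B *v T u)) / (u \<bullet> (B *v u)) \<le> (v \<bullet> (B *v T v)) / (v \<bullet> (B *v v))"
    using continuous_attains_sup[of K "\<lambda>u. (u \<bullet> (B *v T u)) / (u \<bullet> (B *v u))"] by blast
  define a where "a = (v \<bullet> (B *v T v)) / (v \<bullet> (B *v v))"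
  have vV: "v \<in> V" and v0: "v \<noteq> 0" using v K0 by (auto simp: K_def)
  have le: "u \<bullet> (B *v T u) \<le> a * (u \<bullet> (B *v u))" if "u \<in> V" for u
  proof (cases "u = 0")
    case False
    define u' where "u' = (1 / norm u) *\<^sub>R u"
    have "u' \<in> K" using scale that False by (simp add: u'_def)
    from max[OF this] have "(u' \<bullet> (B *v T u')) \<le> a * (u' \<bullet> (B *v u'))"
      using Bpos[OF K0[OF \<open>u' \<in> K\<close>]] by (simp add: a_def pos_divide_le_eq)
    moreover have *: "u = norm u *\<^sub>R u'" using False by (simp add: u'_def)
    have "u \<bullet> (B *v T u) = (norm u)\<^sup>2 * (u' \<bullet> (B *v T u'))" "u \<bullet> (B *v u) = (norm u)\<^sup>2 * (u' \<bullet> (B *v u'))"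
      by (subst (1 2) *, simp add: linear_scale[OF lin] matrix_vector_mult_scaleR power2_eq_square)+
    moreover have "(norm u)\<^sup>2 * c \<le> a * ((norm u)\<^sup>2 * c')" if "c \<le> a * c'" for c c'
      using mult_left_mono[OF that, of "(norm u)\<^sup>2"] by (simp add: mult.left_commute)
    ultimately show ?thesis by metis
  qed simp
  define w where "w = a *\<^sub>R v - T v"
  have wV: "w \<in> V" using V(1) vV TV by (simp add: w_def subspace_diff subspace_scale)
  define q where "q u = a * (u \<bullet> (B *v u)) - u \<bullet> (B *v T u)" for u
  have q0: "q u \<ge> 0" if "u \<in> V" for u using le[OF that] by (simp add: q_def)
  have qv: "q v = 0" using Bpos[OF v0] by (simp add: q_def a_def)
  have exp: "q (v + s *\<^sub>R w) = q v + 2 * s * (w \<bullet> (B *v w)) + s\<^sup>2 * q w" for s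
  proof -
    have 1: "v \<bullet> (B *v T w) = w \<bullet> (B *v T v)"
      using sa[OF vV wV] Bsym[of w "T v"] by (simp add: inner_commute)
    have 2: "v \<bullet> (B *v w) = w \<bullet> (B *v v)" using Bsym[of v w] by (simp add: inner_commute)
    have 3: "w \<bullet> (B *v w) = a * (w \<bullet> (B *v v)) - w \<bullet> (B *v T v)"
      by (subst (2) w_def) (simp add: matrix_vector_mult_diff_distrib matrix_vector_mult_scaleR inner_diff_right)
    show ?thesis unfolding 3 using lin 1 2
      by (simp add: q_def linear_add linear_scale matrix_vector_right_distrib matrix_vector_mult_scaleR
          inner_add_left inner_add_right power2_eq_square algebra_simps)
  qed
  have "w = 0"
  proof (rule ccontr)
    assume "w \<noteq> 0"
    define m where "m = w \<bullet> (B *v w)"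
    have m: "m > 0" using Bpos[OF \<open>w \<noteq> 0\<close>] by (simp add: m_def)
    have qw: "q w \<ge> 0" using q0 wV by simp
    define s where "s = m / (q w + 1)"
    have s: "s > 0" using m qw by (simp add: s_def)
    have "0 \<le> q (v + (- s) *\<^sub>R w)" using V(1) vV wV by (intro q0) (simp add: subspace_diff subspace_scale)
    then have "0 \<le> - 2 * s * m + s\<^sup>2 * q w" unfolding exp qv by (simp add: m_def)
    then have "s * (2 * m) \<le> s * (s * q w)" by (simp add: power2_eq_square)
    then have "2 * m \<le> s * q w" using s by simp
    also have "\<dots> \<le> m" using m qw by (simp add: s_def field_simps)
    finally show False using m by simp
  qed
  then have "T v = a *\<^sub>R v" by (simp add: w_def)
  with vV v0 le show ?thesis using that by blast
qed

text \<open>Eigenvectors for distinct eigenvalues are orthogonal for \<open>B\<close>, hence linearly independent.\<close>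
lemma finite_eigenvalues:
  fixes B :: "real ^ 'n ^ 'n" and T :: "real ^ 'n \<Rightarrow> real ^ 'n"
  assumes B: "sym_pos_def B"
    and sa: "\<And>u v. u \<in> V \<Longrightarrow> v \<in> V \<Longrightarrow> T u \<bullet> (B *v v) = u \<bullet> (B *v T v)"
  shows "finite {a. \<exists>v\<in>V. v \<noteq> 0 \<and> T v = a *\<^sub>R v}" (is "finite ?E")
proof -
  have Bpos: "x \<noteq> 0 \<Longrightarrow> 0 < x \<bullet> (B *v x)" for x using B by (simp add: sym_pos_def_def)
  obtain f where f: "\<And>a. a \<in> ?E \<Longrightarrow> f a \<in> V \<and> f a \<noteq> 0 \<and> T (f a) = a *\<^sub>R f a"
    using bchoice[of ?E "\<lambda>a v. v \<in> V \<and> v \<noteq> 0 \<and> T v = a *\<^sub>R v"] by blast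
  have orth: "f a \<bullet> (B *v f b) = 0" if "a \<in> ?E" "b \<in> ?E" "a \<noteq> b" for a b
  proof -
    have "a * (f a \<bullet> (B *v f b)) = b * (f a \<bullet> (B *v f b))"
      using sa[of "f a" "f b"] f[OF that(1)] f[OF that(2)] by (simp add: matrix_vector_mult_scaleR)
    then show ?thesis using that(3) by simp
  qed
  have inj: "inj_on f ?E"
  proof (rule inj_onI, rule ccontr)
    fix a b assume ab: "a \<in> ?E" "b \<in> ?E" "f a = f b" "a \<noteq> b"
    then have "f a \<bullet> (B *v f a) = 0" using orth[OF ab(1,2,4)] by simp
    then show False using Bpos[of "f a"] f[OF ab(1)] by simp
  qed
  have "independent (f ` ?E)"
    unfolding real_vector.independent_explicit_finite_subsets
  proof (intro allI impI ballI)
    fix t g x assume t: "t \<subseteq> f ` ?E" "finite t" "(\<Sum>x\<in>t. g x *\<^sub>R x) = 0" "x \<in> t"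
    obtain a where a: "a \<in> ?E" "x = f a" using t by blast
    have "(\<Sum>y\<in>t. g y *\<^sub>R y) \<bullet> (B *v x) = (\<Sum>y\<in>t. if y = x then g x * (x \<bullet> (B *v x)) else 0)"
      unfolding inner_sum_left
    proof (rule sum.cong[OF refl])
      fix y assume "y \<in> t"
      then obtain b where b: "b \<in> ?E" "y = f b" using t by blast
      show "g y *\<^sub>R y \<bullet> (B *v x) = (if y = x then g x * (x \<bullet> (B *v x)) else 0)"
        using orth[OF b(1) a(1)] a b by auto
    qed
    then have "g x * (x \<bullet> (B *v x)) = 0" using t by simp
    then show "g x = 0" using Bpos[of x] f[OF a(1)] a(2) by auto
  qed
  then have "finite (f ` ?E)" by (rule finiteI_independent)
  then show ?thesis using inj by (rule finite_imageD)
qed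

text \<open>
  Finiteness of the set of eigenvalues makes the maximum and the minimum in \<open>psi_max_on\<close> and
  \<open>psi_min_on\<close> genuine, and the extreme Rayleigh quotients are eigenvalues. The lower bound follows
  from the upper one for \<open>- A\<close>.
\<close>
lemma eigenvalue_on_bounds:
  fixes B A :: "real ^ 'n ^ 'n"
  assumes B: "sym_pos_def B" and J: "J \<noteq> {}"
    and AJ: "\<And>v i. (\<And>i. i \<notin> J \<Longrightarrow> v $ i = 0) \<Longrightarrow> i \<notin> J \<Longrightarrow> (A *v v) $ i = 0"
    and sa: "\<And>u v. (A *v u) \<bullet> (B *v v) = u \<bullet> (B *v (A *v v))"
    and u: "\<And>i. i \<notin> J \<Longrightarrow> u $ i = 0"
  shows "u \<bullet> (B *v (A *v u)) \<le> psi_max_on J A * (u \<bullet> (B *v u))"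
    and "psi_min_on J A * (u \<bullet> (B *v u)) \<le> u \<bullet> (B *v (A *v u))"
    and "eigenvalue_on J A (psi_max_on J A)" and "eigenvalue_on J A (psi_min_on J A)"
proof -
  define V where "V = {v :: real ^ 'n. \<forall>i. i \<notin> J \<longrightarrow> v $ i = 0}"
  have V: "subspace V" by (auto simp: V_def subspace_def)
  obtain j where "j \<in> J" using J by blast
  then have "axis j 1 \<in> V" "axis j 1 \<noteq> (0 :: real ^ 'n)" by (auto simp: V_def axis_def vec_eq_iff)
  then have V0: "V \<noteq> {0}" by blast
  have AV: "v \<in> V \<Longrightarrow> A *v v \<in> V" for v using AJ by (auto simp: V_def)
  have E: "{a. eigenvalue_on J A a} = {a. \<exists>v\<in>V. v \<noteq> 0 \<and> A *v v = a *\<^sub>R v}"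
    by (auto simp: eigenvalue_on_def V_def)
  have fin: "finite {a. eigenvalue_on J A a}" unfolding E by (rule finite_eigenvalues[OF B]) (rule sa)
  obtain v a where va: "v \<in> V" "v \<noteq> 0" "A *v v = a *\<^sub>R v"
     "\<And>u. u \<in> V \<Longrightarrow> u \<bullet> (B *v (A *v u)) \<le> a * (u \<bullet> (B *v u))"
    using rayleigh_max[OF B V V0 matrix_vector_mul_linear[of A]] AV sa by blast
  obtain w c where wc: "w \<in> V" "w \<noteq> 0" "- (A *v w) = c *\<^sub>R w"
     "\<And>u. u \<in> V \<Longrightarrow> u \<bullet> (B *v (- (A *v u))) \<le> c * (u \<bullet> (B *v u))"
  proof (rule rayleigh_max[OF B V V0, of "\<lambda>u. - (A *v u)"])
    show "linear (\<lambda>u. - (A *v u))" by (intro linear_compose_neg matrix_vector_mul_linear)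
    show "- (A *v v) \<in> V" if "v \<in> V" for v using AV[OF that] V by (simp add: subspace_neg)
    show "- (A *v u) \<bullet> (B *v v) = u \<bullet> (B *v - (A *v v))" for u v
      using sa[of u v] by (simp add: vec.neg)
  qed blast
  have a: "a \<in> {a. eigenvalue_on J A a}" unfolding E using va by blast
  have "A *v w = (- c) *\<^sub>R w" using wc(3) by (metis minus_minus scaleR_minus_left)
  then have c: "- c \<in> {a. eigenvalue_on J A a}" unfolding E using wc by blast
  have uV: "u \<in> V" using u by (simp add: V_def)
  have u0: "0 \<le> u \<bullet> (B *v u)" using B by (cases "u = 0") (auto simp: sym_pos_def_def less_imp_le)
  have "a \<le> psi_max_on J A" unfolding psi_max_on_def using fin a by (rule Max_ge)
  then show "u \<bullet> (B *v (A *v u)) \<le> psi_max_on J A * (u \<bullet> (B *v u))"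
    using va(4)[OF uV] u0 by (meson mult_right_mono order_trans)
  have "psi_min_on J A \<le> - c" unfolding psi_min_on_def using fin c by (rule Min_le)
  then have "psi_min_on J A * (u \<bullet> (B *v u)) \<le> (- c) * (u \<bullet> (B *v u))" using u0 by (rule mult_right_mono)
  also have "\<dots> \<le> u \<bullet> (B *v (A *v u))" using wc(4)[OF uV] by (simp add: vec.neg)
  finally show "psi_min_on J A * (u \<bullet> (B *v u)) \<le> u \<bullet> (B *v (A *v u))" .
  show "eigenvalue_on J A (psi_max_on J A)"
    using Max_in[OF fin] a unfolding psi_max_on_def by blast
  show "eigenvalue_on J A (psi_min_on J A)"
    using Min_in[OF fin] a unfolding psi_min_on_def by blast
qed

text \<open>
  A largest orthonormal set of eigenvectors spans: its orthogonal complement is invariant, so it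
  would otherwise contain one more eigenvector.
\<close>
lemma spectral_theorem:
  fixes A :: "real ^ 'n ^ 'n"
  assumes A: "transpose A = A"
  obtains e :: "'n \<Rightarrow> real ^ 'n" and a :: "'n \<Rightarrow> real"
  where "\<And>i j. e i \<bullet> e j = (if i = j then 1 else 0)" "\<And>i. A *v e i = a i *\<^sub>R e i"
proof -
  define P where "P S \<longleftrightarrow> finite S \<and> pairwise orthogonal S \<and> (\<forall>v\<in>S. norm v = 1 \<and> (\<exists>c. A *v v = c *\<^sub>R v))" for S :: "(real ^ 'n) set"
  have indep: "independent S" if "P S" for S
  proof (rule pairwise_orthogonal_independent)
    show "pairwise orthogonal S" using that by (simp add: P_def)
    show "0 \<notin> S" using that unfolding P_def by (metis norm_zero zero_neq_one)
  qed
  have "P {}" by (simp add: P_def)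
  moreover have "\<forall>S. P S \<longrightarrow> card S < Suc (CARD('n))"
    using indep independent_bound[where 'a = "real ^ 'n"] by (auto simp: less_Suc_eq_le)
  ultimately obtain S where S: "P S" "\<And>S'. P S' \<Longrightarrow> card S' \<le> card S"
    using ex_has_greatest_nat[of P "{}" card] by blast
  have "span S = UNIV"
  proof (rule ccontr)
    assume "span S \<noteq> UNIV"
    then have "span S \<subset> UNIV" by auto
    then obtain x where x: "x \<noteq> 0" "\<And>y. y \<in> span S \<Longrightarrow> orthogonal x y"
      using orthogonal_to_subspace_exists_gen[of S UNIV] by (metis span_UNIV UNIV_I)
    define V where "V = {v. \<forall>s\<in>S. orthogonal v s}"
    have V: "subspace V" by (auto simp: V_def subspace_def orthogonal_def inner_add_left)
    have "x \<in> V" using x by (auto simp: V_def span_base)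
    then have V0: "V \<noteq> {0}" using x by auto
    have AV: "A *v v \<in> V" if "v \<in> V" for v
    proof -
      have "(A *v v) \<bullet> s = 0" if "s \<in> S" for s
      proof -
        obtain c where "A *v s = c *\<^sub>R s" using S(1) \<open>s \<in> S\<close> by (auto simp: P_def)
        then show ?thesis using inner_matrix_sym[OF A, of v s] \<open>v \<in> V\<close> \<open>s \<in> S\<close>
          by (simp add: V_def orthogonal_def)
      qed
      then show ?thesis by (simp add: V_def orthogonal_def)
    qed
    obtain v c where v: "v \<in> V" "v \<noteq> 0" "A *v v = c *\<^sub>R v"
      using rayleigh_max[OF sym_pos_def_one V V0 matrix_vector_mul_linear[of A]] AV inner_matrix_sym[OF A]
      by (metis matrix_vector_mul_lid)
    define v' where "v' = (1 / norm v) *\<^sub>R v"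
    have v': "v' \<in> V" "norm v' = 1" "A *v v' = c *\<^sub>R v'"
      using v V by (auto simp: v'_def subspace_scale matrix_vector_mult_scaleR)
    have "v' \<notin> S" using v'(1,2) by (auto simp: V_def orthogonal_def)
    moreover have "P (insert v' S)"
      using S(1) v' by (auto simp: P_def V_def pairwise_insert orthogonal_commute)
    ultimately show False using S(2)[of "insert v' S"] S(1) by (simp add: P_def)
  qed
  then have "card S = CARD('n)"
    using indep[OF S(1)] dim_eq_card_independent[of S] by (metis dim_span dim_UNIV DIM_cart DIM_real mult.right_neutral)
  then obtain e where e: "bij_betw e (UNIV :: 'n set) S"
    using S(1) finite_same_card_bij[of "UNIV :: 'n set" S] by (auto simp: P_def)
  have eS: "e i \<in> S" for i using e by (auto simp: bij_betw_def)
  have "\<forall>i. \<exists>c. A *v e i = c *\<^sub>R e i" using S(1) eS by (auto simp: P_def)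
  then obtain a where "\<And>i. A *v e i = a i *\<^sub>R e i" by metis
  moreover have "e i \<bullet> e j = (if i = j then 1 else 0)" for i j
  proof (cases "i = j")
    case True then show ?thesis using S(1) eS[of j] by (auto simp: P_def norm_eq_1)
  next
    case False
    then have "e i \<noteq> e j" using e by (auto simp: bij_betw_def inj_on_def)
    then show ?thesis using S(1) eS False by (auto simp: P_def pairwise_def orthogonal_def)
  qed
  ultimately show ?thesis using that by blast
qed

section \<open>Gaussian measures in an orthonormal basis\<close>

definition orthonormal :: "('n::finite \<Rightarrow> real ^ 'n) \<Rightarrow> bool" where
  "orthonormal e \<longleftrightarrow> (\<forall>i j. e i \<bullet> e j = (if i = j then 1 else 0))"

abbreviation std_gauss :: "(real ^ 'n) measure" where
  "std_gauss \<equiv> gauss_measure 0 (mat 1)"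

lemma nn_integral_std_normal_exp:
  assumes B: "B > 0"
  shows "(\<integral>\<^sup>+z. ennreal (std_normal_density z * exp (c * z - (B - 1) / 2 * z\<^sup>2)) \<partial>lborel)
         = ennreal (exp (c\<^sup>2 / (2 * B)) / sqrt B)"
proof -
  have "std_normal_density z * exp (c * z - (B - 1) / 2 * z\<^sup>2)
      = exp (c\<^sup>2 / (2 * B)) / sqrt B * normal_density (c / B) (1 / sqrt B) z" for z
  proof -
    have "- z\<^sup>2 / 2 + (c * z - (B - 1) / 2 * z\<^sup>2) = c\<^sup>2 / (2 * B) - (z - c / B)\<^sup>2 / (2 * (1 / sqrt B)\<^sup>2)"
      using B by (simp add: field_simps power2_eq_square)
    then have "exp (- z\<^sup>2 / 2) * exp (c * z - (B - 1) / 2 * z\<^sup>2)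
        = exp (c\<^sup>2 / (2 * B)) * exp (- (z - c / B)\<^sup>2 / (2 * (1 / sqrt B)\<^sup>2))"
      by (simp add: exp_add[symmetric])
    moreover have "sqrt (2 * pi * (1 / sqrt B)\<^sup>2) = sqrt (2 * pi) / sqrt B"
      using B by (simp add: power_divide real_sqrt_mult real_sqrt_divide)
    ultimately show ?thesis using B by (simp add: std_normal_density_def normal_density_def)
  qed
  then have "(\<integral>\<^sup>+z. ennreal (std_normal_density z * exp (c * z - (B - 1) / 2 * z\<^sup>2)) \<partial>lborel)
      = ennreal (exp (c\<^sup>2 / (2 * B)) / sqrt B) * (\<integral>\<^sup>+z. ennreal (normal_density (c / B) (1 / sqrt B) z) \<partial>lborel)"
    using B by (subst nn_integral_cmult[symmetric]) (simp_all add: ennreal_mult[symmetric])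
  also have "(\<integral>\<^sup>+z. ennreal (normal_density (c / B) (1 / sqrt B) z) \<partial>lborel) = 1"
    using B by (simp add: nn_integral_eq_integral)
  finally show ?thesis by simp
qed

context
  fixes e :: "'n::finite \<Rightarrow> real ^ 'n"
  assumes on: "orthonormal e"
begin

lemma orthonormal_inner: "e i \<bullet> e j = (if i = j then 1 else 0)"
  using on by (simp add: orthonormal_def)

lemma orthonormal_inner_sum [simp]: "e i \<bullet> (\<Sum>j\<in>UNIV. c j *\<^sub>R e j) = c i"
  by (simp add: inner_sum_right orthonormal_inner if_distrib[of "\<lambda>x. _ * x"] cong: if_cong)

lemma orthonormal_inner_sum_on: "e i \<bullet> (\<Sum>j\<in>I. c j *\<^sub>R e j) = (if i \<in> I then c i else 0)"
  by (simp add: inner_sum_right orthonormal_inner if_distrib[of "\<lambda>x. _ * x"] cong: if_cong)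

lemma orthonormal_expansion: "(\<Sum>i\<in>UNIV. (e i \<bullet> x) *\<^sub>R e i) = x"
proof -
  have inj: "inj e" using orthonormal_inner by (metis injI zero_neq_one)
  have "independent (range e)"
  proof (rule pairwise_orthogonal_independent)
    show "pairwise orthogonal (range e)"
      by (auto simp: pairwise_def orthogonal_def orthonormal_inner)
    show "0 \<notin> range e"
      using orthonormal_inner by (metis imageE inner_zero_left zero_neq_one)
  qed
  moreover have "card (range e) = DIM(real ^ 'n)" using inj by (simp add: card_image)
  ultimately have "span (range e) = UNIV"
    using card_ge_dim_independent[of "range e" UNIV] by (auto simp: dim_UNIV)
  moreover have "x - (\<Sum>i\<in>UNIV. (e i \<bullet> x) *\<^sub>R e i) = 0 " (is "?z = 0")
  proof -
    have "orthogonal ?z y" if "y \<in> range e" for y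
      using that by (auto simp: orthogonal_def inner_diff_left inner_commute[of _ "e _"])
    then have "orthogonal ?z y" if "y \<in> span (range e)" for y
      using orthogonal_to_span that by blast
    then have "orthogonal ?z ?z" using calculation by blast
    then show ?thesis by (simp add: orthogonal_self)
  qed
  ultimately show ?thesis by simp
qed

lemma orthonormal_parseval: "x \<bullet> y = (\<Sum>i\<in>UNIV. (e i \<bullet> x) * (e i \<bullet> y))"
proof -
  have "x \<bullet> y = (\<Sum>i\<in>UNIV. (e i \<bullet> x) *\<^sub>R e i) \<bullet> y" by (simp add: orthonormal_expansion)
  then show ?thesis by (simp add: inner_sum_left)
qed

definition rot where "rot \<eta> = (\<Sum>i\<in>UNIV. (\<eta> $ i) *\<^sub>R e i)"

lemma inner_rot [simp]: "e i \<bullet> rot \<eta> = \<eta> $ i" by (simp add: rot_def)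

lemma orthogonal_rot: "orthogonal_transformation rot"
proof -
  have "linear rot" unfolding rot_def
    by (auto intro!: linearI simp: scaleR_left_distrib sum.distrib scaleR_sum_right)
  moreover have "rot v \<bullet> rot w = v \<bullet> w" for v w
    unfolding orthonormal_parseval[of "rot v"] inner_rot by (simp add: inner_vec_def)
  ultimately show ?thesis by (simp add: orthogonal_transformation_def)
qed

lemma measurable_rot [measurable]: "rot \<in> borel_measurable borel"
  by (rule measurable_linear[OF orthogonal_transformation_linear[OF orthogonal_rot]])

lemma distr_lborel_rot: "distr lborel borel rot = lborel"
  by (rule distr_lborel_orthogonal[OF orthogonal_rot])

lemma nn_integral_lborel_rot:
  "F \<in> borel_measurable borel \<Longrightarrow> (\<integral>\<^sup>+x. F x \<partial>lborel) = (\<integral>\<^sup>+\<eta>. F (rot \<eta>) \<partial>lborel)"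
  by (subst distr_lborel_rot[symmetric]) (simp add: nn_integral_distr)

end

lemma nn_integral_lborel_cart_prod:
  fixes f :: "'n::finite \<Rightarrow> real \<Rightarrow> ennreal"
  assumes [measurable]: "\<And>i. f i \<in> borel_measurable borel"
  shows "(\<integral>\<^sup>+x. (\<Prod>i\<in>UNIV. f i (x $ i)) \<partial>(lborel :: (real ^ 'n) measure)) = (\<Prod>i\<in>UNIV. \<integral>\<^sup>+z. f i z \<partial>lborel)"
proof -
  define g where "g b = f (THE i. b = axis i (1::real))" for b :: "real ^ 'n"
  have g: "g (axis i 1) = f i" for i by (simp add: g_def axis_eq_axis)
  have B: "(Basis :: (real ^ 'n) set) = range (\<lambda>i. axis i 1)" by (auto simp: Basis_vec_def)
  have inj: "inj (\<lambda>i::'n. axis i (1::real))" by (simp add: inj_on_def axis_eq_axis)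
  have m: "g b \<in> borel_measurable borel" if "b \<in> Basis" for b using that by (auto simp: B g)
  have "(\<integral>\<^sup>+x. (\<Prod>b\<in>Basis. g b (x \<bullet> b)) \<partial>(lborel :: (real ^ 'n) measure)) = (\<Prod>b\<in>Basis. \<integral>\<^sup>+z. g b z \<partial>lborel)"
    by (rule nn_integral_lborel_prod[OF m]) simp_all
  then show ?thesis
    by (simp add: B prod.reindex[OF inj] g inner_axis)
qed

lemma nn_integral_lborel_orthonormal_prod:
  fixes f :: "'n::finite \<Rightarrow> real \<Rightarrow> ennreal"
  assumes on: "orthonormal e" and [measurable]: "\<And>i. f i \<in> borel_measurable borel"
  shows "(\<integral>\<^sup>+x. (\<Prod>i\<in>UNIV. f i (e i \<bullet> (x - m))) \<partial>lborel) = (\<Prod>i\<in>UNIV. \<integral>\<^sup>+z. f i z \<partial>lborel)"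
proof -
  have "(\<integral>\<^sup>+x. (\<Prod>i\<in>UNIV. f i (e i \<bullet> (x - m))) \<partial>lborel)
      = (\<integral>\<^sup>+x. (\<Prod>i\<in>UNIV. f i (e i \<bullet> (x - m))) \<partial>distr lborel borel ((+) m))"
    by (simp add: lborel_distr_plus)
  also have "\<dots> = (\<integral>\<^sup>+x. (\<Prod>i\<in>UNIV. f i (e i \<bullet> x)) \<partial>lborel)"
    by (simp add: nn_integral_distr)
  also have "\<dots> = (\<integral>\<^sup>+\<eta>. (\<Prod>i\<in>UNIV. f i (\<eta> $ i)) \<partial>lborel)"
    by (subst nn_integral_lborel_rot[OF on]) (simp_all add: inner_rot[OF on])
  finally show ?thesis by (simp add: nn_integral_lborel_cart_prod)
qed

text \<open>
  The matrix with columns \<open>e i\<close> is orthogonal and conjugates \<open>Q\<close> to a diagonal matrix.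
\<close>
lemma det_eq_prod_eigenvalues:
  fixes Q :: "real ^ 'n ^ 'n"
  assumes on: "orthonormal e" and eig: "\<And>i. Q *v e i = a i *\<^sub>R e i"
  shows "det Q = (\<Prod>i\<in>UNIV. a i)"
proof -
  define P where "P = (\<chi> i j. e j $ i)"
  define A where "A = (\<chi> i j. if i = j then a i else 0)"
  have "transpose P ** P = mat 1"
    using on by (auto simp: vec_eq_iff matrix_matrix_mult_def transpose_def P_def mat_def orthonormal_def inner_vec_def)
  then have "det P \<noteq> 0" by (metis det_I det_mul mult_zero_right zero_neq_one)
  moreover have "Q ** P = P ** A"
  proof -
    have "(Q ** P) $ i $ j = (P ** A) $ i $ j" for i j
    proof -
      have "(Q ** P) $ i $ j = (Q *v e j) $ i" by (simp add: matrix_matrix_mult_def matrix_vector_mult_def P_def)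
      also have "\<dots> = a j * e j $ i" by (simp add: eig)
      also have "\<dots> = (P ** A) $ i $ j"
        by (simp add: matrix_matrix_mult_def P_def A_def if_distrib[of "\<lambda>x. _ * x"] cong: if_cong)
      finally show ?thesis .
    qed
    then show ?thesis by (simp add: vec_eq_iff)
  qed
  then have "det Q * det P = det P * det A" by (metis det_mul)
  moreover have "det A = (\<Prod>i\<in>UNIV. a i)" by (subst det_diagonal) (auto simp: A_def)
  ultimately show ?thesis by simp
qed

lemma eigenbasis_quadratic_form:
  fixes Q :: "real ^ 'n ^ 'n"
  assumes on: "orthonormal e" and eig: "\<And>i. Q *v e i = a i *\<^sub>R e i" and Q: "transpose Q = Q"
  shows "x \<bullet> (Q *v x) = (\<Sum>i\<in>UNIV. a i * (e i \<bullet> x)\<^sup>2)"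
proof -
  have "e i \<bullet> (Q *v x) = a i * (e i \<bullet> x)" for i by (simp add: inner_matrix_sym[OF Q] eig)
  then show ?thesis by (subst orthonormal_parseval[OF on]) (simp add: power2_eq_square algebra_simps)
qed

lemma gauss_density_eq_prod:
  fixes Q :: "real ^ 'n ^ 'n"
  assumes on: "orthonormal e" and eig: "\<And>i. Q *v e i = a i *\<^sub>R e i" and Q: "transpose Q = Q"
    and a: "\<And>i. 0 < a i"
  shows "gauss_density \<mu> Q x = (\<Prod>i\<in>UNIV. normal_density 0 (1 / sqrt (a i)) (e i \<bullet> (x - \<mu>)))"
proof -
  have "normal_density 0 (1 / sqrt (a i)) z = sqrt (a i / (2 * pi)) * exp (- (a i * z\<^sup>2) / 2)" for i z
    using a[of i] by (simp add: normal_density_def power_divide real_sqrt_divide)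
  then have "(\<Prod>i\<in>UNIV. normal_density 0 (1 / sqrt (a i)) (e i \<bullet> (x - \<mu>)))
     = (\<Prod>i\<in>UNIV. sqrt (a i / (2 * pi))) * exp (\<Sum>i\<in>UNIV. - (a i * (e i \<bullet> (x - \<mu>))\<^sup>2) / 2)"
    by (simp add: prod.distrib exp_sum)
  also have "(\<Prod>i\<in>UNIV. sqrt (a i / (2 * pi))) = sqrt (det Q / (2 * pi) ^ CARD('n))"
  proof -
    have "(\<Prod>i\<in>S. sqrt (f i)) = sqrt (\<Prod>i\<in>S. f i)" for S :: "'n set" and f
      by (induction S rule: infinite_finite_induct) (auto simp: real_sqrt_mult)
    then show ?thesis by (simp add: prod_dividef det_eq_prod_eigenvalues[OF on eig])
  qed
  also have "(\<Sum>i\<in>UNIV. - (a i * (e i \<bullet> (x - \<mu>))\<^sup>2) / 2) = - ((x - \<mu>) \<bullet> (Q *v (x - \<mu>))) / 2"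
    by (simp add: eigenbasis_quadratic_form[OF on eig Q] sum_divide_distrib[symmetric] sum_negf)
  finally show ?thesis by (simp add: gauss_density_def)
qed

lemma sym_pos_def_eigenbasis:
  fixes Q :: "real ^ 'n ^ 'n"
  assumes Q: "sym_pos_def Q"
  obtains e a where "orthonormal e" "\<And>i. Q *v e i = a i *\<^sub>R e i" "\<And>i. 0 < a i"
proof -
  have tQ: "transpose Q = Q" using Q by (simp add: sym_pos_def_def)
  have "\<exists>e a. orthonormal e \<and> (\<forall>i. Q *v e i = a i *\<^sub>R e i)"
    unfolding orthonormal_def by (rule spectral_theorem[OF tQ]) blast
  then obtain e a where ea: "orthonormal e" "\<And>i. Q *v e i = a i *\<^sub>R e i" by blast
  have "0 < a i" for i
  proof -
    have "e i \<bullet> e i = 1" using ea(1) by (simp add: orthonormal_def)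
    then have "e i \<noteq> 0" by auto
    then have "0 < e i \<bullet> (Q *v e i)" using Q by (simp add: sym_pos_def_def)
    then show ?thesis using \<open>e i \<bullet> e i = 1\<close> by (simp add: ea)
  qed
  then show ?thesis using that ea by blast
qed

lemma measurable_matrix_vector_mult [measurable]:
  "(\<lambda>x. (Q :: real ^ 'n ^ 'm) *v x) \<in> borel_measurable borel"
  by (intro borel_measurable_continuous_onI matrix_vector_mult_linear_continuous_on)

lemma measurable_gauss_density [measurable]: "gauss_density \<mu> Q \<in> borel_measurable borel"
  unfolding gauss_density_def by measurable

lemma sets_gauss_measure [simp, measurable_cong]: "sets (gauss_measure \<mu> Q) = sets borel"
  by (simp add: gauss_measure_def)

lemma space_gauss_measure [simp]: "space (gauss_measure \<mu> Q) = UNIV"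
  by (simp add: gauss_measure_def)

lemma prob_space_gauss_measure:
  fixes Q :: "real ^ 'n ^ 'n"
  assumes Q: "sym_pos_def Q"
  shows "prob_space (gauss_measure \<mu> Q)"
proof
  obtain e a where ea: "orthonormal e" "\<And>i. Q *v e i = a i *\<^sub>R e i" "\<And>i. 0 < a i"
    using sym_pos_def_eigenbasis[OF Q] by blast
  have "emeasure (gauss_measure \<mu> Q) (space (gauss_measure \<mu> Q)) = (\<integral>\<^sup>+x. ennreal (gauss_density \<mu> Q x) \<partial>lborel)"
    by (simp add: gauss_measure_def emeasure_density)
  also have "\<dots> = (\<integral>\<^sup>+x. (\<Prod>i\<in>UNIV. ennreal (normal_density 0 (1 / sqrt (a i)) (e i \<bullet> (x - \<mu>)))) \<partial>lborel)"
    using Q by (simp add: gauss_density_eq_prod[OF ea(1,2) _ ea(3)] sym_pos_def_def prod_ennreal)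
  also have "\<dots> = (\<Prod>i\<in>UNIV. \<integral>\<^sup>+z. ennreal (normal_density 0 (1 / sqrt (a i)) z) \<partial>lborel)"
    by (rule nn_integral_lborel_orthonormal_prod[OF ea(1)]) simp
  also have "\<dots> = 1" using ea(3) by (simp add: nn_integral_eq_integral)
  finally show "emeasure (gauss_measure \<mu> Q) (space (gauss_measure \<mu> Q)) = 1" .
qed

lemma gauss_density_pos:
  fixes Q :: "real ^ 'n ^ 'n"
  assumes Q: "sym_pos_def Q" shows "0 < gauss_density \<mu> Q x"
proof -
  obtain e a where ea: "orthonormal e" "\<And>i. Q *v e i = a i *\<^sub>R e i" "\<And>i. 0 < a i"
    using sym_pos_def_eigenbasis[OF Q] by blast
  then show ?thesis using Q
    by (auto simp: gauss_density_eq_prod[OF ea(1,2) _ ea(3)] sym_pos_def_def intro!: prod_pos normal_density_pos)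
qed

lemma std_gauss_density_eq_prod:
  "orthonormal e \<Longrightarrow> gauss_density 0 (mat 1) \<xi> = (\<Prod>i\<in>UNIV. std_normal_density (e i \<bullet> \<xi>))"
  by (subst gauss_density_eq_prod[of e _ "\<lambda>_. 1"]) (simp_all add: transpose_mat)

text \<open>
  The coordinates of a standard normal vector in any orthonormal basis are independent and standard
  normal. This reduces every Gaussian integral below to one dimension.
\<close>
lemma nn_integral_std_gauss_prod:
  assumes on: "orthonormal e" and [measurable]: "\<And>i. \<phi> i \<in> borel_measurable borel"
  shows "(\<integral>\<^sup>+\<xi>. (\<Prod>i\<in>UNIV. \<phi> i (e i \<bullet> \<xi>)) \<partial>std_gauss)
       = (\<Prod>i\<in>UNIV. \<integral>\<^sup>+z. ennreal (std_normal_density z) * \<phi> i z \<partial>lborel)"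
proof -
  have "(\<integral>\<^sup>+\<xi>. (\<Prod>i\<in>UNIV. \<phi> i (e i \<bullet> \<xi>)) \<partial>std_gauss)
      = (\<integral>\<^sup>+\<xi>. (\<Prod>i\<in>UNIV. ennreal (std_normal_density (e i \<bullet> (\<xi> - 0))) * \<phi> i (e i \<bullet> (\<xi> - 0))) \<partial>lborel)"
    unfolding gauss_measure_def
    by (subst nn_integral_density) (simp_all add: std_gauss_density_eq_prod[OF on] prod.distrib prod_ennreal)
  also have "\<dots> = (\<Prod>i\<in>UNIV. \<integral>\<^sup>+z. ennreal (std_normal_density z) * \<phi> i z \<partial>lborel)"
    by (rule nn_integral_lborel_orthonormal_prod[OF on]) simp
  finally show ?thesis .
qed

section \<open>Block moves and their reversal\<close>

text \<open>
  An orthonormal basis of eigenvectors of one diagonal block of \<open>Q\<close>, padded by zeros. The indices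
  with \<open>a i > 0\<close> belong to the block; the eigenvectors of the padding have \<open>a i = 0\<close> and play the part
  of the other coordinates. In this basis a block move acts separately on each index.
\<close>
locale eigenblock =
  fixes \<mu> :: "real ^ 'n" and Q :: "real ^ 'n ^ 'n" and e :: "'n \<Rightarrow> real ^ 'n" and a :: "'n \<Rightarrow> real"
  assumes Q: "sym_pos_def Q" and on: "orthonormal e" and a_nonneg: "\<And>i. 0 \<le> a i"
    and blk: "\<And>i k. 0 < a i \<Longrightarrow> 0 < a k \<Longrightarrow> e i \<bullet> (Q *v e k) = (if i = k then a i else 0)"
begin

definition I where "I = {i. 0 < a i}"
text \<open>
  The component of \<open>-\<nabla> log \<pi>(x)\<close> along \<open>e i\<close>. In the coordinates \<open>w i\<close> every block move is
  one-dimensional, see \<open>w_step\<close>.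
\<close>
definition w where "w i x = e i \<bullet> (Q *v (x - \<mu>))"
definition comb where "comb c = (\<Sum>i\<in>I. c i *\<^sub>R e i)"
text \<open>
  A move with drift \<open>-u i w i\<close> and noise size \<open>\<beta> i\<close> in direction \<open>e i\<close>. Three choices matter:
  \<open>u = 1/a\<close>, \<open>\<beta> = 1/\<surd>a\<close> is the Gibbs update; \<open>u = h\<close>, \<open>\<beta> = \<surd>(2h - a h\<^sup>2)\<close> the
  Ornstein--Uhlenbeck update; \<open>u = h\<close>, \<open>\<beta> = \<surd>(2h)\<close> the MALA proposal.
\<close>
definition step where "step u \<beta> x \<xi> = x + comb (\<lambda>i. \<beta> i * (e i \<bullet> \<xi>) - u i * w i x)"
text \<open>The noise that carries \<open>step u \<beta> x \<xi>\<close> back to \<open>x\<close> (\<open>step_rnoise\<close>).\<close>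
definition rnoise where
  "rnoise u \<beta> x \<xi> = \<xi> + comb (\<lambda>i. u i * (w i x + w i (step u \<beta> x \<xi>)) / \<beta> i - 2 * (e i \<bullet> \<xi>))"

lemma Q_sym: "x \<bullet> (Q *v y) = (Q *v x) \<bullet> y"
  using Q by (intro inner_matrix_sym) (simp add: sym_pos_def_def)

lemma Q_nonneg: "0 \<le> x \<bullet> (Q *v x)"
  using Q by (cases "x = 0") (auto simp: sym_pos_def_def less_imp_le)

lemma comb_add: "comb c + comb c' = comb (\<lambda>i. c i + c' i)"
  by (simp add: comb_def scaleR_left_distrib sum.distrib)

lemma comb_scale: "r *\<^sub>R comb c = comb (\<lambda>i. r * c i)"
  by (simp add: comb_def scaleR_sum_right)

lemma comb_zero: "(\<And>i. i \<in> I \<Longrightarrow> c i = 0) \<Longrightarrow> comb c = 0"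
  by (simp add: comb_def)

lemma comb_cong: "(\<And>i. i \<in> I \<Longrightarrow> c i = c' i) \<Longrightarrow> comb c = comb c'"
  by (simp add: comb_def)

lemma inner_comb: "e k \<bullet> comb c = (if k \<in> I then c k else 0)"
  unfolding comb_def by (rule orthonormal_inner_sum_on[OF on])

lemma inner_Q_comb: "k \<in> I \<Longrightarrow> e k \<bullet> (Q *v comb c) = a k * c k"
proof -
  assume k: "k \<in> I"
  have "e k \<bullet> (Q *v comb c) = (\<Sum>i\<in>I. c i * (e k \<bullet> (Q *v e i)))"
    by (simp add: comb_def vec.sum vec.scale matrix_vector_mult_scaleR inner_sum_right)
  also have "\<dots> = (\<Sum>i\<in>I. if i = k then a k * c k else 0)"
    using k by (intro sum.cong) (auto simp: I_def blk)
  finally show ?thesis using k by simp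
qed

lemma w_comb: "k \<in> I \<Longrightarrow> w k (x + comb c) = w k x + a k * c k"
  by (simp add: w_def matrix_vector_right_distrib matrix_vector_mult_diff_distrib inner_diff_right
      inner_add_right inner_Q_comb)

lemma w_step: "k \<in> I \<Longrightarrow> w k (step u \<beta> x \<xi>) = (1 - a k * u k) * w k x + a k * \<beta> k * (e k \<bullet> \<xi>)"
  by (simp add: step_def w_comb algebra_simps)

lemma inner_rnoise:
  "k \<in> I \<Longrightarrow> e k \<bullet> rnoise u \<beta> x \<xi> = u k * (w k x + w k (step u \<beta> x \<xi>)) / \<beta> k - e k \<bullet> \<xi>"
  by (simp add: rnoise_def inner_add_right inner_comb)

lemma step_rnoise:
  assumes "\<forall>i\<in>I. \<beta> i \<noteq> 0"
  shows "step u \<beta> (step u \<beta> x \<xi>) (rnoise u \<beta> x \<xi>) = x"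
proof -
  define y where "y = step u \<beta> x \<xi>"
  have "step u \<beta> y (rnoise u \<beta> x \<xi>)
    = x + (comb (\<lambda>i. \<beta> i * (e i \<bullet> \<xi>) - u i * w i x) + comb (\<lambda>i. \<beta> i * (e i \<bullet> rnoise u \<beta> x \<xi>) - u i * w i y))"
    by (subst step_def) (simp add: y_def step_def)
  also have "comb (\<lambda>i. \<beta> i * (e i \<bullet> \<xi>) - u i * w i x) + comb (\<lambda>i. \<beta> i * (e i \<bullet> rnoise u \<beta> x \<xi>) - u i * w i y) = 0"
    unfolding comb_add using assms by (intro comb_zero) (simp add: inner_rnoise y_def[symmetric] field_simps)
  finally show ?thesis by (simp add: y_def)
qed

lemma rnoise_rnoise:
  assumes "\<forall>i\<in>I. \<beta> i \<noteq> 0"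
  shows "rnoise u \<beta> (step u \<beta> x \<xi>) (rnoise u \<beta> x \<xi>) = \<xi>"
proof -
  define y where "y = step u \<beta> x \<xi>"
  have s: "step u \<beta> y (rnoise u \<beta> x \<xi>) = x" using step_rnoise[OF assms] by (simp add: y_def)
  have "rnoise u \<beta> y (rnoise u \<beta> x \<xi>) = \<xi> + (comb (\<lambda>i. u i * (w i x + w i y) / \<beta> i - 2 * (e i \<bullet> \<xi>))
       + comb (\<lambda>i. u i * (w i y + w i x) / \<beta> i - 2 * (e i \<bullet> rnoise u \<beta> x \<xi>)))"
    by (subst rnoise_def) (simp add: s, simp add: rnoise_def y_def)
  also have "comb (\<lambda>i. u i * (w i x + w i y) / \<beta> i - 2 * (e i \<bullet> \<xi>))
       + comb (\<lambda>i. u i * (w i y + w i x) / \<beta> i - 2 * (e i \<bullet> rnoise u \<beta> x \<xi>)) = 0"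
    unfolding comb_add by (intro comb_zero) (simp add: inner_rnoise y_def[symmetric] algebra_simps)
  finally show ?thesis by (simp add: y_def)
qed

lemma quad_comb:
  "(x + comb c - \<mu>) \<bullet> (Q *v (x + comb c - \<mu>)) = (x - \<mu>) \<bullet> (Q *v (x - \<mu>)) + (\<Sum>i\<in>I. 2 * c i * w i x + a i * (c i)\<^sup>2)"
proof -
  have "x + comb c - \<mu> = (x - \<mu>) + comb c" by simp
  moreover have "(u + v) \<bullet> (Q *v (u + v)) = u \<bullet> (Q *v u) + 2 * (v \<bullet> (Q *v u)) + v \<bullet> (Q *v v)" for u v
    using Q_sym[of u v] by (simp add: matrix_vector_right_distrib inner_add_left inner_add_right inner_commute)
  ultimately have "(x + comb c - \<mu>) \<bullet> (Q *v (x + comb c - \<mu>))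
    = (x - \<mu>) \<bullet> (Q *v (x - \<mu>)) + 2 * (comb c \<bullet> (Q *v (x - \<mu>))) + comb c \<bullet> (Q *v comb c)"
    by (simp only:)
  moreover have "comb c \<bullet> (Q *v (x - \<mu>)) = (\<Sum>i\<in>I. c i * w i x)"
    by (simp add: comb_def inner_sum_left w_def)
  moreover have "comb c \<bullet> (Q *v comb c) = (\<Sum>i\<in>I. a i * (c i)\<^sup>2)"
    by (subst comb_def) (simp add: inner_sum_left inner_Q_comb power2_eq_square mult_ac)
  ultimately show ?thesis by (simp add: sum.distrib sum_distrib_left mult.assoc)
qed

lemma inner_self_comb: "(\<xi> + comb c) \<bullet> (\<xi> + comb c) = \<xi> \<bullet> \<xi> + (\<Sum>i\<in>I. 2 * c i * (e i \<bullet> \<xi>) + (c i)\<^sup>2)"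
proof -
  have "comb c \<bullet> \<xi> = (\<Sum>i\<in>I. c i * (e i \<bullet> \<xi>))" by (simp add: comb_def inner_sum_left)
  moreover have "comb c \<bullet> comb c = (\<Sum>i\<in>I. (c i)\<^sup>2)"
    by (subst comb_def) (simp add: inner_sum_left inner_comb power2_eq_square)
  ultimately show ?thesis
    by (simp add: inner_add_left inner_add_right inner_commute sum.distrib sum_distrib_left mult.assoc)
qed

text \<open>
  The change of twice the negative log-density of (state, noise) when a move is reversed. It vanishes
  for all states exactly if the move satisfies detailed balance, that is \<open>\<beta>\<^sup>2 = 2u - a u\<^sup>2\<close> on the block.
  For the MALA proposal the fraction is \<open>h/2\<close>.
\<close>
definition excess where
  "excess u \<beta> x \<xi> = (\<Sum>i\<in>I. ((w i (step u \<beta> x \<xi>))\<^sup>2 - (w i x)\<^sup>2) * (((\<beta> i)\<^sup>2 - 2 * u i + a i * (u i)\<^sup>2) / (a i * (\<beta> i)\<^sup>2)))"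

lemma energy_step:
  assumes "\<forall>i\<in>I. \<beta> i \<noteq> 0"
  shows "(step u \<beta> x \<xi> - \<mu>) \<bullet> (Q *v (step u \<beta> x \<xi> - \<mu>)) + rnoise u \<beta> x \<xi> \<bullet> rnoise u \<beta> x \<xi>
    = (x - \<mu>) \<bullet> (Q *v (x - \<mu>)) + \<xi> \<bullet> \<xi> + excess u \<beta> x \<xi>"
proof -
  let ?c = "\<lambda>i. \<beta> i * (e i \<bullet> \<xi>) - u i * w i x"
  let ?k = "\<lambda>i. u i * (w i x + w i (step u \<beta> x \<xi>)) / \<beta> i - 2 * (e i \<bullet> \<xi>)"
  have "(step u \<beta> x \<xi> - \<mu>) \<bullet> (Q *v (step u \<beta> x \<xi> - \<mu>)) = (x - \<mu>) \<bullet> (Q *v (x - \<mu>)) + (\<Sum>i\<in>I. 2 * ?c i * w i x + a i * (?c i)\<^sup>2)"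
    unfolding step_def by (rule quad_comb)
  moreover have "rnoise u \<beta> x \<xi> \<bullet> rnoise u \<beta> x \<xi> = \<xi> \<bullet> \<xi> + (\<Sum>i\<in>I. 2 * ?k i * (e i \<bullet> \<xi>) + (?k i)\<^sup>2)"
    unfolding rnoise_def by (rule inner_self_comb)
  moreover have "(\<Sum>i\<in>I. 2 * ?c i * w i x + a i * (?c i)\<^sup>2) + (\<Sum>i\<in>I. 2 * ?k i * (e i \<bullet> \<xi>) + (?k i)\<^sup>2) = excess u \<beta> x \<xi>"
    unfolding excess_def sum.distrib[symmetric]
  proof (rule sum.cong[OF refl])
    fix i assume i: "i \<in> I"
    define z where "z = e i \<bullet> \<xi>"
    define W where "W = w i x"
    define b where "b = \<beta> i"
    define v where "v = b * z - u i * W"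
    define k where "k = u i * (W + (W + a i * v)) / b - 2 * z"
    have b: "b \<noteq> 0" using assms i by (simp add: b_def)
    have a: "a i \<noteq> 0" using i by (simp add: I_def)
    have w': "w i (step u \<beta> x \<xi>) = W + a i * v"
      using w_step[OF i, of u \<beta> x \<xi>] by (simp add: W_def v_def z_def b_def algebra_simps)
    have zv: "z = (v + u i * W) / b" using b by (simp add: v_def)
    have kb: "k * b = u i * (2 * W + a i * v) - 2 * (v + u i * W)" using b by (simp add: k_def zv field_simps)
    have "b\<^sup>2 * (2 * k * z + k\<^sup>2) = 2 * (k * b) * (v + u i * W) + (k * b)\<^sup>2"
      using b by (simp add: zv field_simps power2_eq_square)
    also have "\<dots> = (u i)\<^sup>2 * (a i * v) * (2 * W + a i * v) - 2 * u i * v * (2 * W + a i * v)"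
      unfolding kb by (simp add: power2_eq_square algebra_simps)
    finally have R: "b\<^sup>2 * (2 * k * z + k\<^sup>2) = (u i)\<^sup>2 * (a i * v) * (2 * W + a i * v) - 2 * u i * v * (2 * W + a i * v)" .
    have "a i * b\<^sup>2 * ((2 * v * W + a i * v\<^sup>2) + (2 * k * z + k\<^sup>2))
      = a i * b\<^sup>2 * (2 * v * W + a i * v\<^sup>2) + a i * (b\<^sup>2 * (2 * k * z + k\<^sup>2))"
      by (simp add: algebra_simps)
    also have "\<dots> = a i * b\<^sup>2 * (2 * v * W + a i * v\<^sup>2) + a i * ((u i)\<^sup>2 * (a i * v) * (2 * W + a i * v) - 2 * u i * v * (2 * W + a i * v))"
      by (simp only: R)
    also have "\<dots> = ((W + a i * v)\<^sup>2 - W\<^sup>2) * (b\<^sup>2 - 2 * u i + a i * (u i)\<^sup>2)"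
      by (simp add: power2_eq_square algebra_simps)
    finally have "(2 * v * W + a i * v\<^sup>2) + (2 * k * z + k\<^sup>2)
       = ((W + a i * v)\<^sup>2 - W\<^sup>2) * ((b\<^sup>2 - 2 * u i + a i * (u i)\<^sup>2) / (a i * b\<^sup>2))"
      using a b by (simp add: field_simps)
    then show "2 * ?c i * w i x + a i * (?c i)\<^sup>2 + (2 * ?k i * (e i \<bullet> \<xi>) + (?k i)\<^sup>2) =
        ((w i (step u \<beta> x \<xi>))\<^sup>2 - (w i x)\<^sup>2) * (((\<beta> i)\<^sup>2 - 2 * u i + a i * (u i)\<^sup>2) / (a i * (\<beta> i)\<^sup>2))"
      unfolding w' k_def v_def W_def z_def b_def by simp
  qed
  ultimately show ?thesis by simp
qed

definition flip where "flip u \<beta> = (\<lambda>(x, \<xi>). (step u \<beta> x \<xi>, rnoise u \<beta> x \<xi>))"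

text \<open>
  Linearity of the reversal holds up to translation by \<open>\<mu>\<close>; after centring, it is a linear involution
  and preserves Lebesgue measure.
\<close>
lemma distr_lborel_flip:
  assumes \<beta>: "\<forall>i\<in>I. \<beta> i \<noteq> 0"
  shows "flip u \<beta> \<in> borel_measurable borel" and "distr lborel borel (flip u \<beta>) = lborel"
proof -
  define p where "p = (\<mu>, 0 :: real ^ 'n)"
  define L where "L z = flip u \<beta> (p + z) - p" for z
  have flip_flip: "flip u \<beta> (flip u \<beta> z) = z" for z
    using step_rnoise[OF \<beta>] rnoise_rnoise[OF \<beta>] by (cases z) (simp add: flip_def)
  have L: "L (v, \<xi>) = (v + comb (\<lambda>i. \<beta> i * (e i \<bullet> \<xi>) - u i * (e i \<bullet> (Q *v v))),
      \<xi> + comb (\<lambda>i. inverse (\<beta> i) * (u i * (2 * (e i \<bullet> (Q *v v)) + a i * (\<beta> i * (e i \<bullet> \<xi>) - u i * (e i \<bullet> (Q *v v))))) - 2 * (e i \<bullet> \<xi>)))" for v \<xi>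
  proof -
    have "rnoise u \<beta> (\<mu> + v) \<xi> = \<xi> + comb (\<lambda>i. inverse (\<beta> i) * (u i * (2 * (e i \<bullet> (Q *v v)) + a i * (\<beta> i * (e i \<bullet> \<xi>) - u i * (e i \<bullet> (Q *v v))))) - 2 * (e i \<bullet> \<xi>))"
      unfolding rnoise_def
    proof (rule arg_cong[where f = "\<lambda>z. \<xi> + z"], rule comb_cong)
      fix i assume i: "i \<in> I"
      have "w i (\<mu> + v) = e i \<bullet> (Q *v v)" by (simp add: w_def)
      then show "u i * (w i (\<mu> + v) + w i (step u \<beta> (\<mu> + v) \<xi>)) / \<beta> i - 2 * (e i \<bullet> \<xi>) =
        inverse (\<beta> i) * (u i * (2 * (e i \<bullet> (Q *v v)) + a i * (\<beta> i * (e i \<bullet> \<xi>) - u i * (e i \<bullet> (Q *v v))))) - 2 * (e i \<bullet> \<xi>)"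
        by (simp add: w_step[OF i] divide_inverse algebra_simps)
    qed
    then show ?thesis by (simp add: L_def p_def flip_def step_def w_def)
  qed
  have lin: "linear L"
  proof (rule linearI)
    fix z z' :: "(real ^ 'n) \<times> (real ^ 'n)" and r :: real
    obtain v \<xi> v' \<xi>' where z: "z = (v, \<xi>)" "z' = (v', \<xi>')" by (cases z, cases z')
    show "L (z + z') = L z + L z'"
      unfolding z by (simp add: L comb_add matrix_vector_right_distrib inner_add_right algebra_simps)
    show "L (r *\<^sub>R z) = r *\<^sub>R L z"
      unfolding z by (simp add: L comb_scale matrix_vector_mult_scaleR scaleR_right_distrib algebra_simps)
  qed
  have LL: "L (L z) = z" for z by (simp add: L_def flip_flip)
  have eq: "flip u \<beta> = (\<lambda>z. p + L (- p + z))" by (simp add: L_def fun_eq_iff)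
  note [measurable] = measurable_linear[OF lin]
  show "flip u \<beta> \<in> borel_measurable borel" unfolding eq by measurable
  have "distr lborel borel (flip u \<beta>) = distr (distr (distr lborel borel ((+) (- p))) borel L) borel ((+) p)"
    unfolding eq by (simp add: distr_distr o_def)
  then show "distr lborel borel (flip u \<beta>) = lborel"
    by (simp add: lborel_distr_plus distr_lborel_involution[OF lin LL])
qed

end

lemma pair_gauss_eq_density:
  fixes Q :: "real ^ 'n ^ 'n" and R :: "real ^ 'm ^ 'm"
  assumes R: "sym_pos_def R"
  shows "gauss_measure \<mu> Q \<Otimes>\<^sub>M gauss_measure \<nu> R
     = density lborel (\<lambda>z. ennreal (gauss_density \<mu> Q (fst z)) * ennreal (gauss_density \<nu> R (snd z)))"
proof -
  interpret R: prob_space "gauss_measure \<nu> R" by (rule prob_space_gauss_measure[OF R])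
  have "sigma_finite_measure (density lborel (\<lambda>x. ennreal (gauss_density \<nu> R x)))"
    using R.sigma_finite_measure_axioms by (simp add: gauss_measure_def)
  then show ?thesis unfolding gauss_measure_def
    by (subst pair_measure_density) (auto simp: lborel_prod case_prod_beta' intro: sigma_finite_lborel)
qed

context eigenblock begin

text \<open>
  Detailed balance for an arbitrary block move: reversing it changes the joint law of state and noise
  by the factor \<open>exp (- excess / 2)\<close> only, as the reversal preserves Lebesgue measure.
\<close>
lemma pair_gauss_flip:
  assumes \<beta>: "\<forall>i\<in>I. \<beta> i \<noteq> 0"
  defines "M \<equiv> gauss_measure \<mu> Q \<Otimes>\<^sub>M std_gauss"
  shows "M = distr (density M (\<lambda>z. ennreal (exp (- excess u \<beta> (fst z) (snd z) / 2)))) borel (flip u \<beta>)"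
proof -
  define \<rho> where "\<rho> z = gauss_density \<mu> Q (fst z) * gauss_density 0 (mat 1) (snd z)" for z :: "(real ^ 'n) \<times> (real ^ 'n)"
  note [measurable] = distr_lborel_flip(1)[OF \<beta>, of u]
  have \<rho>0: "0 \<le> \<rho> z" for z using gauss_density_pos[OF Q] gauss_density_pos[OF sym_pos_def_one]
    unfolding \<rho>_def by (intro mult_nonneg_nonneg less_imp_le)
  have [measurable]: "\<rho> \<in> borel_measurable borel"
    unfolding \<rho>_def borel_prod[symmetric] by measurable
  have M: "M = density lborel (\<lambda>z. ennreal (\<rho> z))"
    unfolding M_def pair_gauss_eq_density[OF sym_pos_def_one] \<rho>_def
    using gauss_density_pos[OF Q] by (simp add: ennreal_mult' less_imp_le)
  have \<rho>_flip: "\<rho> (flip u \<beta> z) = \<rho> z * exp (- excess u \<beta> (fst z) (snd z) / 2)" for z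
  proof -
    obtain x \<xi> where z: "z = (x, \<xi>)" by (cases z)
    define y where "y = step u \<beta> x \<xi>"
    define \<zeta> where "\<zeta> = rnoise u \<beta> x \<xi>"
    define E where "E = (x - \<mu>) \<bullet> (Q *v (x - \<mu>)) + \<xi> \<bullet> \<xi>"
    define E' where "E' = (y - \<mu>) \<bullet> (Q *v (y - \<mu>)) + \<zeta> \<bullet> \<zeta>"
    have \<rho>: "\<rho> (x, \<xi>) = c * exp (- E / 2)" "\<rho> (y, \<zeta>) = c * exp (- E' / 2)"
      if "c = sqrt (det Q / (2 * pi) ^ CARD('n)) * sqrt (1 / (2 * pi) ^ CARD('n))" for c
      by (simp_all add: that \<rho>_def gauss_density_def E_def E'_def exp_add[symmetric] add_divide_distrib diff_divide_distrib)
    have "E' = E + excess u \<beta> x \<xi>"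
      using energy_step[OF \<beta>, of u x \<xi>] by (simp add: E_def E'_def y_def \<zeta>_def)
    then have "exp (- E' / 2) = exp (- E / 2) * exp (- excess u \<beta> x \<xi> / 2)"
      by (simp add: exp_add[symmetric] add_divide_distrib)
    then show ?thesis using \<rho>[OF refl] by (simp add: z flip_def y_def \<zeta>_def)
  qed
  have mw: "w i \<in> borel_measurable borel" for i unfolding w_def by measurable
  have [measurable]: "(\<lambda>z. excess u \<beta> (fst z) (snd z)) \<in> borel_measurable borel"
  proof -
    have "(\<lambda>z. excess u \<beta> (fst z) (snd z)) = (\<lambda>z. \<Sum>i\<in>I. ((w i (fst (flip u \<beta> z)))\<^sup>2 - (w i (fst z))\<^sup>2) * (((\<beta> i)\<^sup>2 - 2 * u i + a i * (u i)\<^sup>2) / (a i * (\<beta> i)\<^sup>2)))"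
      by (simp add: excess_def flip_def case_prod_beta)
    moreover note [measurable] = mw
    have [measurable]: "flip u \<beta> \<in> borel \<Otimes>\<^sub>M borel \<rightarrow>\<^sub>M borel \<Otimes>\<^sub>M borel"
      using distr_lborel_flip(1)[OF \<beta>, of u] by (simp add: borel_prod)
    have "(\<lambda>z. \<Sum>i\<in>I. ((w i (fst (flip u \<beta> z)))\<^sup>2 - (w i (fst z))\<^sup>2) * (((\<beta> i)\<^sup>2 - 2 * u i + a i * (u i)\<^sup>2) / (a i * (\<beta> i)\<^sup>2))) \<in> borel_measurable (borel \<Otimes>\<^sub>M borel)"
      by measurable
    ultimately show ?thesis by (simp add: borel_prod)
  qed
  have flip_flip: "flip u \<beta> (flip u \<beta> z) = z" for z
    using step_rnoise[OF \<beta>] rnoise_rnoise[OF \<beta>] by (cases z) (simp add: flip_def)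
  have "density M (\<lambda>z. ennreal (exp (- excess u \<beta> (fst z) (snd z) / 2))) = density lborel (\<lambda>z. ennreal (\<rho> (flip u \<beta> z)))"
    unfolding M by (subst density_density_eq) (auto simp: \<rho>_flip ennreal_mult' \<rho>0)
  then have "distr (density M (\<lambda>z. ennreal (exp (- excess u \<beta> (fst z) (snd z) / 2)))) borel (flip u \<beta>)
      = distr (density lborel (\<lambda>z. ennreal (\<rho> (flip u \<beta> z)))) borel (flip u \<beta>)" by simp
  also have "\<dots> = density (distr lborel borel (flip u \<beta>)) (\<lambda>z. ennreal (\<rho> z))"
    by (subst density_distr) auto
  also have "\<dots> = M" by (simp add: M distr_lborel_flip(2)[OF \<beta>])
  finally show ?thesis by simp
qed

end

section \<open>Contraction in mean square from contraction of Lipschitz constants\<close>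

definition bounded_borel :: "('a::topological_space \<Rightarrow> real) \<Rightarrow> bool" where
  "bounded_borel f \<longleftrightarrow> f \<in> borel_measurable borel \<and> (\<exists>B. \<forall>x. \<bar>f x\<bar> \<le> B)"

lemma bounded_borelI: "f \<in> borel_measurable borel \<Longrightarrow> (\<And>x. \<bar>f x\<bar> \<le> B) \<Longrightarrow> bounded_borel f"
  by (auto simp: bounded_borel_def)

lemma bounded_borel_measurable: "bounded_borel f \<Longrightarrow> f \<in> borel_measurable borel"
  by (simp add: bounded_borel_def)

lemma bounded_borelE:
  assumes "bounded_borel f" obtains B where "0 \<le> B" "\<And>x. \<bar>f x\<bar> \<le> B"
  using assms unfolding bounded_borel_def by (metis abs_ge_zero order_trans)

lemma bounded_borel_const [simp]: "bounded_borel (\<lambda>_. c)"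
  by (rule bounded_borelI[where B = "\<bar>c\<bar>"]) auto

lemma bounded_borel_add:
  assumes "bounded_borel f" "bounded_borel g" shows "bounded_borel (\<lambda>x. f x + g x)"
proof -
  obtain B C where "\<And>x. \<bar>f x\<bar> \<le> B" "\<And>x. \<bar>g x\<bar> \<le> C" using assms by (metis bounded_borelE)
  then have "\<bar>f x + g x\<bar> \<le> B + C" for x using abs_triangle_ineq[of "f x" "g x"] by (smt (verit))
  then show ?thesis using assms[THEN bounded_borel_measurable] by (intro bounded_borelI) auto
qed

lemma bounded_borel_mult:
  assumes "bounded_borel f" "bounded_borel g" shows "bounded_borel (\<lambda>x. f x * g x)"
proof -
  obtain B C where "0 \<le> B" "\<And>x. \<bar>f x\<bar> \<le> B" "\<And>x. \<bar>g x\<bar> \<le> C" using assms by (metis bounded_borelE)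
  then have "\<bar>f x * g x\<bar> \<le> B * C" for x by (simp add: abs_mult mult_mono)
  then show ?thesis using assms[THEN bounded_borel_measurable] by (intro bounded_borelI) auto
qed

lemma bounded_borel_cmult: "bounded_borel f \<Longrightarrow> bounded_borel (\<lambda>x. c * f x)"
  by (rule bounded_borel_mult) simp_all

lemma bounded_borel_diff:
  assumes "bounded_borel f" "bounded_borel g" shows "bounded_borel (\<lambda>x. f x - g x)"
  using bounded_borel_add[OF assms(1) bounded_borel_cmult[OF assms(2), of "-1"]] by simp

lemma bounded_borel_power2: "bounded_borel f \<Longrightarrow> bounded_borel (\<lambda>x. (f x)\<^sup>2)"
  unfolding power2_eq_square by (rule bounded_borel_mult)

lemma bounded_borel_sum:
  "(\<And>i. i \<in> S \<Longrightarrow> bounded_borel (f i)) \<Longrightarrow> bounded_borel (\<lambda>x. \<Sum>i\<in>S. f i x)"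
  by (induction S rule: infinite_finite_induct) (auto intro: bounded_borel_add)

lemmas bounded_borel_intros = bounded_borel_add bounded_borel_mult bounded_borel_diff bounded_borel_power2 bounded_borel_const

lemma integral_cauchy_schwarz:
  fixes f g :: "'a \<Rightarrow> real"
  assumes "integrable M (\<lambda>x. (f x)\<^sup>2)" "integrable M (\<lambda>x. (g x)\<^sup>2)" "integrable M (\<lambda>x. f x * g x)"
  shows "(\<integral>x. f x * g x \<partial>M)\<^sup>2 \<le> (\<integral>x. (f x)\<^sup>2 \<partial>M) * (\<integral>x. (g x)\<^sup>2 \<partial>M)"
proof -
  define A B C where "A = (\<integral>x. (f x)\<^sup>2 \<partial>M)" and "B = (\<integral>x. f x * g x \<partial>M)" and "C = (\<integral>x. (g x)\<^sup>2 \<partial>M)"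
  have quad: "0 \<le> A + 2 * t * B + t\<^sup>2 * C" for t
  proof -
    have "0 \<le> (\<integral>x. (f x + t * g x)\<^sup>2 \<partial>M)" by simp
    also have "(\<lambda>x. (f x + t * g x)\<^sup>2) = (\<lambda>x. (f x)\<^sup>2 + (2 * t * (f x * g x) + t\<^sup>2 * (g x)\<^sup>2))"
      by (simp add: fun_eq_iff power2_eq_square algebra_simps)
    also have "(\<integral>x. (f x)\<^sup>2 + (2 * t * (f x * g x) + t\<^sup>2 * (g x)\<^sup>2) \<partial>M) = A + 2 * t * B + t\<^sup>2 * C"
      using assms by (simp add: A_def B_def C_def)
    finally show ?thesis .
  qed
  have A: "0 \<le> A" and C: "0 \<le> C" by (simp_all add: A_def C_def)
  have "B\<^sup>2 \<le> A * C"
  proof (cases "C = 0")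
    case True
    have "B = 0"
    proof (rule ccontr)
      assume "B \<noteq> 0"
      then show False using quad[of "- (A + 1) / (2 * B)"] True by (simp add: field_simps)
    qed
    then show ?thesis using True by simp
  next
    case False
    then have "C > 0" using C by simp
    then show ?thesis using quad[of "- B / C"] by (simp add: field_simps power2_eq_square)
  qed
  then show ?thesis by (simp add: A_def B_def C_def)
qed

locale borel_prob = prob_space M for M :: "'a::topological_space measure" +
  assumes sets_borel [simp, measurable_cong]: "sets M = sets borel"
begin

definition ip :: "('a \<Rightarrow> real) \<Rightarrow> ('a \<Rightarrow> real) \<Rightarrow> real" where "ip f g = (\<integral>x. f x * g x \<partial>M)"
definition nm :: "('a \<Rightarrow> real) \<Rightarrow> real" where "nm f = sqrt (ip f f)"

lemma integrable_bounded_borel: assumes "bounded_borel f" shows "integrable M f"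
proof -
  obtain B where "\<And>x. \<bar>f x\<bar> \<le> B" using assms unfolding bounded_borel_def by blast
  then show ?thesis using bounded_borel_measurable[OF assms]
    by (intro integrable_const_bound[where B = B]) auto
qed

lemma ip_commute: "ip f g = ip g f" by (simp add: ip_def mult.commute[of "f _" "g _"])

lemma ip_nonneg [simp]: "0 \<le> ip f f" by (simp add: ip_def power2_eq_square[symmetric])

lemma ip_diff_left:
  "bounded_borel f \<Longrightarrow> bounded_borel g \<Longrightarrow> bounded_borel k \<Longrightarrow> ip (\<lambda>x. f x - g x) k = ip f k - ip g k"
  by (simp add: ip_def left_diff_distrib integrable_bounded_borel bounded_borel_mult)

lemma ip_add_left:
  "bounded_borel f \<Longrightarrow> bounded_borel g \<Longrightarrow> bounded_borel k \<Longrightarrow> ip (\<lambda>x. f x + g x) k = ip f k + ip g k"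
  by (simp add: ip_def distrib_right integrable_bounded_borel bounded_borel_mult)

lemma ip_diff_right:
  "bounded_borel f \<Longrightarrow> bounded_borel g \<Longrightarrow> bounded_borel k \<Longrightarrow> ip k (\<lambda>x. f x - g x) = ip k f - ip k g"
  using ip_diff_left[of f g k] unfolding ip_commute[of k "\<lambda>x. f x - g x"] ip_commute[of k f] ip_commute[of k g] .

lemma ip_add_right:
  "bounded_borel f \<Longrightarrow> bounded_borel g \<Longrightarrow> bounded_borel k \<Longrightarrow> ip k (\<lambda>x. f x + g x) = ip k f + ip k g"
  using ip_add_left[of f g k] unfolding ip_commute[of k "\<lambda>x. f x + g x"] ip_commute[of k f] ip_commute[of k g] .

lemma ip_cmult_left: "ip (\<lambda>x. c * f x) k = c * ip f k"
  by (simp add: ip_def mult.assoc)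

lemma ip_sum_left:
  "finite S \<Longrightarrow> (\<And>i. i \<in> S \<Longrightarrow> bounded_borel (f i)) \<Longrightarrow> bounded_borel k \<Longrightarrow> ip (\<lambda>x. \<Sum>i\<in>S. f i x) k = (\<Sum>i\<in>S. ip (f i) k)"
  by (simp add: ip_def sum_distrib_right integrable_bounded_borel bounded_borel_mult)

lemma nm_power2: "(nm f)\<^sup>2 = ip f f" by (simp add: nm_def)

lemma nm_less: "ip f f < c\<^sup>2 \<Longrightarrow> 0 < c \<Longrightarrow> nm f < c"
  using real_sqrt_less_mono[of "ip f f" "c\<^sup>2"] by (simp add: nm_def)

lemma nm_nonneg [simp]: "0 \<le> nm f" by (simp add: nm_def)

lemma ip_cauchy_schwarz:
  assumes "bounded_borel f" "bounded_borel g" shows "(ip f g)\<^sup>2 \<le> ip f f * ip g g"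
proof -
  have "(\<integral>x. f x * g x \<partial>M)\<^sup>2 \<le> (\<integral>x. (f x)\<^sup>2 \<partial>M) * (\<integral>x. (g x)\<^sup>2 \<partial>M)"
    using assms by (intro integral_cauchy_schwarz integrable_bounded_borel bounded_borel_power2 bounded_borel_mult)
  then show ?thesis unfolding ip_def power2_eq_square .
qed

lemma nm_triangle:
  assumes "bounded_borel f" "bounded_borel g" shows "nm (\<lambda>x. f x + g x) \<le> nm f + nm g"
proof -
  have "ip (\<lambda>x. f x + g x) (\<lambda>x. f x + g x) = ip f f + 2 * ip f g + ip g g"
    unfolding ip_add_left[OF assms bounded_borel_add[OF assms]] ip_add_right[OF assms assms(1)]
      ip_add_right[OF assms assms(2)] using ip_commute[of g f] by linarith
  also have "ip f g \<le> nm f * nm g"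
    using ip_cauchy_schwarz[OF assms] by (simp add: nm_def real_sqrt_mult[symmetric] real_le_rsqrt)
  finally have "(nm (\<lambda>x. f x + g x))\<^sup>2 \<le> (nm f + nm g)\<^sup>2"
    by (simp add: nm_power2[symmetric] power2_sum)
  then show ?thesis by (rule power2_le_imp_le) simp
qed

lemma nm_diff_commute: "nm (\<lambda>x. f x - g x) = nm (\<lambda>x. g x - f x)"
  by (simp add: nm_def ip_def power2_eq_square[symmetric] power2_commute)

lemma nm_triangle_diff:
  assumes "bounded_borel f" "bounded_borel g" "bounded_borel k"
  shows "nm (\<lambda>x. f x - k x) \<le> nm (\<lambda>x. f x - g x) + nm (\<lambda>x. g x - k x)"
  using nm_triangle[of "\<lambda>x. f x - g x" "\<lambda>x. g x - k x"] assms by (simp add: bounded_borel_diff)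

lemma nm_triangle_le:
  assumes "bounded_borel f" "bounded_borel g"
  shows "nm f \<le> nm (\<lambda>x. f x - g x) + nm g"
  using nm_triangle[of "\<lambda>x. f x - g x" g] assms by (simp add: bounded_borel_diff)

end

text \<open>
  In a log-convex sequence the ratios increase, so the first ratio is at most the asymptotic one,
  whatever the constant \<open>C\<close> is.
\<close>
lemma log_convex_rate:
  fixes s :: "nat \<Rightarrow> real"
  assumes nonneg: "\<And>n. 0 \<le> s n" and conv: "\<And>n. (s (Suc n))\<^sup>2 \<le> s n * s (Suc (Suc n))"
    and bound: "\<And>n. s n \<le> C * r ^ n" and r: "0 \<le> r"
  shows "s 1 \<le> r * s 0"
proof (rule ccontr)
  assume "\<not> s 1 \<le> r * s 0"
  then have gt: "r * s 0 < s 1" by simp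
  have "s 0 \<noteq> 0"
  proof
    assume "s 0 = 0"
    then have "(s 1)\<^sup>2 \<le> 0" using conv[of 0] by simp
    then show False using gt \<open>s 0 = 0\<close> by simp
  qed
  then have s0: "0 < s 0" using nonneg[of 0] by simp
  define q where "q = s 1 / s 0"
  have rq: "r < q" using gt s0 by (simp add: q_def field_simps)
  then have q: "0 < q" using r by simp
  have step: "0 < s n \<and> q * s n \<le> s (Suc n)" for n
  proof (induction n)
    case 0 then show ?case using s0 by (simp add: q_def)
  next
    case (Suc n)
    then have pos: "0 < s (Suc n)" using q by (smt (verit) mult_pos_pos)
    have "q * s (Suc n) * s n \<le> s (Suc n) * s (Suc n)"
      using mult_left_mono[of "q * s n" "s (Suc n)" "s (Suc n)"] Suc pos by (simp add: mult_ac)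
    also have "\<dots> \<le> s (Suc (Suc n)) * s n" using conv[of n] by (simp add: power2_eq_square mult_ac)
    finally have "q * s (Suc n) \<le> s (Suc (Suc n))" using Suc by simp
    then show ?case using pos by simp
  qed
  have lower: "q ^ n * s 0 \<le> s n" for n
  proof (induction n)
    case (Suc n)
    have "q ^ Suc n * s 0 \<le> q * s n" using mult_left_mono[OF Suc.IH, of q] q by (simp add: mult_ac)
    then show ?case using step[of n] by simp
  qed simp
  show False
  proof (cases "r = 0")
    case True
    then show False using bound[of 1] step[of 1] by simp
  next
    case False
    then have r: "0 < r" using r by simp
    have "(q / r) ^ n \<le> C / s 0" for n
    proof -
      have "q ^ n * s 0 \<le> C * r ^ n" using lower[of n] bound[of n] by simp
      then show ?thesis using s0 r by (simp add: field_simps power_divide)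
    qed
    moreover have "1 < q / r" using rq r by simp
    ultimately show False using real_arch_pow[of "q / r" "C / s 0"] by (metis not_less)
  qed
qed

text \<open>Lipschitz functions that decrease to the indicator of a closed set.\<close>
lemma infdist_bump:
  fixes K :: "'a::metric_space set"
  assumes "closed K" "K \<noteq> {}"
  shows "(\<lambda>n. max 0 (1 - real n * infdist x K)) \<longlonglongrightarrow> indicator K x"
proof (cases "x \<in> K")
  case True then show ?thesis by simp
next
  case False
  then have pos: "0 < infdist x K" using assms by (metis in_closed_iff_infdist_zero infdist_nonneg less_le)
  then obtain m :: nat where m: "1 < real m * infdist x K" using reals_Archimedean3 by blast
  have "\<forall>\<^sub>F n in sequentially. max 0 (1 - real n * infdist x K) = 0"
  proof (rule eventually_sequentiallyI[of m])
    fix n assume "m \<le> n"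
    then have "real m * infdist x K \<le> real n * infdist x K" using pos by (intro mult_right_mono) auto
    then show "max 0 (1 - real n * infdist x K) = 0" using m by simp
  qed
  then show ?thesis using False by (simp add: tendsto_eventually)
qed

definition bounded_lipschitz :: "('a::metric_space \<Rightarrow> real) \<Rightarrow> bool" where
  "bounded_lipschitz g \<longleftrightarrow> (\<exists>L\<ge>0. \<forall>x y. \<bar>g x - g y\<bar> \<le> L * dist x y) \<and> (\<exists>B. \<forall>x. \<bar>g x\<bar> \<le> B)"

lemma bounded_lipschitzI:
  "0 \<le> L \<Longrightarrow> (\<And>x y. \<bar>g x - g y\<bar> \<le> L * dist x y) \<Longrightarrow> (\<And>x. \<bar>g x\<bar> \<le> B) \<Longrightarrow> bounded_lipschitz g"
  unfolding bounded_lipschitz_def by blast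

lemma bounded_lipschitz_borel: assumes "bounded_lipschitz g" shows "bounded_borel g"
proof -
  obtain L where L: "0 \<le> L" "\<And>x y. \<bar>g x - g y\<bar> \<le> L * dist x y" using assms by (auto simp: bounded_lipschitz_def)
  then have "L-lipschitz_on UNIV g" by (intro lipschitz_onI) (auto simp: dist_real_def)
  then have "continuous_on UNIV g" by (rule lipschitz_on_continuous_on)
  then show ?thesis using assms borel_measurable_continuous_onI
    by (auto simp: bounded_lipschitz_def bounded_borel_def)
qed

lemma bounded_lipschitz_add:
  assumes "bounded_lipschitz f" "bounded_lipschitz g" shows "bounded_lipschitz (\<lambda>x. f x + g x)"
proof -
  obtain L B where f: "0 \<le> L" "\<And>x y. \<bar>f x - f y\<bar> \<le> L * dist x y" "\<And>x. \<bar>f x\<bar> \<le> B"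
    using assms by (auto simp: bounded_lipschitz_def)
  obtain L' B' where g: "0 \<le> L'" "\<And>x y. \<bar>g x - g y\<bar> \<le> L' * dist x y" "\<And>x. \<bar>g x\<bar> \<le> B'"
    using assms by (auto simp: bounded_lipschitz_def)
  have "\<bar>(f x + g x) - (f y + g y)\<bar> \<le> (L + L') * dist x y" for x y
    using f(2)[of x y] g(2)[of x y] by (simp add: distrib_right)
  moreover have "\<bar>f x + g x\<bar> \<le> B + B'" for x using f(3)[of x] g(3)[of x] by simp
  ultimately show ?thesis using f(1) g(1) unfolding bounded_lipschitz_def
    by (intro conjI exI[of _ "L + L'"] exI[of _ "B + B'"]) auto
qed

lemma bounded_lipschitz_cmult:
  assumes "bounded_lipschitz f" shows "bounded_lipschitz (\<lambda>x. c * f x)"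
proof -
  obtain L B where f: "0 \<le> L" "\<And>x y. \<bar>f x - f y\<bar> \<le> L * dist x y" "\<And>x. \<bar>f x\<bar> \<le> B"
    using assms by (auto simp: bounded_lipschitz_def)
  have "\<bar>c * f x - c * f y\<bar> \<le> (\<bar>c\<bar> * L) * dist x y" for x y
    using mult_left_mono[OF f(2)[of x y], of "\<bar>c\<bar>"] by (simp add: right_diff_distrib[symmetric] abs_mult mult.assoc)
  moreover have "\<bar>c * f x\<bar> \<le> \<bar>c\<bar> * B" for x using f(3) by (simp add: abs_mult mult_left_mono)
  ultimately show ?thesis using f(1) unfolding bounded_lipschitz_def
    by (intro conjI exI[of _ "\<bar>c\<bar> * L"] exI[of _ "\<bar>c\<bar> * B"]) auto
qed

locale polish_prob = borel_prob M for M :: "'a::polish_space measure"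
begin

text \<open>
  Closed sets are handled by \<open>infdist_bump\<close>, and Borel sets are approximated from inside by compact
  sets, since a finite Borel measure on a Polish space is inner regular.
\<close>
lemma lipschitz_approx_indicator:
  assumes A: "A \<in> sets borel" and \<epsilon>: "0 < \<epsilon>"
  shows "\<exists>g. bounded_lipschitz g \<and> nm (\<lambda>x. indicator A x - g x) < \<epsilon>"
proof -
  have zero: "bounded_lipschitz (\<lambda>_::'a. 0::real)"
    unfolding bounded_lipschitz_def by (intro conjI exI[of _ 0]) auto
  define \<delta> where "\<delta> = (\<epsilon> / 2)\<^sup>2 / 2"
  have \<delta>: "0 < \<delta>" using \<epsilon> by (simp add: \<delta>_def)
  obtain K where K: "compact K" "K \<subseteq> A" "measure M A - \<delta> < measure M K"
  proof (cases "measure M A - \<delta> < 0")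
    case True then show ?thesis using that[of "{}"] by simp
  next
    case False
    have "ennreal (measure M A - \<delta>) < emeasure M A"
      using \<delta> False by (simp add: emeasure_eq_measure ennreal_less_iff)
    also have "emeasure M A = (SUP K\<in>{K. K \<subseteq> A \<and> compact K}. emeasure M K)"
      using A by (intro inner_regular) auto
    finally obtain K where "K \<subseteq> A" "compact K" "ennreal (measure M A - \<delta>) < emeasure M K"
      by (auto simp: less_SUP_iff)
    then show ?thesis using False that[of K] by (simp add: emeasure_eq_measure ennreal_less_iff)
  qed
  have [measurable]: "K \<in> sets borel" "A \<in> sets borel" using K A by (auto intro: borel_compact)
  have bbi: "bounded_borel (indicator X :: 'a \<Rightarrow> real)" if "X \<in> sets borel" for X
    using that by (intro bounded_borelI[where B = 1]) (auto simp: indicator_def)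
  have "ip (\<lambda>x. indicator A x - indicator K x) (\<lambda>x. indicator A x - indicator K x) = (\<integral>x. indicator (A - K) x \<partial>M)"
    unfolding ip_def using K(2) by (intro Bochner_Integration.integral_cong) (auto simp: indicator_def)
  also have "\<dots> = measure M A - measure M K"
    using K(2) by (simp add: finite_measure_Diff)
  also have "\<dots> < (\<epsilon> / 2)\<^sup>2" using K(3) \<delta> unfolding \<delta>_def by linarith
  finally have 1: "nm (\<lambda>x. indicator A x - indicator K x) < \<epsilon> / 2"
    using \<epsilon> by (intro nm_less) auto
  obtain g where g: "bounded_lipschitz g" "nm (\<lambda>x. indicator K x - g x) < \<epsilon> / 2"
  proof (cases "K = {}")
    case True then show ?thesis using that[OF zero] \<epsilon> by (simp add: nm_def ip_def)
  next
    case False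
    define g where "g n x = max 0 (1 - real n * infdist x K)" for n x
    have g01: "0 \<le> g n x" "g n x \<le> 1" for n x by (auto simp: g_def infdist_nonneg)
    have lip: "bounded_lipschitz (g n)" for n
    proof (rule bounded_lipschitzI[where L = "real n" and B = 1])
      fix x y
      have "\<bar>g n x - g n y\<bar> \<le> \<bar>real n * infdist x K - real n * infdist y K\<bar>" by (auto simp: g_def)
      also have "\<dots> \<le> real n * dist x y"
        using infdist_triangle_abs[of x K y] by (simp add: right_diff_distrib[symmetric] abs_mult mult_left_mono)
      finally show "\<bar>g n x - g n y\<bar> \<le> real n * dist x y" .
      show "\<bar>g n x\<bar> \<le> 1" using g01[of n x] by simp
    qed simp
    have [measurable]: "g n \<in> borel_measurable borel" for n
      using bounded_lipschitz_borel[OF lip] by (rule bounded_borel_measurable)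
    have le1: "\<bar>(indicator K x - g n x) * (indicator K x - g n x)\<bar> \<le> 1" for n x
    proof -
      have "\<bar>indicator K x - g n x\<bar> \<le> 1" using g01[of n x] by (auto simp: indicator_def)
      then show ?thesis unfolding abs_mult by (intro mult_le_one) auto
    qed
    have "(\<lambda>n. ip (\<lambda>x. indicator K x - g n x) (\<lambda>x. indicator K x - g n x)) \<longlonglongrightarrow> (\<integral>x. 0 \<partial>M)"
      unfolding ip_def
    proof (rule integral_dominated_convergence[where w = "\<lambda>_. 1"])
      show "AE x in M. (\<lambda>n. (indicator K x - g n x) * (indicator K x - g n x)) \<longlonglongrightarrow> 0"
      proof (rule AE_I2)
        fix x
        have "(\<lambda>n. g n x) \<longlonglongrightarrow> indicator K x"
          unfolding g_def using infdist_bump[of K x] K(1) False by (simp add: compact_imp_closed)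
        then have "(\<lambda>n. (indicator K x - g n x) * (indicator K x - g n x)) \<longlonglongrightarrow> (indicator K x - indicator K x) * (indicator K x - indicator K x)"
          by (intro tendsto_intros)
        then show "(\<lambda>n. (indicator K x - g n x) * (indicator K x - g n x)) \<longlonglongrightarrow> 0" by simp
      qed
    qed (use le1 in auto)
    then have "(\<lambda>n. ip (\<lambda>x. indicator K x - g n x) (\<lambda>x. indicator K x - g n x)) \<longlonglongrightarrow> 0" by simp
    moreover have "0 < (\<epsilon> / 2)\<^sup>2" using \<epsilon> by simp
    ultimately have "\<forall>\<^sub>F n in sequentially. ip (\<lambda>x. indicator K x - g n x) (\<lambda>x. indicator K x - g n x) < (\<epsilon> / 2)\<^sup>2"
      by (rule order_tendstoD(2))
    then obtain n where "ip (\<lambda>x. indicator K x - g n x) (\<lambda>x. indicator K x - g n x) < (\<epsilon> / 2)\<^sup>2"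
      using eventually_happens'[OF sequentially_bot] by blast
    then have "nm (\<lambda>x. indicator K x - g n x) < \<epsilon> / 2" using \<epsilon> by (intro nm_less) auto
    then show ?thesis using that lip by blast
  qed
  have "nm (\<lambda>x. indicator A x - g x) \<le> nm (\<lambda>x. indicator A x - indicator K x) + nm (\<lambda>x. indicator K x - g x)"
    using bounded_lipschitz_borel[OF g(1)] by (intro nm_triangle_diff bbi) auto
  then have "nm (\<lambda>x. indicator A x - g x) < \<epsilon>" using 1 g(2) by simp
  then show ?thesis using g(1) by blast
qed

lemma lipschitz_approx_simple:
  assumes "finite S" "\<And>k. k \<in> S \<Longrightarrow> A k \<in> sets borel" "0 < \<epsilon>"
  shows "\<exists>g. bounded_lipschitz g \<and> nm (\<lambda>x. (\<Sum>k\<in>S. c k * indicator (A k) x) - g x) < \<epsilon>"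
  using assms
proof (induction S arbitrary: \<epsilon> rule: finite_induct)
  case empty
  have "bounded_lipschitz (\<lambda>_::'a. 0::real)"
    unfolding bounded_lipschitz_def by (intro conjI exI[of _ 0]) auto
  then show ?case using empty by (intro exI[of _ "\<lambda>_. 0"]) (simp add: nm_def ip_def)
next
  case (insert j S)
  have bbi: "bounded_borel (indicator X :: 'a \<Rightarrow> real)" if "X \<in> sets borel" for X
    using that by (intro bounded_borelI[where B = 1]) (auto simp: indicator_def)
  have half: "0 < \<epsilon> / 2" using insert.prems by simp
  obtain g where g: "bounded_lipschitz g" "nm (\<lambda>x. (\<Sum>k\<in>S. c k * indicator (A k) x) - g x) < \<epsilon> / 2"
    using insert.IH[OF insert.prems(1) half] by auto
  define \<eta> where "\<eta> = \<epsilon> / 2 / (\<bar>c j\<bar> + 1)"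
  have \<eta>: "0 < \<eta>" using half by (simp add: \<eta>_def)
  obtain k where k: "bounded_lipschitz k" "nm (\<lambda>x. indicator (A j) x - k x) < \<eta>"
    using lipschitz_approx_indicator[OF insert.prems(1)[of j] \<eta>] by auto
  have "nm (\<lambda>x. c j * (indicator (A j) x - k x)) = \<bar>c j\<bar> * nm (\<lambda>x. indicator (A j) x - k x)"
  proof -
    have "ip (\<lambda>x. c j * (indicator (A j) x - k x)) (\<lambda>x. c j * (indicator (A j) x - k x))
      = (c j)\<^sup>2 * ip (\<lambda>x. indicator (A j) x - k x) (\<lambda>x. indicator (A j) x - k x)"
      by (subst ip_cmult_left, subst ip_commute, subst ip_cmult_left) (simp add: power2_eq_square)
    then show ?thesis by (simp add: nm_def real_sqrt_mult)
  qed
  also have "\<dots> \<le> \<bar>c j\<bar> * \<eta>" using k(2) by (intro mult_left_mono) auto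
  also have "\<dots> \<le> (\<bar>c j\<bar> + 1) * \<eta>" using \<eta> by (intro mult_right_mono) auto
  also have "\<dots> = \<epsilon> / 2" by (simp add: \<eta>_def field_simps)
  finally have kj: "nm (\<lambda>x. c j * (indicator (A j) x - k x)) \<le> \<epsilon> / 2" .
  have "(\<lambda>x. (\<Sum>k\<in>insert j S. c k * indicator (A k) x) - (c j * k x + g x))
    = (\<lambda>x. c j * (indicator (A j) x - k x) + ((\<Sum>k\<in>S. c k * indicator (A k) x) - g x))"
    unfolding sum.insert[OF insert.hyps] by (simp add: fun_eq_iff algebra_simps)
  moreover have "nm (\<lambda>x. c j * (indicator (A j) x - k x) + ((\<Sum>k\<in>S. c k * indicator (A k) x) - g x))
    \<le> nm (\<lambda>x. c j * (indicator (A j) x - k x)) + nm (\<lambda>x. (\<Sum>k\<in>S. c k * indicator (A k) x) - g x)"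
    using insert.prems(1) g(1) k(1)
    by (intro nm_triangle bounded_borel_cmult bounded_borel_diff bounded_borel_sum bbi bounded_lipschitz_borel) auto
  ultimately have "nm (\<lambda>x. (\<Sum>k\<in>insert j S. c k * indicator (A k) x) - (c j * k x + g x)) < \<epsilon>"
    using kj g(2) by simp
  then show ?case using bounded_lipschitz_add[OF bounded_lipschitz_cmult[OF k(1)] g(1)] by blast
qed

lemma lipschitz_approx:
  assumes f: "bounded_borel f" and \<epsilon>: "0 < \<epsilon>"
  shows "\<exists>g. bounded_lipschitz g \<and> nm (\<lambda>x. f x - g x) < \<epsilon>"
proof -
  obtain B where B: "\<And>x. \<bar>f x\<bar> \<le> B" using f unfolding bounded_borel_def by blast
  have [measurable]: "f \<in> borel_measurable borel" using f by (rule bounded_borel_measurable)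
  obtain n :: nat where n: "inverse (real (Suc n)) < \<epsilon> / 2" using reals_Archimedean[of "\<epsilon> / 2"] \<epsilon> by auto
  define N where "N = real (Suc n)"
  have N: "0 < N" "1 / N < \<epsilon> / 2" using n by (auto simp: N_def inverse_eq_divide)
  define m where "m = \<lceil>N * B\<rceil> + 1"
  define A where "A k = {x. \<lfloor>N * f x\<rfloor> = k}" for k
  have A: "A k \<in> sets borel" for k unfolding A_def by measurable
  define s where "s x = (\<Sum>k\<in>{-m..m}. (of_int k / N) * indicator (A k) x)" for x
  have s: "s x = of_int \<lfloor>N * f x\<rfloor> / N" for x
  proof -
    have "\<bar>N * f x\<bar> \<le> N * B" using B N(1) by (simp add: abs_mult)
    then have "\<lfloor>N * f x\<rfloor> \<in> {-m..m}" unfolding m_def by (simp, linarith)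
    moreover have "s x = (\<Sum>k\<in>{-m..m}. if k = \<lfloor>N * f x\<rfloor> then of_int k / N else 0)"
      unfolding s_def by (intro sum.cong) (auto simp: A_def indicator_def)
    ultimately show ?thesis by simp
  qed
  have bs: "bounded_borel s"
    unfolding s_def using A by (intro bounded_borel_sum bounded_borel_cmult bounded_borelI[where B = 1]) (auto simp: indicator_def)
  have "\<bar>f x - s x\<bar> \<le> 1 / N" for x
  proof -
    have "0 \<le> N * f x - of_int \<lfloor>N * f x\<rfloor>" "N * f x - of_int \<lfloor>N * f x\<rfloor> \<le> 1" by linarith+
    then have "\<bar>N * f x - of_int \<lfloor>N * f x\<rfloor>\<bar> / N \<le> 1 / N" using N(1) by (intro divide_right_mono) auto
    moreover have "\<bar>f x - s x\<bar> = \<bar>N * f x - of_int \<lfloor>N * f x\<rfloor>\<bar> / N"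
      using N(1) unfolding s by (simp add: field_simps flip: abs_divide)
    ultimately show ?thesis by simp
  qed
  then have "(f x - s x) * (f x - s x) \<le> (1 / N)\<^sup>2" for x
    by (metis abs_le_square_iff abs_of_nonneg N(1) power2_eq_square zero_le_divide_1_iff less_imp_le)
  then have "ip (\<lambda>x. f x - s x) (\<lambda>x. f x - s x) \<le> (\<integral>x. (1 / N)\<^sup>2 \<partial>M)"
    unfolding ip_def using f bs
    by (intro integral_mono integrable_bounded_borel bounded_borel_mult bounded_borel_diff) auto
  then have "nm (\<lambda>x. f x - s x) \<le> 1 / N" using N(1) by (simp add: nm_def real_le_lsqrt prob_space)
  moreover obtain g where g: "bounded_lipschitz g" "nm (\<lambda>x. s x - g x) < \<epsilon> / 2"
    using lipschitz_approx_simple[of "{-m..m}" A "\<epsilon> / 2" "\<lambda>k. of_int k / N"] A \<epsilon> unfolding s_def by auto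
  moreover have "nm (\<lambda>x. f x - g x) \<le> nm (\<lambda>x. f x - s x) + nm (\<lambda>x. s x - g x)"
    by (intro nm_triangle_diff f bs bounded_lipschitz_borel g(1))
  ultimately show ?thesis using N(2) by (intro exI[of _ g]) simp
qed

text \<open>
  For selfadjoint \<open>T\<close> the numbers \<open>\<parallel>T\<^sup>n k\<parallel>\<^sup>2\<close> are log-convex, so a geometric bound with an unknown
  constant gives the contraction of the very first step. The constant may depend on the Lipschitz
  function; only the rate must not, and density of the Lipschitz functions does the rest. The
  projection \<open>E\<close> removes the functions that \<open>T\<close> fixes.
\<close>
lemma contraction_from_lipschitz_rate:
  fixes T E :: "('a \<Rightarrow> real) \<Rightarrow> 'a \<Rightarrow> real"
  assumes T: "\<And>f. bounded_borel f \<Longrightarrow> bounded_borel (T f)"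
    and E: "\<And>f. bounded_borel f \<Longrightarrow> bounded_borel (E f)"
    and T_diff: "\<And>f g. bounded_borel f \<Longrightarrow> bounded_borel g \<Longrightarrow> T (\<lambda>x. f x - g x) = (\<lambda>x. T f x - T g x)"
    and E_diff: "\<And>f g. bounded_borel f \<Longrightarrow> bounded_borel g \<Longrightarrow> E (\<lambda>x. f x - g x) = (\<lambda>x. E f x - E g x)"
    and T_nm: "\<And>f. bounded_borel f \<Longrightarrow> nm (T f) \<le> nm f"
    and E_nm: "\<And>f. bounded_borel f \<Longrightarrow> nm (E f) \<le> nm f"
    and T_sa: "\<And>f g. bounded_borel f \<Longrightarrow> bounded_borel g \<Longrightarrow> ip (T f) g = ip f (T g)"
    and r: "0 \<le> r"
    and rate: "\<And>f. bounded_lipschitz f \<Longrightarrow> \<exists>C. \<forall>n. ip ((T ^^ n) (\<lambda>x. f x - E f x)) ((T ^^ n) (\<lambda>x. f x - E f x)) \<le> C * (r\<^sup>2) ^ n"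
    and f: "bounded_borel f"
  shows "nm (T (\<lambda>x. f x - E f x)) \<le> r * nm (\<lambda>x. f x - E f x)"
proof (rule field_le_epsilon)
  have lip: "nm (T (\<lambda>x. g x - E g x)) \<le> r * nm (\<lambda>x. g x - E g x)" if g: "bounded_lipschitz g" for g
  proof -
    define k where "k n = (T ^^ n) (\<lambda>x. g x - E g x)" for n
    have bg: "bounded_borel g" using g by (rule bounded_lipschitz_borel)
    have bk: "bounded_borel (k n)" for n
      by (induction n) (auto simp: k_def intro: T E bounded_borel_diff bg)
    obtain C where C: "\<And>n. ip (k n) (k n) \<le> C * (r\<^sup>2) ^ n" using rate[OF g] by (auto simp: k_def)
    have "ip (k 1) (k 1) \<le> r\<^sup>2 * ip (k 0) (k 0)"
    proof (rule log_convex_rate[where C = C and s = "\<lambda>n. ip (k n) (k n)"])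
      fix n
      have "ip (k (Suc n)) (k (Suc n)) = ip (k n) (k (Suc (Suc n)))"
        using T_sa[OF bk[of n] bk[of "Suc n"]] by (simp add: k_def)
      then show "(ip (k (Suc n)) (k (Suc n)))\<^sup>2 \<le> ip (k n) (k n) * ip (k (Suc (Suc n))) (k (Suc (Suc n)))"
        using ip_cauchy_schwarz[OF bk bk] by simp
    qed (use C r in auto)
    then have "nm (k 1) \<le> sqrt (r\<^sup>2 * ip (k 0) (k 0))" by (simp add: nm_def)
    then show ?thesis using r by (simp add: k_def nm_def real_sqrt_mult)
  qed
  fix \<epsilon> :: real assume \<epsilon>: "0 < \<epsilon>"
  \<comment> \<open>replacing \<open>f\<close> by \<open>g\<close> costs \<open>2 \<eta>\<close> on the left and \<open>2 r \<eta>\<close> on the right\<close>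
  define \<eta> where "\<eta> = \<epsilon> / (2 * r + 2)"
  have \<eta>: "0 < \<eta>" using \<epsilon> r by (simp add: \<eta>_def)
  obtain g where g: "bounded_lipschitz g" "nm (\<lambda>x. f x - g x) < \<eta>" using lipschitz_approx[OF f \<eta>] by blast
  have bg: "bounded_borel g" using g(1) by (rule bounded_lipschitz_borel)
  define F where "F = (\<lambda>x. f x - E f x)"
  define G where "G = (\<lambda>x. g x - E g x)"
  have bF: "bounded_borel F" and bG: "bounded_borel G" unfolding F_def G_def using f bg E by (auto intro: bounded_borel_diff)
  have FG: "nm (\<lambda>x. F x - G x) \<le> 2 * \<eta>"
  proof -
    have "(\<lambda>x. F x - G x) = (\<lambda>x. (f x - g x) - E (\<lambda>x. f x - g x) x)"
      using E_diff[OF f bg] by (simp add: F_def G_def fun_eq_iff)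
    then have "nm (\<lambda>x. F x - G x) = nm (\<lambda>x. (f x - g x) - E (\<lambda>x. f x - g x) x)" by (rule arg_cong)
    also have "\<dots> \<le> nm (\<lambda>x. f x - g x) + nm (E (\<lambda>x. f x - g x))"
      using nm_triangle_diff[of "\<lambda>x. f x - g x" "\<lambda>_. 0" "E (\<lambda>x. f x - g x)"] nm_diff_commute[of "\<lambda>_. 0"]
      by (simp add: f bg E bounded_borel_diff)
    also have "\<dots> \<le> 2 * \<eta>" using E_nm[OF bounded_borel_diff[OF f bg]] g(2) by simp
    finally show ?thesis .
  qed
  have "nm (T F) \<le> nm (\<lambda>x. T F x - T G x) + nm (T G)" by (intro nm_triangle_le T bF bG)
  also have "nm (\<lambda>x. T F x - T G x) \<le> 2 * \<eta>"
    using T_nm[OF bounded_borel_diff[OF bF bG]] T_diff[OF bF bG] FG by simp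
  also have "nm (T G) \<le> r * nm G" using lip[OF g(1)] by (simp add: G_def)
  also have "r * nm G \<le> r * (nm F + 2 * \<eta>)"
    using nm_triangle_le[OF bG bF] FG nm_diff_commute[of F G] r by (intro mult_left_mono) auto
  finally have "nm (T F) \<le> r * nm F + (2 * r + 2) * \<eta>" by (simp add: algebra_simps)
  also have "(2 * r + 2) * \<eta> = \<epsilon>" using r by (simp add: \<eta>_def)
  finally show "nm (T (\<lambda>x. f x - E f x)) \<le> r * nm (\<lambda>x. f x - E f x) + \<epsilon>" by (simp add: F_def)
qed

end

section \<open>Reversible Gaussian block updates\<close>

lemma polish_prob_gauss:
  fixes Q :: "real ^ 'n ^ 'n"
  assumes "sym_pos_def Q" shows "polish_prob (gauss_measure \<mu> Q)"
proof -
  interpret prob_space "gauss_measure \<mu> Q" by (rule prob_space_gauss_measure[OF assms])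
  show ?thesis by unfold_locales simp
qed

lemma sym_pos_def_coercive:
  fixes Q :: "real ^ 'n ^ 'n"
  assumes Q: "sym_pos_def Q"
  obtains l where "0 < l" "\<And>v. l * (v \<bullet> v) \<le> v \<bullet> (Q *v v)"
proof -
  obtain e a where ea: "orthonormal e" "\<And>i. Q *v e i = a i *\<^sub>R e i" "\<And>i. 0 < a i"
    using sym_pos_def_eigenbasis[OF Q] by blast
  define l where "l = Min (range a)"
  have l: "0 < l" using ea(3) by (simp add: l_def)
  have "l * (v \<bullet> v) \<le> v \<bullet> (Q *v v)" for v
  proof -
    have "l * (v \<bullet> v) = (\<Sum>i\<in>UNIV. l * (e i \<bullet> v)\<^sup>2)"
      by (subst orthonormal_parseval[OF ea(1)]) (simp add: sum_distrib_left power2_eq_square)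
    also have "\<dots> \<le> (\<Sum>i\<in>UNIV. a i * (e i \<bullet> v)\<^sup>2)"
      by (intro sum_mono mult_right_mono) (auto simp: l_def)
    also have "\<dots> = v \<bullet> (Q *v v)" using Q
      by (simp add: eigenbasis_quadratic_form[OF ea(1,2)] sym_pos_def_def)
    finally show ?thesis .
  qed
  then show ?thesis using l that by blast
qed

lemma sym_pos_def_det_pos:
  fixes Q :: "real ^ 'n ^ 'n"
  assumes Q: "sym_pos_def Q" shows "0 < det Q"
proof -
  obtain e a where "orthonormal e" "\<And>i. Q *v e i = a i *\<^sub>R e i" "\<And>i. 0 < a i"
    using sym_pos_def_eigenbasis[OF Q] by blast
  then show ?thesis by (simp add: det_eq_prod_eigenvalues[of e Q a] prod_pos)
qed

lemma sym_pos_def_scale: "sym_pos_def Q \<Longrightarrow> 0 < c \<Longrightarrow> sym_pos_def (c *\<^sub>R Q)" for Q :: "real ^ 'n ^ 'n"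
  by (auto simp: sym_pos_def_def transpose_def vec_eq_iff scaleR_matrix_vector_assoc[symmetric])

text \<open>
  As \<open>q \<le> 4 exp (q/4)\<close>, the energy times the density for \<open>Q\<close> is at most a multiple of the density
  for \<open>Q / 2\<close>.
\<close>
lemma integrable_gauss_energy:
  fixes Q :: "real ^ 'n ^ 'n"
  assumes Q: "sym_pos_def Q"
  shows "integrable (gauss_measure \<mu> Q) (\<lambda>x. (x - \<mu>) \<bullet> (Q *v (x - \<mu>)))"
proof -
  define q where "q x = (x - \<mu>) \<bullet> (Q *v (x - \<mu>))" for x
  have q0: "0 \<le> q x" for x using Q by (cases "x = \<mu>") (auto simp: q_def sym_pos_def_def less_imp_le)
  have [measurable]: "q \<in> borel_measurable borel" unfolding q_def by measurable
  define R where "R = (1 / 2) *\<^sub>R Q"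
  have R: "sym_pos_def R" unfolding R_def by (rule sym_pos_def_scale[OF Q]) simp
  interpret R: prob_space "gauss_measure \<mu> R" by (rule prob_space_gauss_measure[OF R])
  have det: "0 < det Q" "0 < det R"
    using sym_pos_def_det_pos[OF Q] sym_pos_def_det_pos[OF R] .
  define k where "k = sqrt (det Q / (2 * pi) ^ CARD('n)) / sqrt (det R / (2 * pi) ^ CARD('n))"
  have k: "0 \<le> k" using det by (simp add: k_def)
  have le: "gauss_density \<mu> Q x * q x \<le> (4 * k) * gauss_density \<mu> R x" for x
  proof -
    have "q x / 4 \<le> exp (q x / 4)" using exp_ge_add_one_self[of "q x / 4"] by linarith
    then have "q x \<le> 4 * exp (q x / 4)" by simp
    then have "exp (- q x / 2) * q x \<le> exp (- q x / 2) * (4 * exp (q x / 4))" by (intro mult_left_mono) auto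
    also have "\<dots> = 4 * exp (- q x / 4)" by (simp add: exp_add[symmetric])
    also have "- q x / 4 = - ((x - \<mu>) \<bullet> (R *v (x - \<mu>))) / 2"
      by (simp add: q_def R_def scaleR_matrix_vector_assoc[symmetric])
    finally have "sqrt (det Q / (2 * pi) ^ CARD('n)) * (exp (- q x / 2) * q x)
       \<le> sqrt (det Q / (2 * pi) ^ CARD('n)) * (4 * exp (- ((x - \<mu>) \<bullet> (R *v (x - \<mu>))) / 2))"
      using det by (intro mult_left_mono) auto
    moreover have "sqrt (det Q / (2 * pi) ^ CARD('n)) = k * sqrt (det R / (2 * pi) ^ CARD('n))"
      using det by (simp add: k_def)
    ultimately show ?thesis by (simp add: gauss_density_def q_def mult_ac)
  qed
  have "integrable (gauss_measure \<mu> R) (\<lambda>_. 4 * k)" by simp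
  then have "integrable lborel (\<lambda>x. gauss_density \<mu> R x *\<^sub>R (4 * k))"
    unfolding gauss_measure_def using gauss_density_pos[OF R] by (subst (asm) integrable_density) (auto simp: less_imp_le)
  then have "integrable lborel (\<lambda>x. gauss_density \<mu> Q x *\<^sub>R q x)"
    by (rule Bochner_Integration.integrable_bound)
       (use le q0 k gauss_density_pos[OF Q, of \<mu>] gauss_density_pos[OF R, of \<mu>] in \<open>auto simp: mult_ac less_imp_le abs_mult intro!: AE_I2\<close>)
  then show ?thesis
    unfolding gauss_measure_def q_def[symmetric] using gauss_density_pos[OF Q]
    by (subst integrable_density) (auto simp: less_imp_le)
qed

interpretation std: prob_space "std_gauss :: (real ^ 'n) measure"
  by (rule prob_space_gauss_measure[OF sym_pos_def_one])

lemma std_prob_UNIV [simp]: "measure (std_gauss :: (real ^ 'n) measure) UNIV = 1"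
  using std.prob_space by simp

context eigenblock begin

interpretation Pi: polish_prob "gauss_measure \<mu> Q" by (rule polish_prob_gauss[OF Q])
interpretation pair: pair_prob_space "gauss_measure \<mu> Q" "std_gauss :: (real ^ 'n) measure" ..

lemma measurable_w [measurable]: "w i \<in> borel_measurable borel" unfolding w_def by measurable

lemma measurable_step [measurable (raw)]:
  assumes [measurable]: "f \<in> N \<rightarrow>\<^sub>M borel" "g \<in> N \<rightarrow>\<^sub>M borel"
  shows "(\<lambda>z. step u \<beta> (f z) (g z)) \<in> N \<rightarrow>\<^sub>M borel"
  unfolding step_def comb_def by measurable

text \<open>The Markov operator of a block move.\<close>
definition op :: "('n \<Rightarrow> real) \<Rightarrow> ('n \<Rightarrow> real) \<Rightarrow> (real ^ 'n \<Rightarrow> real) \<Rightarrow> real ^ 'n \<Rightarrow> real" where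
  "op u \<beta> f x = (\<integral>\<xi>. f (step u \<beta> x \<xi>) \<partial>std_gauss)"

lemma integrable_std_bounded:
  assumes "bounded_borel f" "g \<in> borel_measurable borel"
  shows "integrable std_gauss (\<lambda>\<xi>. f (g \<xi>))"
proof -
  obtain B where "\<And>x. \<bar>f x\<bar> \<le> B" using assms(1) unfolding bounded_borel_def by blast
  moreover note [measurable] = bounded_borel_measurable[OF assms(1)] assms(2)
  ultimately show ?thesis by (intro std.integrable_const_bound[where B = B]) auto
qed

lemma integrable_std_step: "bounded_borel f \<Longrightarrow> integrable std_gauss (\<lambda>\<xi>. f (step u \<beta> x \<xi>))"
  by (rule integrable_std_bounded) measurable

lemma bounded_borel_op: assumes f: "bounded_borel f" shows "bounded_borel (op u \<beta> f)"
proof -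
  obtain B where B: "\<And>x. \<bar>f x\<bar> \<le> B" using f unfolding bounded_borel_def by blast
  note [measurable] = bounded_borel_measurable[OF f]
  have "\<bar>op u \<beta> f x\<bar> \<le> B" for x
  proof -
    have "\<bar>op u \<beta> f x\<bar> \<le> (\<integral>\<xi>. \<bar>f (step u \<beta> x \<xi>)\<bar> \<partial>std_gauss)" unfolding op_def by (rule integral_abs_bound)
    also have "\<dots> \<le> (\<integral>\<xi>. B \<partial>(std_gauss :: (real ^ 'n) measure))"
      by (intro Bochner_Integration.integral_mono integrable_abs integrable_std_step f) (use B in auto)
    finally show ?thesis by simp
  qed
  moreover have "op u \<beta> f \<in> borel_measurable borel" unfolding op_def by measurable
  ultimately show ?thesis by (rule bounded_borelI[rotated])
qed

lemma op_diff: "bounded_borel f \<Longrightarrow> bounded_borel g \<Longrightarrow> op u \<beta> (\<lambda>x. f x - g x) = (\<lambda>x. op u \<beta> f x - op u \<beta> g x)"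
  by (simp add: op_def fun_eq_iff integrable_std_step)

lemma op_cong_const: "(\<And>\<xi>. f (step u \<beta> x \<xi>) = c) \<Longrightarrow> op u \<beta> f x = c"
  by (simp add: op_def)

lemma op_square_le:
  assumes f: "bounded_borel f" shows "(op u \<beta> f x)\<^sup>2 \<le> op u \<beta> (\<lambda>x. (f x)\<^sup>2) x"
proof -
  have "(\<integral>\<xi>. f (step u \<beta> x \<xi>) * 1 \<partial>std_gauss)\<^sup>2 \<le> (\<integral>\<xi>. (f (step u \<beta> x \<xi>))\<^sup>2 \<partial>std_gauss) * (\<integral>\<xi>. 1\<^sup>2 \<partial>(std_gauss :: (real ^ 'n) measure))"
    using f by (intro integral_cauchy_schwarz) (auto intro: integrable_std_step integrable_std_step[OF bounded_borel_power2])
  then show ?thesis by (simp add: op_def)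
qed

text \<open>Exactly the moves for which \<open>excess\<close> vanishes and the noise is determined by the move.\<close>
definition reversible where
  "reversible u \<beta> \<longleftrightarrow> (\<forall>i\<in>I. \<beta> i \<noteq> 0 \<and> (\<beta> i)\<^sup>2 = 2 * u i - a i * (u i)\<^sup>2)"

lemma reversible_flip:
  assumes "reversible u \<beta>"
  shows "distr (gauss_measure \<mu> Q \<Otimes>\<^sub>M std_gauss) borel (flip u \<beta>) = gauss_measure \<mu> Q \<Otimes>\<^sub>M std_gauss"
proof -
  have "excess u \<beta> x \<xi> = 0" for x \<xi>
    using assms by (auto simp: excess_def reversible_def intro!: sum.neutral)
  then show ?thesis using pair_gauss_flip[of \<beta> u] assms by (simp add: reversible_def density_1)
qed

lemma sets_pair_gauss [measurable_cong]:
  "sets (gauss_measure \<mu> Q \<Otimes>\<^sub>M (std_gauss :: (real ^ 'n) measure)) = sets borel"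
  by (simp add: borel_prod[symmetric] cong: sets_pair_measure_cong)

lemma measurable_flip:
  "reversible u \<beta> \<Longrightarrow> flip u \<beta> \<in> gauss_measure \<mu> Q \<Otimes>\<^sub>M std_gauss \<rightarrow>\<^sub>M borel"
  using distr_lborel_flip(1)[of \<beta> u]
  by (simp add: reversible_def measurable_cong_sets[OF sets_pair_gauss refl])

lemma reversible_integral:
  fixes h :: "(real ^ 'n) \<times> (real ^ 'n) \<Rightarrow> real"
  assumes r: "reversible u \<beta>" and h: "h \<in> borel_measurable borel"
  shows "(\<integral>z. h z \<partial>(gauss_measure \<mu> Q \<Otimes>\<^sub>M std_gauss)) = (\<integral>z. h (flip u \<beta> z) \<partial>(gauss_measure \<mu> Q \<Otimes>\<^sub>M std_gauss))"
    and "integrable (gauss_measure \<mu> Q \<Otimes>\<^sub>M std_gauss) h \<longleftrightarrow> integrable (gauss_measure \<mu> Q \<Otimes>\<^sub>M std_gauss) (\<lambda>z. h (flip u \<beta> z))"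
  using h measurable_flip[OF r]
  by (subst reversible_flip[OF r, symmetric], simp add: integral_distr integrable_distr_eq)+

lemma integrable_pair_bounded:
  assumes h: "h \<in> borel_measurable borel" "\<And>z. \<bar>h z\<bar> \<le> B"
  shows "integrable (gauss_measure \<mu> Q \<Otimes>\<^sub>M std_gauss) (h :: (real ^ 'n) \<times> (real ^ 'n) \<Rightarrow> real)"
  using h by (intro pair.P.integrable_const_bound[where B = B]) auto

text \<open>Exchange the two ends of the move by \<open>reversible_integral\<close>.\<close>
lemma op_selfadjoint:
  assumes r: "reversible u \<beta>" and f: "bounded_borel f" and g: "bounded_borel g"
  shows "Pi.ip (op u \<beta> f) g = Pi.ip f (op u \<beta> g)"
proof -
  have *: "Pi.ip k (op u \<beta> l) = (\<integral>z. k (fst z) * l (fst (flip u \<beta> z)) \<partial>(gauss_measure \<mu> Q \<Otimes>\<^sub>M std_gauss))"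
    if k: "bounded_borel k" and l: "bounded_borel l" for k l
  proof -
    note [measurable] = bounded_borel_measurable[OF k] bounded_borel_measurable[OF l]
    obtain B C where BC: "0 \<le> B" "\<And>x. \<bar>k x\<bar> \<le> B" "\<And>x. \<bar>l x\<bar> \<le> C" using k l by (metis bounded_borelE)
    have m: "(\<lambda>z. k (fst z) * l (step u \<beta> (fst z) (snd z))) \<in> borel_measurable borel"
      unfolding borel_prod[symmetric] by measurable
    have "\<bar>k (fst z) * l (step u \<beta> (fst z) (snd z))\<bar> \<le> B * C" for z
      using BC by (simp add: abs_mult mult_mono)
    then have "integrable (gauss_measure \<mu> Q \<Otimes>\<^sub>M std_gauss) (\<lambda>z. k (fst z) * l (step u \<beta> (fst z) (snd z)))"
      by (rule integrable_pair_bounded[OF m])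
    from pair.integral_fst'[OF this] show ?thesis
      by (simp add: Pi.ip_def op_def flip_def case_prod_beta)
  qed
  have [measurable]: "f \<in> borel_measurable borel" "g \<in> borel_measurable borel"
    using f g by (auto intro: bounded_borel_measurable)
  have fm: "flip u \<beta> \<in> borel_measurable borel"
    using distr_lborel_flip(1)[of \<beta> u] r by (simp add: reversible_def)
  have "(\<lambda>z. f (fst z) * g (fst (flip u \<beta> z))) \<in> borel_measurable borel"
  proof -
    have [measurable]: "flip u \<beta> \<in> borel \<Otimes>\<^sub>M borel \<rightarrow>\<^sub>M borel \<Otimes>\<^sub>M borel" using fm by (simp add: borel_prod)
    show ?thesis unfolding borel_prod[symmetric] by measurable
  qed
  moreover have "flip u \<beta> (flip u \<beta> z) = z" for z
    using step_rnoise[of \<beta> u] rnoise_rnoise[of \<beta> u] r by (cases z) (auto simp: flip_def reversible_def)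
  ultimately have "Pi.ip f (op u \<beta> g) = (\<integral>z. g (fst z) * f (fst (flip u \<beta> z)) \<partial>(gauss_measure \<mu> Q \<Otimes>\<^sub>M std_gauss))"
    unfolding *[OF f g] by (subst reversible_integral(1)[OF r]) (simp_all add: mult.commute)
  also have "\<dots> = Pi.ip g (op u \<beta> f)" by (rule *[OF g f, symmetric])
  finally show ?thesis by (simp add: Pi.ip_commute[of "op u \<beta> f" g])
qed

lemma op_nm:
  assumes r: "reversible u \<beta>" and f: "bounded_borel f" shows "Pi.nm (op u \<beta> f) \<le> Pi.nm f"
proof -
  have one: "op u \<beta> (\<lambda>_. 1) = (\<lambda>_. 1)" by (simp add: op_def fun_eq_iff)
  have "Pi.ip (op u \<beta> f) (op u \<beta> f) \<le> (\<integral>x. op u \<beta> (\<lambda>x. (f x)\<^sup>2) x \<partial>gauss_measure \<mu> Q)"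
    unfolding Pi.ip_def
    by (intro Bochner_Integration.integral_mono Pi.integrable_bounded_borel bounded_borel_mult bounded_borel_op bounded_borel_power2 f)
       (use op_square_le[OF f] in \<open>simp add: power2_eq_square\<close>)
  also have "\<dots> = Pi.ip (op u \<beta> (\<lambda>x. (f x)\<^sup>2)) (\<lambda>_. 1)" by (simp add: Pi.ip_def)
  also have "\<dots> = Pi.ip f f" unfolding op_selfadjoint[OF r bounded_borel_power2[OF f] bounded_borel_const] one
    by (simp add: Pi.ip_def power2_eq_square)
  finally show ?thesis by (simp add: Pi.nm_def)
qed

abbreviation Gibbs where "Gibbs \<equiv> op (\<lambda>i. 1 / a i) (\<lambda>i. 1 / sqrt (a i))"

lemma reversible_Gibbs: "reversible (\<lambda>i. 1 / a i) (\<lambda>i. 1 / sqrt (a i))"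
  by (auto simp: reversible_def I_def power_divide field_simps power2_eq_square)

lemma step_shift: "step u \<beta> (x + comb c) \<xi> = step u \<beta> x \<xi> + comb (\<lambda>i. (1 - a i * u i) * c i)"
proof -
  have "step u \<beta> (x + comb c) \<xi> = x + (comb c + comb (\<lambda>i. \<beta> i * (e i \<bullet> \<xi>) - u i * (w i x + a i * c i)))"
    unfolding step_def by (simp add: w_comb add.assoc cong: comb_cong)
  also have "comb c + comb (\<lambda>i. \<beta> i * (e i \<bullet> \<xi>) - u i * (w i x + a i * c i))
     = comb (\<lambda>i. \<beta> i * (e i \<bullet> \<xi>) - u i * w i x) + comb (\<lambda>i. (1 - a i * u i) * c i)"
    unfolding comb_add by (rule comb_cong) (simp add: algebra_simps)
  finally show ?thesis by (simp add: step_def add.assoc)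
qed

text \<open>
  For \<open>u = 1/a\<close> the new block does not depend on the old one. Hence \<open>Gibbs f\<close> is constant along the
  block, and every block move leaves it unchanged (\<open>op_Gibbs\<close>).
\<close>
lemma Gibbs_fibre: "Gibbs f (x + comb c) = Gibbs f x"
proof -
  have "comb (\<lambda>i. (1 - a i * (1 / a i)) * c i) = 0" by (rule comb_zero) (simp add: I_def)
  then show ?thesis by (simp add: op_def step_shift)
qed

lemma Gibbs_step: "Gibbs f (step u \<beta> x \<xi>) = Gibbs f x"
  by (simp add: step_def Gibbs_fibre)

lemma op_Gibbs: "op u \<beta> (Gibbs f) = Gibbs f"
  by (rule ext, rule op_cong_const) (rule Gibbs_step)

end

section \<open>The Ornstein--Uhlenbeck block update\<close>

lemma (in pair_prob_space) integrable_fst_component: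
  fixes f :: "_ \<Rightarrow> real"
  assumes "integrable M1 f"
  shows "integrable (M1 \<Otimes>\<^sub>M M2) (\<lambda>z. f (fst z))" and "(\<integral>z. f (fst z) \<partial>(M1 \<Otimes>\<^sub>M M2)) = (\<integral>x. f x \<partial>M1)"
proof -
  have [measurable]: "f \<in> borel_measurable M1" using assms by simp
  show i: "integrable (M1 \<Otimes>\<^sub>M M2) (\<lambda>z. f (fst z))"
    using assms by (intro Fubini_integrable) (auto simp: M2.prob_space)
  show "(\<integral>z. f (fst z) \<partial>(M1 \<Otimes>\<^sub>M M2)) = (\<integral>x. f x \<partial>M1)"
    using integral_fst'[OF i] by (simp add: M2.prob_space)
qed

lemma gauss_energy_diff:
  fixes Q :: "real ^ 'n ^ 'n"
  assumes Q: "sym_pos_def Q"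
  shows "(u - v) \<bullet> (Q *v (u - v)) \<le> 2 * (u \<bullet> (Q *v u)) + 2 * (v \<bullet> (Q *v v))"
proof -
  have sym: "transpose Q = Q" using Q by (simp add: sym_pos_def_def)
  have "0 \<le> (u + v) \<bullet> (Q *v (u + v))" using Q by (cases "u + v = 0") (auto simp: sym_pos_def_def less_imp_le)
  then show ?thesis
    by (simp add: matrix_vector_right_distrib matrix_vector_mult_diff_distrib inner_add_left inner_add_right
        inner_diff_left inner_diff_right)
qed

context eigenblock begin

interpretation Pi: polish_prob "gauss_measure \<mu> Q"
  by (rule polish_prob_gauss[OF Q])
interpretation pair: pair_prob_space "gauss_measure \<mu> Q" "std_gauss :: (real ^ 'n) measure" ..

lemma Q_comb: "comb c \<bullet> (Q *v comb c) = (\<Sum>i\<in>I. a i * (c i)\<^sup>2)"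
  using quad_comb[of \<mu> c] by (simp add: w_def)

text \<open>
  Lipschitz continuity along the block only, in the norm given by \<open>Q\<close>. The other coordinates stay
  fixed under a block update.
\<close>
definition fibre_lip where
  "fibre_lip L k \<longleftrightarrow> (\<forall>x c. \<bar>k (x + comb c) - k x\<bar> \<le> L * sqrt (\<Sum>i\<in>I. a i * (c i)\<^sup>2))"

text \<open>
  Run the move from \<open>x\<close> and from \<open>x + comb c\<close> with the same noise: the difference is multiplied by
  \<open>1 - a i u i\<close> in direction \<open>e i\<close>.
\<close>
lemma fibre_lip_op:
  assumes k: "fibre_lip L k" and bk: "bounded_borel k" and L: "0 \<le> L" and r: "0 \<le> r"
    and u: "\<And>i. i \<in> I \<Longrightarrow> \<bar>1 - a i * u i\<bar> \<le> r"
  shows "fibre_lip (L * r) (op u \<beta> k)"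
  unfolding fibre_lip_def
proof (intro allI)
  fix x c
  let ?c = "\<lambda>i. (1 - a i * u i) * c i"
  have "(\<Sum>i\<in>I. a i * (?c i)\<^sup>2) \<le> (\<Sum>i\<in>I. r\<^sup>2 * (a i * (c i)\<^sup>2))"
  proof (rule sum_mono)
    fix i assume "i \<in> I"
    then have "\<bar>1 - a i * u i\<bar> \<le> \<bar>r\<bar>" using u r by simp
    then have "(1 - a i * u i)\<^sup>2 \<le> r\<^sup>2" by (simp only: abs_le_square_iff)
    then have "(1 - a i * u i)\<^sup>2 * (a i * (c i)\<^sup>2) \<le> r\<^sup>2 * (a i * (c i)\<^sup>2)"
      using a_nonneg by (intro mult_right_mono) auto
    then show "a i * (?c i)\<^sup>2 \<le> r\<^sup>2 * (a i * (c i)\<^sup>2)" by (simp add: power_mult_distrib mult_ac)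
  qed
  then have "sqrt (\<Sum>i\<in>I. a i * (?c i)\<^sup>2) \<le> sqrt (r\<^sup>2 * (\<Sum>i\<in>I. a i * (c i)\<^sup>2))"
    by (simp add: sum_distrib_left)
  also have "\<dots> = r * sqrt (\<Sum>i\<in>I. a i * (c i)\<^sup>2)" using r by (simp add: real_sqrt_mult)
  finally have le: "sqrt (\<Sum>i\<in>I. a i * (?c i)\<^sup>2) \<le> r * sqrt (\<Sum>i\<in>I. a i * (c i)\<^sup>2)" .
  have "(\<lambda>\<xi>. step u \<beta> x \<xi> + comb ?c) \<in> borel_measurable borel" by measurable
  note int = integrable_std_bounded[OF bk this] integrable_std_step[OF bk, of u \<beta> x]
  have eq: "op u \<beta> k (x + comb c) - op u \<beta> k x = (\<integral>\<xi>. k (step u \<beta> x \<xi> + comb ?c) - k (step u \<beta> x \<xi>) \<partial>std_gauss)"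
    unfolding op_def step_shift
    by (rule Bochner_Integration.integral_diff[OF int, symmetric])
  have "\<bar>op u \<beta> k (x + comb c) - op u \<beta> k x\<bar> \<le> (\<integral>\<xi>. \<bar>k (step u \<beta> x \<xi> + comb ?c) - k (step u \<beta> x \<xi>)\<bar> \<partial>std_gauss)"
    unfolding eq by (rule integral_abs_bound)
  also have "\<dots> \<le> (\<integral>\<xi>. L * (r * sqrt (\<Sum>i\<in>I. a i * (c i)\<^sup>2)) \<partial>(std_gauss :: (real ^ 'n) measure))"
  proof (rule Bochner_Integration.integral_mono)
    show "integrable std_gauss (\<lambda>\<xi>. \<bar>k (step u \<beta> x \<xi> + comb ?c) - k (step u \<beta> x \<xi>)\<bar>)"
      by (rule integrable_abs[OF Bochner_Integration.integrable_diff[OF int]])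
    fix \<xi>
    have "\<bar>k (step u \<beta> x \<xi> + comb ?c) - k (step u \<beta> x \<xi>)\<bar> \<le> L * sqrt (\<Sum>i\<in>I. a i * (?c i)\<^sup>2)"
      using k by (simp only: fibre_lip_def)
    also have "\<dots> \<le> L * (r * sqrt (\<Sum>i\<in>I. a i * (c i)\<^sup>2))" by (rule mult_left_mono[OF le L])
    finally show "\<bar>k (step u \<beta> x \<xi> + comb ?c) - k (step u \<beta> x \<xi>)\<bar> \<le> L * (r * sqrt (\<Sum>i\<in>I. a i * (c i)\<^sup>2))" .
  qed simp
  finally show "\<bar>op u \<beta> k (x + comb c) - op u \<beta> k x\<bar> \<le> L * r * sqrt (\<Sum>i\<in>I. a i * (c i)\<^sup>2)"
    by (simp add: mult.assoc)
qed

definition energy where "energy = (\<integral>x. (x - \<mu>) \<bullet> (Q *v (x - \<mu>)) \<partial>gauss_measure \<mu> Q)"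

text \<open>
  A function that is orthogonal to its Gibbs average is controlled by its oscillation along the
  block. Comparing it at \<open>x\<close> and at a Gibbs-resampled \<open>y\<close> bounds the norm by the mean energy of the
  difference, as \<open>x\<close> and \<open>y\<close> both have law \<open>\<Pi>\<close>. The dimension-dependent factor is harmless, since only
  the geometric rate enters in \<open>contraction_from_lipschitz_rate\<close>.
\<close>
lemma fibre_lip_bound:
  assumes k: "fibre_lip L k" and bk: "bounded_borel k" and L: "0 \<le> L"
    and orth: "Pi.ip k (Gibbs k) = 0"
  shows "Pi.ip k k \<le> L\<^sup>2 * (4 * energy)"
proof -
  let ?M = "gauss_measure \<mu> Q \<Otimes>\<^sub>M (std_gauss :: (real ^ 'n) measure)"
  let ?u = "\<lambda>i. 1 / a i" and ?\<beta> = "\<lambda>i. 1 / sqrt (a i)"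
  define q where "q x = (x - \<mu>) \<bullet> (Q *v (x - \<mu>))" for x
  have qint: "integrable (gauss_measure \<mu> Q) q" unfolding q_def by (rule integrable_gauss_energy[OF Q])
  have [measurable]: "q \<in> borel_measurable borel" unfolding q_def by measurable
  note [measurable] = bounded_borel_measurable[OF bk]
  obtain B where B: "0 \<le> B" "\<And>x. \<bar>k x\<bar> \<le> B" using bounded_borelE[OF bk] by metis
  have le: "(k x - k y)\<^sup>2 \<le> (2 * B)\<^sup>2" for x y
  proof -
    have "\<bar>k x - k y\<bar> \<le> \<bar>2 * B\<bar>" using B(2)[of x] B(2)[of y] by linarith
    then show ?thesis by (simp only: abs_le_square_iff)
  qed
  have bG: "bounded_borel (Gibbs k)" by (rule bounded_borel_op[OF bk])
  let ?y = "\<lambda>z. step ?u ?\<beta> (fst z) (snd z)"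
  have "Pi.ip k k \<le> Pi.ip (\<lambda>x. k x - Gibbs k x) (\<lambda>x. k x - Gibbs k x)"
    using Pi.ip_nonneg[of "Gibbs k"] orth Pi.ip_commute[of "Gibbs k" k]
    by (simp add: Pi.ip_diff_left Pi.ip_diff_right bk bG bounded_borel_diff)
  also have "\<dots> \<le> (\<integral>x. (\<integral>\<xi>. (k x - k (step ?u ?\<beta> x \<xi>))\<^sup>2 \<partial>std_gauss) \<partial>gauss_measure \<mu> Q)"
    unfolding Pi.ip_def
  proof (rule Bochner_Integration.integral_mono)
    show "integrable (gauss_measure \<mu> Q) (\<lambda>x. (k x - Gibbs k x) * (k x - Gibbs k x))"
      by (intro Pi.integrable_bounded_borel bounded_borel_mult bounded_borel_diff bk bG)
    have "bounded_borel (\<lambda>x. \<integral>\<xi>. (k x - k (step ?u ?\<beta> x \<xi>))\<^sup>2 \<partial>std_gauss)"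
    proof (rule bounded_borelI)
      show "(\<lambda>x. \<integral>\<xi>. (k x - k (step ?u ?\<beta> x \<xi>))\<^sup>2 \<partial>std_gauss) \<in> borel_measurable borel" by measurable
      fix x
      have "(\<integral>\<xi>. (k x - k (step ?u ?\<beta> x \<xi>))\<^sup>2 \<partial>std_gauss) \<le> (\<integral>\<xi>. (2 * B)\<^sup>2 \<partial>(std_gauss :: (real ^ 'n) measure))"
      proof (rule Bochner_Integration.integral_mono)
        show "integrable std_gauss (\<lambda>\<xi>. (k x - k (step ?u ?\<beta> x \<xi>))\<^sup>2)"
          by (rule integrable_std_step[of "\<lambda>y. (k x - k y)\<^sup>2"]) (intro bounded_borel_power2 bounded_borel_diff bk bounded_borel_const)
      qed (simp, rule le)
      then show "\<bar>\<integral>\<xi>. (k x - k (step ?u ?\<beta> x \<xi>))\<^sup>2 \<partial>std_gauss\<bar> \<le> (2 * B)\<^sup>2" by simp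
    qed
    then show "integrable (gauss_measure \<mu> Q) (\<lambda>x. \<integral>\<xi>. (k x - k (step ?u ?\<beta> x \<xi>))\<^sup>2 \<partial>std_gauss)"
      by (rule Pi.integrable_bounded_borel)
    fix x
    have "op ?u ?\<beta> (\<lambda>y. k x - k y) x = k x - Gibbs k x"
      by (simp add: op_def integrable_std_step bk)
    then have "(k x - Gibbs k x)\<^sup>2 \<le> op ?u ?\<beta> (\<lambda>y. (k x - k y)\<^sup>2) x"
      using op_square_le[of "\<lambda>y. k x - k y" ?u ?\<beta> x] bk by (simp add: bounded_borel_diff)
    then show "(k x - Gibbs k x) * (k x - Gibbs k x) \<le> (\<integral>\<xi>. (k x - k (step ?u ?\<beta> x \<xi>))\<^sup>2 \<partial>std_gauss)"
      by (simp add: op_def power2_eq_square)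
  qed
  also have "\<dots> = (\<integral>z. (k (fst z) - k (?y z))\<^sup>2 \<partial>?M)"
  proof -
    have "integrable ?M (\<lambda>z. (k (fst z) - k (?y z))\<^sup>2)"
    proof (rule integrable_pair_bounded)
      show "(\<lambda>z. (k (fst z) - k (?y z))\<^sup>2) \<in> borel_measurable borel"
        unfolding borel_prod[symmetric] by measurable
      show "\<bar>(k (fst z) - k (?y z))\<^sup>2\<bar> \<le> (2 * B)\<^sup>2" for z
        using le by simp
    qed
    from pair.integral_fst'[OF this] show ?thesis by simp
  qed
  also have "\<dots> \<le> (\<integral>z. L\<^sup>2 * (2 * q (fst z) + 2 * q (?y z)) \<partial>?M)"
  proof -
    have i1: "integrable ?M (\<lambda>z. q (fst z))" by (rule pair.integrable_fst_component(1)[OF qint])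
    have m: "(\<lambda>z :: (real ^ 'n) \<times> (real ^ 'n). q (fst z)) \<in> borel_measurable borel" unfolding borel_prod[symmetric] by measurable
    have i2: "integrable ?M (\<lambda>z. q (?y z))"
      using i1 reversible_integral(2)[OF reversible_Gibbs m] by (simp add: flip_def case_prod_beta)
    show ?thesis
    proof (rule Bochner_Integration.integral_mono)
      show "integrable ?M (\<lambda>z. (k (fst z) - k (?y z))\<^sup>2)"
      proof (rule integrable_pair_bounded)
        show "(\<lambda>z. (k (fst z) - k (?y z))\<^sup>2) \<in> borel_measurable borel"
          unfolding borel_prod[symmetric] by measurable
        show "\<bar>(k (fst z) - k (?y z))\<^sup>2\<bar> \<le> (2 * B)\<^sup>2" for z
          using le by simp
      qed
      show "integrable ?M (\<lambda>z. L\<^sup>2 * (2 * q (fst z) + 2 * q (?y z)))" using i1 i2 by simp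
      fix z :: "(real ^ 'n) \<times> (real ^ 'n)"
      obtain x \<xi> where z: "z = (x, \<xi>)" by (cases z)
      let ?c = "\<lambda>i. ?\<beta> i * (e i \<bullet> \<xi>) - ?u i * w i x"
      let ?s = "\<Sum>i\<in>I. a i * (?c i)\<^sup>2"
      have s: "?s = (step ?u ?\<beta> x \<xi> - x) \<bullet> (Q *v (step ?u ?\<beta> x \<xi> - x))"
        by (simp add: step_def Q_comb)
      have sle: "?s \<le> 2 * q (step ?u ?\<beta> x \<xi>) + 2 * q x"
        using gauss_energy_diff[OF Q, of "step ?u ?\<beta> x \<xi> - \<mu>" "x - \<mu>"] unfolding s q_def by simp
      have "\<bar>k (step ?u ?\<beta> x \<xi>) - k x\<bar> \<le> L * sqrt ?s"
        using k unfolding fibre_lip_def step_def by blast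
      then have "\<bar>k (step ?u ?\<beta> x \<xi>) - k x\<bar>\<^sup>2 \<le> (L * sqrt ?s)\<^sup>2" by (intro power_mono) auto
      moreover have "0 \<le> ?s" using a_nonneg by (simp add: sum_nonneg)
      ultimately have "(k x - k (step ?u ?\<beta> x \<xi>))\<^sup>2 \<le> L\<^sup>2 * ?s"
        by (simp add: power_mult_distrib power2_commute)
      also have "L\<^sup>2 * ?s \<le> L\<^sup>2 * (2 * q (step ?u ?\<beta> x \<xi>) + 2 * q x)" by (rule mult_left_mono[OF sle]) simp
      finally show "(k (fst z) - k (?y z))\<^sup>2 \<le> L\<^sup>2 * (2 * q (fst z) + 2 * q (?y z))"
        unfolding z fst_conv snd_conv by (simp only: add.commute)
    qed
  qed
  also have "\<dots> = L\<^sup>2 * (4 * energy)"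
  proof -
    have i1: "integrable ?M (\<lambda>z. q (fst z))" by (rule pair.integrable_fst_component(1)[OF qint])
    have m: "(\<lambda>z :: (real ^ 'n) \<times> (real ^ 'n). q (fst z)) \<in> borel_measurable borel" unfolding borel_prod[symmetric] by measurable
    have i2: "integrable ?M (\<lambda>z. q (?y z))"
      using i1 reversible_integral(2)[OF reversible_Gibbs m] by (simp add: flip_def case_prod_beta)
    have e1: "(\<integral>z. q (fst z) \<partial>?M) = energy"
      using pair.integrable_fst_component(2)[OF qint] by (simp add: energy_def q_def)
    have e2: "(\<integral>z. q (?y z) \<partial>?M) = energy"
      using e1 reversible_integral(1)[OF reversible_Gibbs m] by (simp add: flip_def case_prod_beta)
    show ?thesis using i1 i2 e1 e2 by simp
  qed
  finally show ?thesis .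
qed

abbreviation OU where "OU h \<equiv> op (\<lambda>_. h) (\<lambda>i. sqrt (2 * h - a i * h\<^sup>2))"

lemma reversible_OU:
  assumes h: "0 < h" and ha: "\<And>i. i \<in> I \<Longrightarrow> h * a i \<le> 1"
  shows "reversible (\<lambda>_. h) (\<lambda>i. sqrt (2 * h - a i * h\<^sup>2))"
  unfolding reversible_def
proof (intro ballI)
  fix i assume "i \<in> I"
  then have "h * (h * a i) < 2 * h" using ha[of i] h mult_left_mono[of "h * a i" 1 h] by simp
  then have "0 < 2 * h - a i * h\<^sup>2" by (simp add: power2_eq_square mult_ac)
  then show "sqrt (2 * h - a i * h\<^sup>2) \<noteq> 0 \<and> (sqrt (2 * h - a i * h\<^sup>2))\<^sup>2 = 2 * h - a i * h\<^sup>2" by simp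
qed

lemma lipschitz_imp_energy_lipschitz:
  assumes "bounded_lipschitz g"
  obtains L where "0 \<le> L" "\<And>x v. \<bar>g (x + v) - g x\<bar> \<le> L * sqrt (v \<bullet> (Q *v v))"
proof -
  obtain L where L: "0 \<le> L" "\<And>x y. \<bar>g x - g y\<bar> \<le> L * dist x y" using assms by (auto simp: bounded_lipschitz_def)
  obtain l where l: "0 < l" "\<And>v. l * (v \<bullet> v) \<le> v \<bullet> (Q *v v)" using sym_pos_def_coercive[OF Q] by blast
  have "\<bar>g (x + v) - g x\<bar> \<le> (L / sqrt l) * sqrt (v \<bullet> (Q *v v))" for x v
  proof -
    have "sqrt l * norm v \<le> sqrt (v \<bullet> (Q *v v))"
      using real_sqrt_le_mono[OF l(2)[of v]] by (simp add: real_sqrt_mult norm_eq_sqrt_inner)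
    then have "norm v \<le> sqrt (v \<bullet> (Q *v v)) / sqrt l" using l(1) by (simp add: field_simps)
    then have "L * norm v \<le> L * (sqrt (v \<bullet> (Q *v v)) / sqrt l)" using L(1) by (rule mult_left_mono)
    moreover have "\<bar>g (x + v) - g x\<bar> \<le> L * norm v" using L(2)[of "x + v" x] by (simp add: dist_norm)
    ultimately show ?thesis by simp
  qed
  moreover have "0 \<le> L / sqrt l" using L l by simp
  ultimately show ?thesis using that by blast
qed

lemma Gibbs_orthogonal:
  assumes f: "bounded_borel f" and g: "bounded_borel g"
  shows "Pi.ip (\<lambda>x. f x - Gibbs f x) (Gibbs g) = 0"
  using op_selfadjoint[OF reversible_Gibbs f bounded_borel_op[OF g]]
  by (simp add: Pi.ip_diff_left f g bounded_borel_op op_Gibbs)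

text \<open>
  In direction \<open>e i\<close> the coupled difference shrinks by \<open>1 - h a i \<le> 1 - \<tau>\<close>; it is nonnegative because
  \<open>h a i \<le> 1\<close>.
\<close>
lemma OU_contraction:
  assumes h: "0 < h" and ha: "\<And>i. i \<in> I \<Longrightarrow> h * a i \<le> 1" and \<tau>: "\<And>i. i \<in> I \<Longrightarrow> \<tau> \<le> h * a i" "\<tau> \<le> 1"
    and f: "bounded_borel f"
  shows "Pi.nm (OU h (\<lambda>x. f x - Gibbs f x)) \<le> (1 - \<tau>) * Pi.nm (\<lambda>x. f x - Gibbs f x)"
proof (rule Pi.contraction_from_lipschitz_rate[OF _ _ _ _ _ _ _ _ _ f])
  note rev = reversible_OU[OF h ha]
  let ?\<beta> = "\<lambda>i. sqrt (2 * h - a i * h\<^sup>2)"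
  show "0 \<le> 1 - \<tau>" using \<tau>(2) by simp
  fix g :: "real ^ 'n \<Rightarrow> real" assume g: "bounded_lipschitz g"
  have bg: "bounded_borel g" by (rule bounded_lipschitz_borel[OF g])
  obtain L where L: "0 \<le> L" "\<And>x v. \<bar>g (x + v) - g x\<bar> \<le> L * sqrt (v \<bullet> (Q *v v))"
    using lipschitz_imp_energy_lipschitz[OF g] by blast
  define k where "k n = ((OU h) ^^ n) (\<lambda>x. g x - Gibbs g x)" for n
  have bk: "bounded_borel (k n)" for n
    by (induction n) (auto simp: k_def intro: bounded_borel_op bounded_borel_diff bg)
  have lip: "fibre_lip (L * (1 - \<tau>) ^ n) (k n)" for n
  proof (induction n)
    case 0
    show ?case using L(2) by (simp add: k_def fibre_lip_def Gibbs_fibre Q_comb[symmetric])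
  next
    case (Suc n)
    have "fibre_lip (L * (1 - \<tau>) ^ n * (1 - \<tau>)) (OU h (k n))"
    proof (rule fibre_lip_op[OF Suc bk])
      show "\<bar>1 - a i * h\<bar> \<le> 1 - \<tau>" if "i \<in> I" for i
        using ha[OF that] \<tau>(1)[OF that] by (simp add: mult.commute)
    qed (use L(1) \<tau>(2) in auto)
    then show ?case by (simp add: k_def mult_ac)
  qed
  have orth: "Pi.ip (k n) (Gibbs l) = 0" if l: "bounded_borel l" for n l
  proof (induction n)
    case 0 show ?case using Gibbs_orthogonal[OF bg l] by (simp add: k_def)
  next
    case (Suc n)
    have "Pi.ip (k (Suc n)) (Gibbs l) = Pi.ip (k n) (OU h (Gibbs l))"
      using op_selfadjoint[OF rev bk[of n] bounded_borel_op[OF l]] by (simp add: k_def)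
    then show ?case using Suc by (simp add: op_Gibbs)
  qed
  have "Pi.ip (k n) (k n) \<le> (L\<^sup>2 * (4 * energy)) * ((1 - \<tau>)\<^sup>2) ^ n" for n
  proof -
    have "Pi.ip (k n) (k n) \<le> (L * (1 - \<tau>) ^ n)\<^sup>2 * (4 * energy)"
      using \<tau>(2) L(1) by (intro fibre_lip_bound lip bk orth) auto
    then show ?thesis by (simp add: power_mult_distrib power_mult[symmetric] mult_ac)
  qed
  then show "\<exists>C. \<forall>n. Pi.ip (((OU h) ^^ n) (\<lambda>x. g x - Gibbs g x)) (((OU h) ^^ n) (\<lambda>x. g x - Gibbs g x)) \<le> C * ((1 - \<tau>)\<^sup>2) ^ n"
    unfolding k_def by blast
qed (use reversible_OU[OF h ha] reversible_Gibbs in \<open>auto intro: bounded_borel_op op_nm op_selfadjoint simp: op_diff\<close>)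

end

section \<open>Dilated Gaussian measures\<close>

lemma nn_integral_lborel_cart_scale:
  fixes G :: "real ^ 'n \<Rightarrow> ennreal"
  assumes [measurable]: "G \<in> borel_measurable borel" and \<sigma>: "\<And>i. 0 < \<sigma> i"
  shows "(\<integral>\<^sup>+\<eta>. G \<eta> \<partial>lborel) = (\<integral>\<^sup>+\<eta>. ennreal (\<Prod>i\<in>UNIV. \<sigma> i) * G (\<chi> i. \<sigma> i * \<eta> $ i) \<partial>lborel)"
proof -
  define c where "c b = \<sigma> (THE i. b = axis i (1::real))" for b :: "real ^ 'n"
  have c: "c (axis i 1) = \<sigma> i" for i by (simp add: c_def axis_eq_axis)
  have B: "(Basis :: (real ^ 'n) set) = range (\<lambda>i. axis i 1)" by (auto simp: Basis_vec_def)
  have inj: "inj (\<lambda>i::'n. axis i (1::real))" by (simp add: inj_on_def axis_eq_axis)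
  define T where "T x = (0 :: real ^ 'n) + (\<Sum>j\<in>Basis. (c j * (x \<bullet> j)) *\<^sub>R j)" for x
  have T: "T x = (\<chi> i. \<sigma> i * x $ i)" for x
  proof -
    have "T x = (\<Sum>i\<in>UNIV. (\<sigma> i * x $ i) *\<^sub>R axis i 1)"
      unfolding T_def B sum.reindex[OF inj] by (simp add: c inner_axis)
    then show ?thesis
      by (simp add: vec_eq_iff axis_def if_distrib[of "\<lambda>x. _ * x"] cong: if_cong)
  qed
  have [measurable]: "T \<in> borel_measurable borel" unfolding T_def by measurable
  have "lborel = density (distr lborel borel T) (\<lambda>_. (\<Prod>j\<in>Basis. \<bar>c j\<bar>))"
    unfolding T_def by (rule lborel_affine_euclidean) (use \<sigma> in \<open>auto simp: B c less_imp_neq[symmetric]\<close>)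
  also have "(\<Prod>j\<in>Basis. \<bar>c j\<bar>) = (\<Prod>i\<in>UNIV. \<sigma> i)"
    using \<sigma> by (simp add: B prod.reindex[OF inj] c less_imp_le)
  finally have eq: "lborel = density (distr lborel borel T) (\<lambda>_. ennreal (\<Prod>i\<in>UNIV. \<sigma> i))" by simp
  have "(\<integral>\<^sup>+\<eta>. G \<eta> \<partial>lborel) = (\<integral>\<^sup>+\<eta>. G \<eta> \<partial>density (distr lborel borel T) (\<lambda>_. ennreal (\<Prod>i\<in>UNIV. \<sigma> i)))"
    by (simp only: eq[symmetric])
  also have "\<dots> = (\<integral>\<^sup>+\<eta>. ennreal (\<Prod>i\<in>UNIV. \<sigma> i) * G (T \<eta>) \<partial>lborel)"
    by (simp add: nn_integral_density nn_integral_distr)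
  finally show ?thesis by (simp add: T)
qed

definition dilate :: "('n::finite \<Rightarrow> real ^ 'n) \<Rightarrow> ('n \<Rightarrow> real) \<Rightarrow> real ^ 'n \<Rightarrow> real ^ 'n" where
  "dilate e \<sigma> \<xi> = (\<Sum>i\<in>UNIV. (\<sigma> i * (e i \<bullet> \<xi>)) *\<^sub>R e i)"

text \<open>
  The density of the centred normal law with standard deviation \<open>s\<close> with respect to the standard one.
\<close>
definition tilt :: "real \<Rightarrow> real \<Rightarrow> real" where
  "tilt s z = exp (- (1 / s\<^sup>2 - 1) * z\<^sup>2 / 2) / s"

lemma measurable_tilt [measurable]: "tilt s \<in> borel_measurable borel"
  unfolding tilt_def by measurable

lemma tilt_nonneg: "0 < s \<Longrightarrow> 0 \<le> tilt s z" by (simp add: tilt_def)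

lemma std_normal_density_tilt: "0 < s \<Longrightarrow> std_normal_density z * tilt s z = std_normal_density (z / s) / s"
  by (simp add: std_normal_density_def tilt_def power_divide exp_add[symmetric] field_simps)

text \<open>A product of one-dimensional changes of variables.\<close>
lemma distr_std_gauss_dilate:
  fixes e :: "'n::finite \<Rightarrow> real ^ 'n"
  assumes on: "orthonormal e" and \<sigma>: "\<And>i. 0 < \<sigma> i"
  shows "distr std_gauss borel (dilate e \<sigma>) = density std_gauss (\<lambda>\<xi>. ennreal (\<Prod>i\<in>UNIV. tilt (\<sigma> i) (e i \<bullet> \<xi>)))"
proof (rule measure_eqI)
  have [measurable]: "dilate e \<sigma> \<in> borel_measurable borel" unfolding dilate_def by measurable
  note [measurable] = measurable_rot[OF on]
  fix A assume "A \<in> sets (distr std_gauss borel (dilate e \<sigma>))"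
  then have [measurable]: "A \<in> sets borel" by simp
  have dr: "dilate e \<sigma> (rot e \<eta>) = rot e (\<chi> i. \<sigma> i * \<eta> $ i)" for \<eta>
    by (simp add: dilate_def inner_rot[OF on]) (simp add: rot_def[OF on])
  define g where "g \<eta> = ennreal (\<Prod>i\<in>UNIV. std_normal_density (\<eta> $ i / \<sigma> i) / \<sigma> i) * indicator A (rot e \<eta>)" for \<eta>
  have [measurable]: "g \<in> borel_measurable borel" unfolding g_def by measurable
  have std_rot: "gauss_density 0 (mat 1) (rot e \<eta>) = (\<Prod>i\<in>UNIV. std_normal_density (\<eta> $ i))" for \<eta>
    by (simp add: std_gauss_density_eq_prod[OF on] inner_rot[OF on])
  have "emeasure (distr std_gauss borel (dilate e \<sigma>)) A = (\<integral>\<^sup>+\<xi>. indicator A \<xi> \<partial>distr std_gauss borel (dilate e \<sigma>))"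
    by simp
  also have "\<dots> = (\<integral>\<^sup>+\<xi>. indicator A (dilate e \<sigma> \<xi>) \<partial>std_gauss)"
    by (rule nn_integral_distr) measurable
  also have "\<dots> = (\<integral>\<^sup>+\<xi>. ennreal (gauss_density 0 (mat 1) \<xi>) * indicator A (dilate e \<sigma> \<xi>) \<partial>lborel)"
    unfolding gauss_measure_def by (rule nn_integral_density) measurable
  also have "\<dots> = (\<integral>\<^sup>+\<eta>. ennreal (\<Prod>i\<in>UNIV. std_normal_density (\<eta> $ i)) * indicator A (rot e (\<chi> i. \<sigma> i * \<eta> $ i)) \<partial>lborel)"
    by (subst nn_integral_lborel_rot[OF on]) (simp_all add: std_rot dr)
  also have "\<dots> = (\<integral>\<^sup>+\<eta>. ennreal (\<Prod>i\<in>UNIV. \<sigma> i) * g (\<chi> i. \<sigma> i * \<eta> $ i) \<partial>lborel)"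
  proof (rule nn_integral_cong)
    fix \<eta> :: "real ^ 'n"
    have "(\<Prod>i\<in>UNIV. std_normal_density (\<eta> $ i)) = (\<Prod>i\<in>UNIV. \<sigma> i) * (\<Prod>i\<in>UNIV. std_normal_density (\<sigma> i * \<eta> $ i / \<sigma> i) / \<sigma> i)"
      unfolding prod.distrib[symmetric] using \<sigma> by (intro prod.cong) (auto simp: less_imp_neq[symmetric])
    then have "ennreal (\<Prod>i\<in>UNIV. std_normal_density (\<eta> $ i)) = ennreal (\<Prod>i\<in>UNIV. \<sigma> i) * ennreal (\<Prod>i\<in>UNIV. std_normal_density (\<sigma> i * \<eta> $ i / \<sigma> i) / \<sigma> i)"
      using \<sigma> by (simp only: ennreal_mult' prod_nonneg less_imp_le)
    then show "ennreal (\<Prod>i\<in>UNIV. std_normal_density (\<eta> $ i)) * indicator A (rot e (\<chi> i. \<sigma> i * \<eta> $ i))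
        = ennreal (\<Prod>i\<in>UNIV. \<sigma> i) * g (\<chi> i. \<sigma> i * \<eta> $ i)"
      by (simp add: g_def mult.assoc)
  qed
  also have "\<dots> = (\<integral>\<^sup>+\<eta>. g \<eta> \<partial>lborel)"
    by (rule nn_integral_lborel_cart_scale[symmetric]) (use \<sigma> in auto)
  also have "\<dots> = (\<integral>\<^sup>+\<eta>. ennreal (gauss_density 0 (mat 1) (rot e \<eta>)) *
      (ennreal (\<Prod>i\<in>UNIV. tilt (\<sigma> i) (e i \<bullet> rot e \<eta>)) * indicator A (rot e \<eta>)) \<partial>lborel)"
  proof (rule nn_integral_cong)
    fix \<eta> :: "real ^ 'n"
    have "(\<Prod>i\<in>UNIV. std_normal_density (\<eta> $ i / \<sigma> i) / \<sigma> i) = (\<Prod>i\<in>UNIV. std_normal_density (\<eta> $ i)) * (\<Prod>i\<in>UNIV. tilt (\<sigma> i) (\<eta> $ i))"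
      unfolding prod.distrib[symmetric] using \<sigma> by (simp add: std_normal_density_tilt)
    moreover have "0 \<le> (\<Prod>i\<in>UNIV. tilt (\<sigma> i) (\<eta> $ i))" "0 \<le> (\<Prod>i\<in>UNIV. std_normal_density (\<eta> $ i))"
      using \<sigma> by (auto intro!: prod_nonneg tilt_nonneg)
    ultimately show "g \<eta> = ennreal (gauss_density 0 (mat 1) (rot e \<eta>)) *
      (ennreal (\<Prod>i\<in>UNIV. tilt (\<sigma> i) (e i \<bullet> rot e \<eta>)) * indicator A (rot e \<eta>))"
      by (simp add: g_def std_rot inner_rot[OF on] ennreal_mult mult.assoc)
  qed
  also have "\<dots> = (\<integral>\<^sup>+\<xi>. ennreal (gauss_density 0 (mat 1) \<xi>) *
      (ennreal (\<Prod>i\<in>UNIV. tilt (\<sigma> i) (e i \<bullet> \<xi>)) * indicator A \<xi>) \<partial>lborel)"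
    by (subst (2) nn_integral_lborel_rot[OF on]) simp_all
  also have "\<dots> = (\<integral>\<^sup>+\<xi>. ennreal (\<Prod>i\<in>UNIV. tilt (\<sigma> i) (e i \<bullet> \<xi>)) * indicator A \<xi> \<partial>std_gauss)"
    unfolding gauss_measure_def by (rule nn_integral_density[symmetric]) measurable
  also have "\<dots> = emeasure (density std_gauss (\<lambda>\<xi>. ennreal (\<Prod>i\<in>UNIV. tilt (\<sigma> i) (e i \<bullet> \<xi>)))) A"
    by (rule emeasure_density[symmetric]) measurable
  finally show "emeasure (distr std_gauss borel (dilate e \<sigma>)) A = emeasure (density std_gauss (\<lambda>\<xi>. ennreal (\<Prod>i\<in>UNIV. tilt (\<sigma> i) (e i \<bullet> \<xi>)))) A" .
qed simp

text \<open>
  The one-dimensional factors of \<open>E[\<omega>\<^sup>2]\<close> and \<open>E[\<omega>\<^sup>2/\<alpha>]\<close>. Completing the square in the first integral leaves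
  the exponent \<open>K + c\<^sup>2/(2B)\<close>, a multiple of \<open>W\<^sup>2\<close> for the state \<open>W\<close>; it is never positive, so the
  bound is uniform in \<open>W\<close>. The remaining factor \<open>1/(v \<surd>B)\<close> is \<open>1 + O(t\<^sup>2)\<close>: with \<open>v = 1 - t/2\<close> the terms
  of first order cancel. Summability of \<open>t\<^sup>2\<close> over the block is what the trace condition provides.
\<close>
lemma tilt_square_integral:
  fixes h a W t s :: real
  assumes h: "0 < h" and t: "t = h * a" "0 < t" "t \<le> 1 / 2" and s: "s = sqrt (1 - t / 2)"
  shows "(\<integral>\<^sup>+z. ennreal (std_normal_density z) *
       ennreal ((tilt s z)\<^sup>2 * exp (h / 4 * (((1 - t) * W + a * sqrt (2 * h) * z)\<^sup>2 - W\<^sup>2))) \<partial>lborel)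
       \<le> ennreal (1 / (1 - 5 / 4 * t\<^sup>2))" (is "?I1 \<le> _")
    and "(\<integral>\<^sup>+z. ennreal (std_normal_density z) * ennreal ((tilt s z)\<^sup>2) \<partial>lborel) \<le> ennreal (1 / (1 - 5 / 4 * t\<^sup>2))" (is "?I2 \<le> _")
proof -
  define v where "v = 1 - t / 2"
  have v: "0 < v" "v \<le> 1" "s\<^sup>2 = v" "s > 0" using t by (auto simp: v_def s)
  have t2: "t\<^sup>2 \<le> (1 / 2)\<^sup>2" using t by (intro power_mono) auto
  then have t2': "t\<^sup>2 \<le> 1 / 4" by (simp add: power2_eq_square)
  have tilt2: "(tilt s z)\<^sup>2 = exp (- (1 / v - 1) * z\<^sup>2) / v" for z
    using v by (simp add: tilt_def power_divide exp_double[symmetric] power2_eq_square[of "exp _"] exp_add[symmetric])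
  have B0: "1 \<le> 1 / v" using v by simp
  have bound: "1 / (v * sqrt B) \<le> 1 / (1 - 5 / 4 * t\<^sup>2)" if B: "0 < B" "1 - 5 / 4 * t\<^sup>2 \<le> v\<^sup>2 * B" for B
  proof -
    define y where "y = 1 - 5 / 4 * t\<^sup>2"
    have y: "0 < y" "y \<le> 1" using t2' by (auto simp: y_def)
    have "y * y \<le> y * 1" using y by (intro mult_left_mono) auto
    then have "y\<^sup>2 \<le> v\<^sup>2 * B" using B(2)[folded y_def] unfolding power2_eq_square[of y] by linarith
    then have "y \<le> sqrt (v\<^sup>2 * B)" by (rule real_le_rsqrt)
    also have "\<dots> = v * sqrt B" using v by (simp add: real_sqrt_mult)
    finally show ?thesis using y unfolding y_def[symmetric] by (intro divide_left_mono) (auto intro: mult_pos_pos)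
  qed
  \<comment> \<open>the exponent of the first integrand is \<open>K + c z - (B - 1) / 2 z\<^sup>2\<close>\<close>
  define B where "B = 2 / v - 1 - t\<^sup>2"
  define c where "c = h / 2 * (1 - t) * a * sqrt (2 * h) * W"
  define K where "K = - (h / 4) * W\<^sup>2 * (2 * t - t\<^sup>2)"
  have B1: "1 - t\<^sup>2 \<le> B" using B0 by (simp add: B_def)
  have B: "0 < B" using B1 t2' by linarith
  have a2: "a * sqrt (2 * h) * (a * sqrt (2 * h)) = 2 * t\<^sup>2 / h" using h t(1) by (simp add: power2_eq_square field_simps)
  have expo: "- (1 / v - 1) * z\<^sup>2 + h / 4 * (((1 - t) * W + a * sqrt (2 * h) * z)\<^sup>2 - W\<^sup>2)
     = K + (c * z - (B - 1) / 2 * z\<^sup>2)" for z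
  proof -
    have "((1 - t) * W + a * sqrt (2 * h) * z)\<^sup>2 = ((1 - t) * W)\<^sup>2 + 2 * (1 - t) * W * (a * sqrt (2 * h)) * z + (a * sqrt (2 * h) * (a * sqrt (2 * h))) * z\<^sup>2"
      by (simp add: power2_eq_square algebra_simps)
    also have "\<dots> = ((1 - t) * W)\<^sup>2 + 2 * (1 - t) * W * (a * sqrt (2 * h)) * z + 2 * t\<^sup>2 / h * z\<^sup>2" unfolding a2 by simp
    finally have E: "((1 - t) * W + a * sqrt (2 * h) * z)\<^sup>2 = ((1 - t) * W)\<^sup>2 + 2 * (1 - t) * W * (a * sqrt (2 * h)) * z + 2 * t\<^sup>2 / h * z\<^sup>2" .
    have lin: "h / 4 * (P + R + 2 * t\<^sup>2 / h * z\<^sup>2 - W\<^sup>2) = h / 4 * (P - W\<^sup>2) + h / 4 * R + t\<^sup>2 / 2 * z\<^sup>2" for P R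
      using h by (simp add: field_simps)
    have "h / 4 * (((1 - t) * W + a * sqrt (2 * h) * z)\<^sup>2 - W\<^sup>2)
       = h / 4 * (((1 - t) * W)\<^sup>2 - W\<^sup>2) + h / 4 * (2 * (1 - t) * W * (a * sqrt (2 * h)) * z) + t\<^sup>2 / 2 * z\<^sup>2"
      unfolding E by (rule lin)
    moreover have "h / 4 * (((1 - t) * W)\<^sup>2 - W\<^sup>2) = K" by (simp add: K_def power2_eq_square field_simps)
    moreover have "h / 4 * (2 * (1 - t) * W * (a * sqrt (2 * h)) * z) = c * z" by (simp add: c_def)
    moreover have "(B - 1) / 2 * z\<^sup>2 = (1 / v - 1) * z\<^sup>2 - t\<^sup>2 / 2 * z\<^sup>2" by (simp add: B_def add_divide_distrib diff_divide_distrib algebra_simps)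
    moreover have "- (1 / v - 1) * z\<^sup>2 = - ((1 / v - 1) * z\<^sup>2)" by (rule mult_minus_left)
    ultimately show ?thesis by linarith
  qed
  have neg: "K + c\<^sup>2 / (2 * B) \<le> 0"
  proof -
    \<comment> \<open>reduces to \<open>2 t (1 - t) \<ge> 0\<close> after replacing \<open>B\<close> by its lower bound \<open>1 - t\<^sup>2\<close>\<close>
    have "(1 - t\<^sup>2) * (2 * t - t\<^sup>2) - (1 - t)\<^sup>2 * t\<^sup>2 = 2 * t * (1 - t)"
      by (simp add: power2_eq_square algebra_simps)
    moreover have "0 \<le> 2 * t * (1 - t)" using t by simp
    moreover have "t * t \<le> t * 1" using t by (intro mult_left_mono) auto
    then have "(1 - t\<^sup>2) * (2 * t - t\<^sup>2) \<le> B * (2 * t - t\<^sup>2)"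
      using B1 t by (intro mult_right_mono) (auto simp: power2_eq_square)
    ultimately have le: "(1 - t)\<^sup>2 * t\<^sup>2 \<le> B * (2 * t - t\<^sup>2)" by linarith
    have "c\<^sup>2 = (h / 2 * (1 - t) * W)\<^sup>2 * (a * sqrt (2 * h) * (a * sqrt (2 * h)))"
      by (simp add: c_def power2_eq_square mult_ac)
    also have "\<dots> = h / 2 * W\<^sup>2 * ((1 - t)\<^sup>2 * t\<^sup>2)"
      unfolding a2 using h by (simp add: power2_eq_square field_simps)
    also have "\<dots> \<le> h / 2 * W\<^sup>2 * (B * (2 * t - t\<^sup>2))"
      using le h by (intro mult_left_mono) auto
    finally have "c\<^sup>2 \<le> - K * (2 * B)" by (simp add: K_def field_simps)
    then have "c\<^sup>2 / (2 * B) \<le> - K" using B by (simp add: pos_divide_le_eq)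
    then show ?thesis by simp
  qed
  have "?I1 = (\<integral>\<^sup>+z. ennreal (exp K / v) * ennreal (std_normal_density z * exp (c * z - (B - 1) / 2 * z\<^sup>2)) \<partial>lborel)"
  proof (rule nn_integral_cong)
    fix z
    have "(tilt s z)\<^sup>2 * exp (h / 4 * (((1 - t) * W + a * sqrt (2 * h) * z)\<^sup>2 - W\<^sup>2))
      = exp (- (1 / v - 1) * z\<^sup>2 + h / 4 * (((1 - t) * W + a * sqrt (2 * h) * z)\<^sup>2 - W\<^sup>2)) / v"
      unfolding tilt2 by (simp only: exp_add times_divide_eq_left)
    also have "\<dots> = exp K / v * exp (c * z - (B - 1) / 2 * z\<^sup>2)" unfolding expo by (simp add: exp_add)
    finally show "ennreal (std_normal_density z) * ennreal ((tilt s z)\<^sup>2 * exp (h / 4 * (((1 - t) * W + a * sqrt (2 * h) * z)\<^sup>2 - W\<^sup>2)))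
      = ennreal (exp K / v) * ennreal (std_normal_density z * exp (c * z - (B - 1) / 2 * z\<^sup>2))"
      using v by (simp add: ennreal_mult[symmetric] mult_ac)
  qed
  also have "\<dots> = ennreal (exp K / v) * ennreal (exp (c\<^sup>2 / (2 * B)) / sqrt B)"
    by (subst nn_integral_cmult) (simp_all only: nn_integral_std_normal_exp[OF B], measurable)
  also have "\<dots> = ennreal (exp (K + c\<^sup>2 / (2 * B)) * (1 / (v * sqrt B)))"
    using v B by (simp add: ennreal_mult[symmetric] exp_add)
  also have "\<dots> \<le> ennreal (1 * (1 / (v * sqrt B)))"
    using neg v B by (intro ennreal_leI mult_right_mono) auto
  also have "\<dots> \<le> ennreal (1 / (1 - 5 / 4 * t\<^sup>2))"
  proof -
    have "v\<^sup>2 * B = 2 * v - v\<^sup>2 * (1 + t\<^sup>2)" using v by (simp add: B_def power2_eq_square field_simps)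
    also have "\<dots> = 1 - 5 / 4 * t\<^sup>2 + t * t\<^sup>2 * (1 - t / 4)" by (simp add: v_def power2_eq_square field_simps)
    also have "\<dots> \<ge> 1 - 5 / 4 * t\<^sup>2" using t by simp
    finally show ?thesis using bound[OF B] by (simp add: ennreal_leI)
  qed
  finally show "?I1 \<le> ennreal (1 / (1 - 5 / 4 * t\<^sup>2))" .
  define B' where "B' = 2 / v - 1"
  have B': "0 < B'" using B0 by (simp add: B'_def)
  have "?I2 = (\<integral>\<^sup>+z. ennreal (1 / v) * ennreal (std_normal_density z * exp (0 * z - (B' - 1) / 2 * z\<^sup>2)) \<partial>lborel)"
  proof (rule nn_integral_cong)
    fix z
    have "- (1 / v - 1) * z\<^sup>2 = 0 * z - (B' - 1) / 2 * z\<^sup>2" by (simp add: B'_def add_divide_distrib diff_divide_distrib algebra_simps)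
    then have "(tilt s z)\<^sup>2 = 1 / v * exp (0 * z - (B' - 1) / 2 * z\<^sup>2)" unfolding tilt2 by simp
    then show "ennreal (std_normal_density z) * ennreal ((tilt s z)\<^sup>2)
      = ennreal (1 / v) * ennreal (std_normal_density z * exp (0 * z - (B' - 1) / 2 * z\<^sup>2))"
      using v by (simp add: ennreal_mult[symmetric] mult_ac)
  qed
  also have "\<dots> = ennreal (1 / v) * ennreal (exp (0\<^sup>2 / (2 * B')) / sqrt B')"
    by (subst nn_integral_cmult) (simp_all only: nn_integral_std_normal_exp[OF B'], measurable)
  also have "\<dots> = ennreal (1 / (v * sqrt B'))" using v B' by (simp add: ennreal_mult[symmetric])
  also have "\<dots> \<le> ennreal (1 / (1 - 5 / 4 * t\<^sup>2))"
  proof -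
    have "v\<^sup>2 * B' = 2 * v - v\<^sup>2" using v by (simp add: B'_def power2_eq_square field_simps)
    also have "\<dots> = 1 - 5 / 4 * t\<^sup>2 + t\<^sup>2" by (simp add: v_def power2_eq_square field_simps)
    also have "\<dots> \<ge> 1 - 5 / 4 * t\<^sup>2" by simp
    finally show ?thesis using bound[OF B'] by (simp add: ennreal_leI)
  qed
  finally show "?I2 \<le> ennreal (1 / (1 - 5 / 4 * t\<^sup>2))" .
qed

section \<open>Comparing block MALA with the Ornstein--Uhlenbeck update\<close>

lemma prod_mono_ennreal:
  fixes f g :: "'a \<Rightarrow> ennreal"
  shows "(\<And>i. i \<in> A \<Longrightarrow> f i \<le> g i) \<Longrightarrow> prod f A \<le> prod g A"
  by (induction A rule: infinite_finite_induct) (auto intro!: mult_mono)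

text \<open>
  The step size conditions in terms of the eigenvalues of the block, with \<open>\<tau>\<close> a lower bound of
  \<open>h a i\<close>.
\<close>
locale eigenblock_step = eigenblock \<mu> Q e a for \<mu> :: "real ^ 'n" and Q e a +
  fixes h \<tau> :: real
  assumes h_pos: "0 < h" and ha: "\<And>i. i \<in> I \<Longrightarrow> h * a i \<le> 1 / 2"
    and h_tr: "(\<Sum>i\<in>I. (h * a i)\<^sup>2) \<le> 1 / 10"
    and \<tau>: "0 < \<tau>" "\<tau> \<le> 1" "\<And>i. i \<in> I \<Longrightarrow> \<tau> \<le> h * a i"
begin

interpretation Pi: polish_prob "gauss_measure \<mu> Q"
  by (rule polish_prob_gauss[OF Q])
interpretation pair: pair_prob_space "gauss_measure \<mu> Q" "std_gauss :: (real ^ 'n) measure" ..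

definition propose where "propose x \<xi> = step (\<lambda>_. h) (\<lambda>_. sqrt (2 * h)) x \<xi>"
text \<open>
  The negative logarithm of the acceptance ratio, half the \<open>excess\<close> of the MALA proposal.
\<close>
definition nlratio where "nlratio x \<xi> = h / 4 * (\<Sum>i\<in>I. (w i (propose x \<xi>))\<^sup>2 - (w i x)\<^sup>2)"
definition acc where "acc x \<xi> = min 1 (exp (- nlratio x \<xi>))"
text \<open>
  The ratio of the standard deviations \<open>\<surd>(2h - a h\<^sup>2)\<close> of the Ornstein--Uhlenbeck update and \<open>\<surd>(2h)\<close> of
  the MALA proposal in direction \<open>e i\<close>.
\<close>
definition \<sigma> where "\<sigma> i = (if i \<in> I then sqrt (1 - h * a i / 2) else 1)"
definition weight where "weight \<xi> = (\<Prod>i\<in>UNIV. tilt (\<sigma> i) (e i \<bullet> \<xi>))"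

lemma measurable_propose [measurable (raw)]:
  assumes [measurable]: "f \<in> N \<rightarrow>\<^sub>M borel" "g \<in> N \<rightarrow>\<^sub>M borel"
  shows "(\<lambda>z. propose (f z) (g z)) \<in> N \<rightarrow>\<^sub>M borel"
  unfolding propose_def by measurable

lemma measurable_nlratio [measurable (raw)]:
  assumes [measurable]: "f \<in> N \<rightarrow>\<^sub>M borel" "g \<in> N \<rightarrow>\<^sub>M borel"
  shows "(\<lambda>z. nlratio (f z) (g z)) \<in> borel_measurable N"
  unfolding nlratio_def by measurable

lemma measurable_acc [measurable (raw)]:
  assumes [measurable]: "f \<in> N \<rightarrow>\<^sub>M borel" "g \<in> N \<rightarrow>\<^sub>M borel"
  shows "(\<lambda>z. acc (f z) (g z)) \<in> borel_measurable N"
  unfolding acc_def by measurable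

lemma measurable_weight [measurable]: "weight \<in> borel_measurable borel"
  unfolding weight_def by measurable

lemma \<sigma>_pos: "0 < \<sigma> i"
  using ha[of i] by (auto simp: \<sigma>_def)

lemma weight_nonneg: "0 \<le> weight \<xi>"
  unfolding weight_def by (intro prod_nonneg tilt_nonneg \<sigma>_pos)

lemma acc_pos: "0 < acc x \<xi>" and acc_le: "acc x \<xi> \<le> 1"
  by (auto simp: acc_def)

lemma inner_dilate: "e i \<bullet> dilate e \<sigma> \<xi> = \<sigma> i * (e i \<bullet> \<xi>)"
  by (simp add: dilate_def orthonormal_inner_sum[OF on])

text \<open>
  Both updates have the same mean, and their noises differ by a dilation in the eigenbasis; so the
  density of one with respect to the other depends on the noise only.
\<close>
lemma OU_eq_weighted:
  assumes f: "bounded_borel f"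
  shows "OU h f x = (\<integral>\<xi>. weight \<xi> * f (propose x \<xi>) \<partial>std_gauss)"
proof -
  note [measurable] = bounded_borel_measurable[OF f]
  have [measurable]: "dilate e \<sigma> \<in> borel_measurable borel" unfolding dilate_def by measurable
  have "step (\<lambda>_. h) (\<lambda>i. sqrt (2 * h - a i * h\<^sup>2)) x \<xi> = propose x (dilate e \<sigma> \<xi>)" for \<xi>
  proof -
    have "sqrt (2 * h - a i * h\<^sup>2) * (e i \<bullet> \<xi>) = sqrt (2 * h) * (e i \<bullet> dilate e \<sigma> \<xi>)" if "i \<in> I" for i
    proof -
      have "2 * h - a i * h\<^sup>2 = 2 * h * (1 - h * a i / 2)" by (simp add: power2_eq_square algebra_simps)
      then show ?thesis using that by (simp add: inner_dilate \<sigma>_def real_sqrt_mult)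
    qed
    then show ?thesis unfolding propose_def step_def by (intro arg_cong[where f = "\<lambda>z. x + z"] comb_cong) simp
  qed
  then have "OU h f x = (\<integral>\<xi>. f (propose x (dilate e \<sigma> \<xi>)) \<partial>std_gauss)" by (simp add: op_def)
  also have "\<dots> = (\<integral>\<xi>. f (propose x \<xi>) \<partial>distr std_gauss borel (dilate e \<sigma>))"
    by (rule integral_distr[symmetric]) measurable
  also have "\<dots> = (\<integral>\<xi>. f (propose x \<xi>) \<partial>density std_gauss (\<lambda>\<xi>. ennreal (weight \<xi>)))"
    unfolding weight_def by (subst distr_std_gauss_dilate[OF on \<sigma>_pos]) simp
  also have "\<dots> = (\<integral>\<xi>. weight \<xi> * f (propose x \<xi>) \<partial>std_gauss)"
    using weight_nonneg by (subst integral_density) auto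
  finally show ?thesis .
qed

text \<open>
  With \<open>y\<^sub>i = 5/4 (h a i)\<^sup>2\<close>, the trace condition gives \<open>\<Sum> y\<^sub>i \<le> 1/8\<close>, and then
  \<open>\<Prod> (1 - y\<^sub>i) \<ge> 1 - \<Sum> y\<^sub>i \<ge> 7/8\<close>.
\<close>
lemma prod_bound:
  assumes "\<And>i. \<phi> i \<in> borel_measurable borel" "\<And>i. i \<notin> I \<Longrightarrow> (\<integral>\<^sup>+z. ennreal (std_normal_density z) * \<phi> i z \<partial>lborel) \<le> 1"
    "\<And>i. i \<in> I \<Longrightarrow> (\<integral>\<^sup>+z. ennreal (std_normal_density z) * \<phi> i z \<partial>lborel) \<le> ennreal (1 / (1 - 5 / 4 * (h * a i)\<^sup>2))"
  shows "(\<integral>\<^sup>+\<xi>. (\<Prod>i\<in>UNIV. \<phi> i (e i \<bullet> \<xi>)) \<partial>std_gauss) \<le> ennreal (8 / 7)"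
proof -
  define y where "y i = 5 / 4 * (h * a i)\<^sup>2" for i
  have y: "0 \<le> y i" "y i \<le> 5 / 16" if "i \<in> I" for i
  proof -
    have "0 \<le> h * a i" using h_pos a_nonneg by simp
    then have "(h * a i)\<^sup>2 \<le> (1 / 2)\<^sup>2" using ha[OF that] by (intro power_mono) auto
    then show "0 \<le> y i" "y i \<le> 5 / 16" by (simp_all add: y_def power_divide)
  qed
  have y1: "0 < 1 - y i" if "i \<in> I" for i using y(2)[OF that] by simp
  have "(\<integral>\<^sup>+\<xi>. (\<Prod>i\<in>UNIV. \<phi> i (e i \<bullet> \<xi>)) \<partial>std_gauss) = (\<Prod>i\<in>UNIV. \<integral>\<^sup>+z. ennreal (std_normal_density z) * \<phi> i z \<partial>lborel)"
    by (rule nn_integral_std_gauss_prod[OF on]) fact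
  also have "\<dots> \<le> (\<Prod>i\<in>UNIV. if i \<in> I then ennreal (1 / (1 - y i)) else 1)"
    using assms(2,3) by (intro prod_mono_ennreal) (auto simp: y_def)
  also have "\<dots> = (\<Prod>i\<in>I. ennreal (1 / (1 - y i)))"
    by (simp add: prod.If_cases)
  also have "\<dots> = ennreal (\<Prod>i\<in>I. 1 / (1 - y i))" using y1 by (intro prod_ennreal) (simp add: less_imp_le)
  also have "\<dots> \<le> ennreal (8 / 7)"
  proof (rule ennreal_leI)
    have "1 - (\<Sum>i\<in>I. y i) \<le> (\<Prod>i\<in>I. 1 - y i)"
      using y1 y(1) by (intro Weierstrass_prod_ineq) (simp add: less_imp_le)
    moreover have "(\<Sum>i\<in>I. y i) \<le> 1 / 8" using h_tr unfolding y_def sum_distrib_left[symmetric] by simp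
    ultimately have "7 / 8 \<le> (\<Prod>i\<in>I. 1 - y i)" by simp
    then have "1 / (\<Prod>i\<in>I. 1 - y i) \<le> 1 / (7 / 8)" by (intro divide_left_mono) auto
    then show "(\<Prod>i\<in>I. 1 / (1 - y i)) \<le> 8 / 7" by (simp add: prod_dividef)
  qed
  finally show ?thesis .
qed

text \<open>
  Split \<open>1/acc \<le> 1 + exp nlratio\<close>. Both resulting integrals factorise over the eigenbasis, and each is
  at most \<open>8/7\<close>.
\<close>
lemma chi_square_bound: "(\<integral>\<^sup>+\<xi>. ennreal ((weight \<xi>)\<^sup>2 / acc x \<xi>) \<partial>std_gauss) \<le> 4"
proof -
  define \<psi> where "\<psi> i z = (if i \<in> I then exp (h / 4 * (((1 - h * a i) * w i x + a i * sqrt (2 * h) * z)\<^sup>2 - (w i x)\<^sup>2)) else 1)" for i z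
  have \<psi>0: "0 \<le> \<psi> i z" for i z by (simp add: \<psi>_def)
  have [measurable]: "\<psi> i \<in> borel_measurable borel" for i unfolding \<psi>_def by measurable
  have nlratio: "exp (nlratio x \<xi>) = (\<Prod>i\<in>UNIV. \<psi> i (e i \<bullet> \<xi>))" for \<xi>
  proof -
    have "nlratio x \<xi> = (\<Sum>i\<in>I. h / 4 * (((1 - h * a i) * w i x + a i * sqrt (2 * h) * (e i \<bullet> \<xi>))\<^sup>2 - (w i x)\<^sup>2))"
      unfolding nlratio_def sum_distrib_left propose_def by (intro sum.cong refl) (simp add: w_step mult.commute[of h])
    then have "exp (nlratio x \<xi>) = (\<Prod>i\<in>I. \<psi> i (e i \<bullet> \<xi>))" by (simp add: exp_sum \<psi>_def)
    also have "\<dots> = (\<Prod>i\<in>UNIV. \<psi> i (e i \<bullet> \<xi>))"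
      by (rule prod.mono_neutral_left) (auto simp: \<psi>_def)
    finally show ?thesis .
  qed
  have le: "(weight \<xi>)\<^sup>2 / acc x \<xi> \<le> (weight \<xi>)\<^sup>2 + (weight \<xi>)\<^sup>2 * exp (nlratio x \<xi>)" for \<xi>
  proof -
    \<comment> \<open>the reciprocal of \<open>min 1 r\<close> is \<open>max 1 (1/r)\<close>\<close>
    have "1 / acc x \<xi> \<le> 1 + exp (nlratio x \<xi>)"
      by (auto simp: acc_def min_def exp_minus field_simps)
    then have "(weight \<xi>)\<^sup>2 * (1 / acc x \<xi>) \<le> (weight \<xi>)\<^sup>2 * (1 + exp (nlratio x \<xi>))" by (rule mult_left_mono) simp
    then show ?thesis by (simp add: algebra_simps)
  qed
  have w2: "(weight \<xi>)\<^sup>2 = (\<Prod>i\<in>UNIV. (tilt (\<sigma> i) (e i \<bullet> \<xi>))\<^sup>2)" for \<xi>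
    by (simp add: weight_def prod_power_distrib)
  have one: "(\<integral>\<^sup>+z. ennreal (std_normal_density z) * ennreal ((tilt (\<sigma> i) z)\<^sup>2) \<partial>lborel) \<le> 1" if "i \<notin> I" for i
  proof -
    have "(\<integral>\<^sup>+z. ennreal (std_normal_density z) \<partial>lborel) = 1" by (simp add: nn_integral_eq_integral)
    then show ?thesis using that by (simp add: \<sigma>_def tilt_def)
  qed
  have a: "0 < h * a i" if "i \<in> I" for i using that h_pos by (simp add: I_def)
  have \<sigma>I: "\<sigma> i = sqrt (1 - (h * a i) / 2)" if "i \<in> I" for i using that by (simp add: \<sigma>_def)
  have "(\<integral>\<^sup>+\<xi>. ennreal ((weight \<xi>)\<^sup>2 / acc x \<xi>) \<partial>std_gauss)
     \<le> (\<integral>\<^sup>+\<xi>. (\<Prod>i\<in>UNIV. ennreal ((tilt (\<sigma> i) (e i \<bullet> \<xi>))\<^sup>2)) + (\<Prod>i\<in>UNIV. ennreal ((tilt (\<sigma> i) (e i \<bullet> \<xi>))\<^sup>2 * \<psi> i (e i \<bullet> \<xi>))) \<partial>std_gauss)"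
  proof (rule nn_integral_mono)
    fix \<xi>
    have "ennreal ((weight \<xi>)\<^sup>2 / acc x \<xi>) \<le> ennreal ((weight \<xi>)\<^sup>2 + (weight \<xi>)\<^sup>2 * exp (nlratio x \<xi>))"
      using le by (rule ennreal_leI)
    also have "\<dots> = ennreal ((weight \<xi>)\<^sup>2) + ennreal ((weight \<xi>)\<^sup>2 * exp (nlratio x \<xi>))" by (simp add: ennreal_plus)
    also have "(weight \<xi>)\<^sup>2 * exp (nlratio x \<xi>) = (\<Prod>i\<in>UNIV. (tilt (\<sigma> i) (e i \<bullet> \<xi>))\<^sup>2 * \<psi> i (e i \<bullet> \<xi>))"
      by (simp add: w2 nlratio prod.distrib)
    finally show "ennreal ((weight \<xi>)\<^sup>2 / acc x \<xi>) \<le> (\<Prod>i\<in>UNIV. ennreal ((tilt (\<sigma> i) (e i \<bullet> \<xi>))\<^sup>2)) + (\<Prod>i\<in>UNIV. ennreal ((tilt (\<sigma> i) (e i \<bullet> \<xi>))\<^sup>2 * \<psi> i (e i \<bullet> \<xi>)))"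
      using \<psi>0 by (simp add: w2 prod_ennreal)
  qed
  also have "\<dots> = (\<integral>\<^sup>+\<xi>. (\<Prod>i\<in>UNIV. ennreal ((tilt (\<sigma> i) (e i \<bullet> \<xi>))\<^sup>2)) \<partial>std_gauss)
     + (\<integral>\<^sup>+\<xi>. (\<Prod>i\<in>UNIV. ennreal ((tilt (\<sigma> i) (e i \<bullet> \<xi>))\<^sup>2 * \<psi> i (e i \<bullet> \<xi>))) \<partial>std_gauss)"
    by (rule nn_integral_add) measurable
  also have "\<dots> \<le> ennreal (8 / 7) + ennreal (8 / 7)"
  proof (rule add_mono)
    show "(\<integral>\<^sup>+\<xi>. (\<Prod>i\<in>UNIV. ennreal ((tilt (\<sigma> i) (e i \<bullet> \<xi>))\<^sup>2)) \<partial>std_gauss) \<le> ennreal (8 / 7)"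
    proof (rule prod_bound[where \<phi> = "\<lambda>i z. ennreal ((tilt (\<sigma> i) z)\<^sup>2)"])
      show "(\<integral>\<^sup>+z. ennreal (std_normal_density z) * ennreal ((tilt (\<sigma> i) z)\<^sup>2) \<partial>lborel) \<le> ennreal (1 / (1 - 5 / 4 * (h * a i)\<^sup>2))"
        if "i \<in> I" for i
        by (rule tilt_square_integral(2)[OF h_pos refl a[OF that] ha[OF that] \<sigma>I[OF that]])
    qed (use one in auto)
    show "(\<integral>\<^sup>+\<xi>. (\<Prod>i\<in>UNIV. ennreal ((tilt (\<sigma> i) (e i \<bullet> \<xi>))\<^sup>2 * \<psi> i (e i \<bullet> \<xi>))) \<partial>std_gauss) \<le> ennreal (8 / 7)"
    proof (rule prod_bound[where \<phi> = "\<lambda>i z. ennreal ((tilt (\<sigma> i) z)\<^sup>2 * \<psi> i z)"])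
      show "(\<integral>\<^sup>+z. ennreal (std_normal_density z) * ennreal ((tilt (\<sigma> i) z)\<^sup>2 * \<psi> i z) \<partial>lborel) \<le> ennreal (1 / (1 - 5 / 4 * (h * a i)\<^sup>2))"
        if "i \<in> I" for i
        using tilt_square_integral(1)[OF h_pos refl a[OF that] ha[OF that] \<sigma>I[OF that], of "w i x"] that
        by (simp add: \<psi>_def)
    qed (use one in \<open>auto simp: \<psi>_def\<close>)
  qed
  also have "\<dots> = ennreal (8 / 7 + 8 / 7)" by (rule ennreal_plus[symmetric]) auto
  also have "\<dots> \<le> ennreal 4" by (rule ennreal_leI) simp
  finally show ?thesis by simp
qed

text \<open>
  Cauchy--Schwarz for \<open>weight / \<surd>acc\<close> and \<open>\<surd>acc (f - c)\<close>. The constant \<open>c\<close> is free because \<open>weight\<close>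
  integrates to 1.
\<close>
lemma overlap:
  assumes f: "bounded_borel f"
  shows "(OU h f x - c)\<^sup>2 \<le> 4 * (\<integral>\<xi>. acc x \<xi> * (f (propose x \<xi>) - c)\<^sup>2 \<partial>std_gauss)"
proof -
  note [measurable] = bounded_borel_measurable[OF f]
  define p where "p \<xi> = weight \<xi> / sqrt (acc x \<xi>)" for \<xi>
  define q where "q \<xi> = sqrt (acc x \<xi>) * (f (propose x \<xi>) - c)" for \<xi>
  have [measurable]: "p \<in> borel_measurable borel" "q \<in> borel_measurable borel"
    unfolding p_def q_def by measurable
  obtain B where B: "\<And>x. \<bar>f x - c\<bar> \<le> B"
    using bounded_borel_diff[OF f bounded_borel_const[of c]] unfolding bounded_borel_def by blast
  have sq: "(sqrt (acc x \<xi>))\<^sup>2 = acc x \<xi>" for \<xi> using acc_pos[of x \<xi>] by simp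
  have p2: "(p \<xi>)\<^sup>2 = (weight \<xi>)\<^sup>2 / acc x \<xi>" for \<xi> by (simp add: p_def power_divide sq)
  have q2: "(q \<xi>)\<^sup>2 = acc x \<xi> * (f (propose x \<xi>) - c)\<^sup>2" for \<xi> by (simp add: q_def power_mult_distrib sq)
  have pq: "p \<xi> * q \<xi> = weight \<xi> * (f (propose x \<xi>) - c)" for \<xi> using acc_pos[of x \<xi>] by (simp add: p_def q_def)
  have fin: "(\<integral>\<^sup>+\<xi>. ennreal ((p \<xi>)\<^sup>2) \<partial>std_gauss) \<le> 4" using chi_square_bound by (simp add: p2)
  have ip: "integrable std_gauss (\<lambda>\<xi>. (p \<xi>)\<^sup>2)"
    using fin by (intro integrableI_nonneg) (auto intro: le_less_trans)
  have "ennreal (\<integral>\<xi>. (p \<xi>)\<^sup>2 \<partial>std_gauss) \<le> ennreal 4"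
    using fin nn_integral_eq_integral[OF ip] by simp
  then have ip4: "(\<integral>\<xi>. (p \<xi>)\<^sup>2 \<partial>std_gauss) \<le> 4" by (subst (asm) ennreal_le_iff) auto
  have qB: "(q \<xi>)\<^sup>2 \<le> B\<^sup>2" for \<xi>
  proof -
    have "acc x \<xi> * (f (propose x \<xi>) - c)\<^sup>2 \<le> 1 * B\<^sup>2"
    proof (rule mult_mono)
      have "\<bar>f (propose x \<xi>) - c\<bar> \<le> \<bar>B\<bar>" using B[of "propose x \<xi>"] by linarith
      then show "(f (propose x \<xi>) - c)\<^sup>2 \<le> B\<^sup>2" by (simp only: abs_le_square_iff)
    qed (use acc_le in auto)
    then show ?thesis by (simp add: q2)
  qed
  have iq: "integrable std_gauss (\<lambda>\<xi>. (q \<xi>)\<^sup>2)"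
    by (rule std.integrable_const_bound[where B = "B\<^sup>2"]) (auto simp: qB)
  have ipq: "integrable std_gauss (\<lambda>\<xi>. p \<xi> * q \<xi>)"
  proof (rule Bochner_Integration.integrable_bound)
    show "integrable std_gauss (\<lambda>\<xi>. (p \<xi>)\<^sup>2 + (q \<xi>)\<^sup>2)" using ip iq by simp
    have "\<bar>p \<xi> * q \<xi>\<bar> \<le> (p \<xi>)\<^sup>2 + (q \<xi>)\<^sup>2" for \<xi>
    proof -
      have "2 * \<bar>p \<xi> * q \<xi>\<bar> \<le> (p \<xi>)\<^sup>2 + (q \<xi>)\<^sup>2"
        using sum_squares_bound[of "\<bar>p \<xi>\<bar>" "\<bar>q \<xi>\<bar>"] by (simp add: abs_mult mult.assoc)
      then show ?thesis using abs_ge_zero[of "p \<xi> * q \<xi>"] by linarith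
    qed
    then show "AE \<xi> in std_gauss. norm (p \<xi> * q \<xi>) \<le> norm ((p \<xi>)\<^sup>2 + (q \<xi>)\<^sup>2)" by simp
  qed measurable
  have "OU h (\<lambda>y. f y - c) x = OU h f x - c"
    by (simp add: op_def integrable_std_step f)
  then have eq: "OU h f x - c = (\<integral>\<xi>. p \<xi> * q \<xi> \<partial>std_gauss)"
    using OU_eq_weighted[OF bounded_borel_diff[OF f bounded_borel_const[of c]], of x] by (simp add: pq)
  have "(OU h f x - c)\<^sup>2 \<le> (\<integral>\<xi>. (p \<xi>)\<^sup>2 \<partial>std_gauss) * (\<integral>\<xi>. (q \<xi>)\<^sup>2 \<partial>std_gauss)"
    unfolding eq by (rule integral_cauchy_schwarz[OF ip iq ipq])
  also have "\<dots> \<le> 4 * (\<integral>\<xi>. (q \<xi>)\<^sup>2 \<partial>std_gauss)"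
    using ip4 by (rule mult_right_mono) simp
  finally show ?thesis by (simp add: q2)
qed

text \<open>The MALA operator, with the proposal written as a function of the noise.\<close>
definition K where
  "K f x = (\<integral>\<xi>. acc x \<xi> * f (propose x \<xi>) + (1 - acc x \<xi>) * f x \<partial>std_gauss)"

lemma bounded_K_integrand:
  assumes "\<And>x. \<bar>f x\<bar> \<le> B" shows "\<bar>acc x \<xi> * f (propose x \<xi>) + (1 - acc x \<xi>) * f x\<bar> \<le> B"
proof -
  have "\<bar>acc x \<xi> * f (propose x \<xi>) + (1 - acc x \<xi>) * f x\<bar> \<le> acc x \<xi> * \<bar>f (propose x \<xi>)\<bar> + (1 - acc x \<xi>) * \<bar>f x\<bar>"
    using abs_triangle_ineq[of "acc x \<xi> * f (propose x \<xi>)" "(1 - acc x \<xi>) * f x"] acc_pos[of x \<xi>] acc_le[of x \<xi>]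
    by (simp add: abs_mult)
  also have "\<dots> \<le> acc x \<xi> * B + (1 - acc x \<xi>) * B"
    using assms acc_pos[of x \<xi>] acc_le[of x \<xi>] by (intro add_mono mult_left_mono) auto
  finally show ?thesis by (simp add: algebra_simps)
qed

lemma integrable_K_integrand:
  assumes f: "bounded_borel f"
  shows "integrable std_gauss (\<lambda>\<xi>. acc x \<xi> * f (propose x \<xi>) + (1 - acc x \<xi>) * f x)"
proof -
  note [measurable] = bounded_borel_measurable[OF f]
  obtain B where B: "\<And>x. \<bar>f x\<bar> \<le> B" using f unfolding bounded_borel_def by blast
  show ?thesis by (rule std.integrable_const_bound[where B = B]) (auto simp: bounded_K_integrand[of f B, OF B])
qed

lemma bounded_borel_K: assumes f: "bounded_borel f" shows "bounded_borel (K f)"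
proof -
  note [measurable] = bounded_borel_measurable[OF f]
  obtain B where B: "\<And>x. \<bar>f x\<bar> \<le> B" using f unfolding bounded_borel_def by blast
  show ?thesis
  proof (rule bounded_borelI)
    show "K f \<in> borel_measurable borel" unfolding K_def by measurable
    fix x
    have "\<bar>K f x\<bar> \<le> (\<integral>\<xi>. \<bar>acc x \<xi> * f (propose x \<xi>) + (1 - acc x \<xi>) * f x\<bar> \<partial>std_gauss)"
      unfolding K_def by (rule integral_abs_bound)
    also have "\<dots> \<le> (\<integral>\<xi>. B \<partial>(std_gauss :: (real ^ 'n) measure))"
    proof (rule Bochner_Integration.integral_mono)
      show "integrable std_gauss (\<lambda>\<xi>. \<bar>acc x \<xi> * f (propose x \<xi>) + (1 - acc x \<xi>) * f x\<bar>)"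
        by (rule integrable_abs[OF integrable_K_integrand[OF f]])
    qed (simp_all add: bounded_K_integrand[of f B, OF B])
    finally show "\<bar>K f x\<bar> \<le> B" by simp
  qed
qed

lemma K_diff:
  assumes "bounded_borel f" "bounded_borel g" shows "K (\<lambda>x. f x - g x) = (\<lambda>x. K f x - K g x)"
proof
  fix x
  have "K (\<lambda>x. f x - g x) x = (\<integral>\<xi>. (acc x \<xi> * f (propose x \<xi>) + (1 - acc x \<xi>) * f x) - (acc x \<xi> * g (propose x \<xi>) + (1 - acc x \<xi>) * g x) \<partial>std_gauss)"
    unfolding K_def by (rule Bochner_Integration.integral_cong) (auto simp: algebra_simps)
  then show "K (\<lambda>x. f x - g x) x = K f x - K g x"
    unfolding K_def using integrable_K_integrand[OF assms(1)] integrable_K_integrand[OF assms(2)] by simp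
qed

lemma Gibbs_propose: "Gibbs f (propose x \<xi>) = Gibbs f x"
  unfolding propose_def by (rule Gibbs_step)

text \<open>Neither an accepted nor a rejected move changes a function of the other blocks.\<close>
lemma K_Gibbs: "K (Gibbs f) = Gibbs f"
  by (simp add: K_def Gibbs_propose fun_eq_iff distrib_right[symmetric])

text \<open>
  Detailed balance: the joint law of state and noise, weighted by the acceptance probability, is
  invariant under reversal, because \<open>exp (- r) min 1 (exp r) = min 1 (exp (- r))\<close>.
\<close>
lemma K_invariant:
  assumes f: "bounded_borel f"
  shows "(\<integral>x. K f x \<partial>gauss_measure \<mu> Q) = (\<integral>x. f x \<partial>gauss_measure \<mu> Q)"
proof -
  let ?M = "gauss_measure \<mu> Q \<Otimes>\<^sub>M (std_gauss :: (real ^ 'n) measure)"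
  let ?\<beta> = "\<lambda>_::'n. sqrt (2 * h)" and ?u = "\<lambda>_::'n. h"
  note [measurable] = bounded_borel_measurable[OF f]
  obtain B where B: "\<And>x. \<bar>f x\<bar> \<le> B" using f unfolding bounded_borel_def by blast
  have \<beta>: "\<forall>i\<in>I. ?\<beta> i \<noteq> 0" using h_pos by simp
  have ex: "excess ?u ?\<beta> x \<xi> / 2 = nlratio x \<xi>" for x \<xi>
  proof -
    have "excess ?u ?\<beta> x \<xi> = (\<Sum>i\<in>I. ((w i (propose x \<xi>))\<^sup>2 - (w i x)\<^sup>2) * (h / 2))"
      unfolding excess_def propose_def
    proof (rule sum.cong[OF refl])
      fix i assume "i \<in> I"
      then have "a i \<noteq> 0" by (simp add: I_def)
      then have "((sqrt (2 * h))\<^sup>2 - 2 * h + a i * h\<^sup>2) / (a i * (sqrt (2 * h))\<^sup>2) = h / 2"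
        using h_pos by (simp add: power2_eq_square)
      then show "((w i (step ?u ?\<beta> x \<xi>))\<^sup>2 - (w i x)\<^sup>2) * (((sqrt (2 * h))\<^sup>2 - 2 * h + a i * h\<^sup>2) / (a i * (sqrt (2 * h))\<^sup>2))
         = ((w i (step ?u ?\<beta> x \<xi>))\<^sup>2 - (w i x)\<^sup>2) * (h / 2)" by (simp only:)
    qed
    also have "\<dots> = (\<Sum>i\<in>I. (w i (propose x \<xi>))\<^sup>2 - (w i x)\<^sup>2) * (h / 2)" by (rule sum_distrib_right[symmetric])
    finally show ?thesis by (simp add: nlratio_def mult.commute)
  qed
  define D where "D z = nlratio (fst z) (snd z)" for z
  have [measurable]: "D \<in> borel_measurable borel" unfolding D_def borel_prod[symmetric] by measurable
  note [measurable] = distr_lborel_flip(1)[OF \<beta>, of ?u]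
  define Y where "Y z = propose (fst z) (snd z)" for z
  have flip: "fst (flip ?u ?\<beta> z) = Y z" for z by (simp add: flip_def case_prod_beta Y_def propose_def)
  have ff: "flip ?u ?\<beta> (flip ?u ?\<beta> z) = z" for z
    using step_rnoise[OF \<beta>] rnoise_rnoise[OF \<beta>] by (cases z) (simp add: flip_def)
  have Yf: "Y (flip ?u ?\<beta> z) = fst z" for z using flip[of "flip ?u ?\<beta> z"] by (simp add: ff)
  have Df: "D (flip ?u ?\<beta> z) = - D z" for z
  proof -
    have Dz: "D z = h / 4 * (\<Sum>i\<in>I. (w i (Y z))\<^sup>2 - (w i (fst z))\<^sup>2)" for z by (simp add: D_def nlratio_def Y_def)
    show ?thesis unfolding Dz Yf flip by (simp add: sum_subtractf right_diff_distrib)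
  qed
  have Acc: "acc (fst z) (snd z) = min 1 (exp (- D z))" for z by (simp add: acc_def D_def)
  have M: "?M = distr (density ?M (\<lambda>z. ennreal (exp (- D z)))) borel (flip ?u ?\<beta>)"
    using pair_gauss_flip[OF \<beta>, of ?u] by (simp add: ex D_def)
  have mY: "(\<lambda>z. f (Y z)) \<in> borel_measurable borel" "(\<lambda>z. f (fst z)) \<in> borel_measurable (borel :: ((real ^ 'n) \<times> (real ^ 'n)) measure)"
    unfolding Y_def borel_prod[symmetric] by measurable
  note [measurable] = mY
  have swap: "(\<integral>z. min 1 (exp (- D z)) * f (Y z) \<partial>?M) = (\<integral>z. min 1 (exp (- D z)) * f (fst z) \<partial>?M)"
  proof -
    have "(\<integral>z. min 1 (exp (- D z)) * f (Y z) \<partial>?M)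
       = (\<integral>z. min 1 (exp (- D z)) * f (Y z) \<partial>distr (density ?M (\<lambda>z. ennreal (exp (- D z)))) borel (flip ?u ?\<beta>))"
      by (subst M) simp
    also have "\<dots> = (\<integral>z. min 1 (exp (D z)) * f (fst z) \<partial>density ?M (\<lambda>z. ennreal (exp (- D z))))"
      by (subst integral_distr) (auto simp: Df Yf)
    also have "\<dots> = (\<integral>z. exp (- D z) * (min 1 (exp (D z)) * f (fst z)) \<partial>?M)"
      by (subst integral_density) auto
    also have "(\<lambda>z. exp (- D z) * (min 1 (exp (D z)) * f (fst z))) = (\<lambda>z. min 1 (exp (- D z)) * f (fst z))"
      by (auto simp: fun_eq_iff min_def exp_minus field_simps)
    finally show ?thesis .
  qed
  have bnd: "\<bar>min 1 (exp (- D z)) * f y\<bar> \<le> B" for z y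
  proof -
    have "\<bar>min 1 (exp (- D z)) * f y\<bar> \<le> 1 * B" unfolding abs_mult using B by (intro mult_mono) auto
    then show ?thesis by simp
  qed
  have i1: "integrable ?M (\<lambda>z. min 1 (exp (- D z)) * f (Y z))"
    by (rule integrable_pair_bounded[where B = B]) (measurable, rule bnd)
  have i2: "integrable ?M (\<lambda>z. min 1 (exp (- D z)) * f (fst z))"
    by (rule integrable_pair_bounded[where B = B]) (measurable, rule bnd)
  have i3: "integrable ?M (\<lambda>z. f (fst z))" "(\<integral>z. f (fst z) \<partial>?M) = (\<integral>x. f x \<partial>gauss_measure \<mu> Q)"
    by (rule pair.integrable_fst_component[OF Pi.integrable_bounded_borel[OF f]])+
  have "integrable ?M (\<lambda>z. min 1 (exp (- D z)) * f (Y z) + (f (fst z) - min 1 (exp (- D z)) * f (fst z)))"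
    using i1 i2 i3 by simp
  from pair.integral_fst'[OF this]
  have "(\<integral>x. K f x \<partial>gauss_measure \<mu> Q) = (\<integral>z. min 1 (exp (- D z)) * f (Y z) + (f (fst z) - min 1 (exp (- D z)) * f (fst z)) \<partial>?M)"
    by (simp add: K_def Acc[of "(_, _)", simplified] Y_def left_diff_distrib)
  also have "\<dots> = (\<integral>x. f x \<partial>gauss_measure \<mu> Q)" using i1 i2 i3 swap by simp
  finally show ?thesis .
qed

text \<open>
  Take \<open>c = K f x\<close> in \<open>overlap\<close>; the accepted moves contribute at most the whole conditional variance
  of \<open>f\<close> under the kernel.
\<close>
lemma K_variance:
  assumes f: "bounded_borel f"
  shows "(OU h f x - K f x)\<^sup>2 \<le> 4 * (K (\<lambda>x. (f x)\<^sup>2) x - (K f x)\<^sup>2)"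
proof -
  define c where "c = K f x"
  note [measurable] = bounded_borel_measurable[OF f]
  have bc: "bounded_borel (\<lambda>y. (f y - c)\<^sup>2)" by (intro bounded_borel_power2 bounded_borel_diff f bounded_borel_const)
  have "(OU h f x - c)\<^sup>2 \<le> 4 * (\<integral>\<xi>. acc x \<xi> * (f (propose x \<xi>) - c)\<^sup>2 \<partial>std_gauss)" by (rule overlap[OF f])
  also have "(\<integral>\<xi>. acc x \<xi> * (f (propose x \<xi>) - c)\<^sup>2 \<partial>std_gauss) \<le> K (\<lambda>y. (f y - c)\<^sup>2) x"
    unfolding K_def
  proof (rule Bochner_Integration.integral_mono)
    show i: "integrable std_gauss (\<lambda>\<xi>. acc x \<xi> * (f (propose x \<xi>) - c)\<^sup>2 + (1 - acc x \<xi>) * (f x - c)\<^sup>2)"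
      by (rule integrable_K_integrand[OF bc])
    show "integrable std_gauss (\<lambda>\<xi>. acc x \<xi> * (f (propose x \<xi>) - c)\<^sup>2)"
      by (rule Bochner_Integration.integrable_bound[OF i]) (use acc_pos acc_le in \<open>auto simp: less_imp_le\<close>)
  qed (use acc_le in simp)
  also have "K (\<lambda>y. (f y - c)\<^sup>2) x = K (\<lambda>x. (f x)\<^sup>2) x - c\<^sup>2"
  proof -
    have i1: "integrable std_gauss (\<lambda>\<xi>. acc x \<xi> * (f (propose x \<xi>))\<^sup>2 + (1 - acc x \<xi>) * (f x)\<^sup>2)"
      by (rule integrable_K_integrand[OF bounded_borel_power2[OF f]])
    have i2: "integrable std_gauss (\<lambda>\<xi>. acc x \<xi> * f (propose x \<xi>) + (1 - acc x \<xi>) * f x)"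
      by (rule integrable_K_integrand[OF f])
    have "K (\<lambda>y. (f y - c)\<^sup>2) x = (\<integral>\<xi>. (acc x \<xi> * (f (propose x \<xi>))\<^sup>2 + (1 - acc x \<xi>) * (f x)\<^sup>2)
        - (2 * c) * (acc x \<xi> * f (propose x \<xi>) + (1 - acc x \<xi>) * f x) + c\<^sup>2 \<partial>std_gauss)"
      unfolding K_def by (rule Bochner_Integration.integral_cong) (auto simp: power2_eq_square algebra_simps)
    also have "\<dots> = K (\<lambda>x. (f x)\<^sup>2) x - (2 * c) * K f x + c\<^sup>2"
      unfolding K_def using i1 i2 by simp
    finally show ?thesis by (simp add: c_def power2_eq_square)
  qed
  finally show ?thesis by (simp add: c_def)
qed

lemma OU_K_close:
  assumes f: "bounded_borel f"
  shows "Pi.ip (\<lambda>x. OU h f x - K f x) (\<lambda>x. OU h f x - K f x) \<le> 4 * (Pi.ip f f - Pi.ip (K f) (K f))"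
proof -
  note bK = bounded_borel_K[OF f] and bK2 = bounded_borel_K[OF bounded_borel_power2[OF f]]
  have "Pi.ip (\<lambda>x. OU h f x - K f x) (\<lambda>x. OU h f x - K f x) \<le> (\<integral>x. 4 * (K (\<lambda>x. (f x)\<^sup>2) x - (K f x)\<^sup>2) \<partial>gauss_measure \<mu> Q)"
    unfolding Pi.ip_def
  proof (rule Bochner_Integration.integral_mono)
    show "integrable (gauss_measure \<mu> Q) (\<lambda>x. (OU h f x - K f x) * (OU h f x - K f x))"
      by (intro Pi.integrable_bounded_borel bounded_borel_mult bounded_borel_diff bounded_borel_op bK f)
    show "integrable (gauss_measure \<mu> Q) (\<lambda>x. 4 * (K (\<lambda>x. (f x)\<^sup>2) x - (K f x)\<^sup>2))"
      by (intro Pi.integrable_bounded_borel bounded_borel_cmult bounded_borel_diff bounded_borel_power2 bK bK2)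
    show "(OU h f x - K f x) * (OU h f x - K f x) \<le> 4 * (K (\<lambda>x. (f x)\<^sup>2) x - (K f x)\<^sup>2)" for x
      using K_variance[OF f, of x] by (simp add: power2_eq_square)
  qed
  also have "\<dots> = 4 * ((\<integral>x. K (\<lambda>x. (f x)\<^sup>2) x \<partial>gauss_measure \<mu> Q) - (\<integral>x. (K f x)\<^sup>2 \<partial>gauss_measure \<mu> Q))"
    using Pi.integrable_bounded_borel[OF bK2] Pi.integrable_bounded_borel[OF bounded_borel_power2[OF bK]] by simp
  also have "\<dots> = 4 * (Pi.ip f f - Pi.ip (K f) (K f))"
    by (subst K_invariant[OF bounded_borel_power2[OF f]]) (simp add: Pi.ip_def power2_eq_square)
  finally show ?thesis .
qed

text \<open>
  With \<open>g = f - P f\<close> both sides only involve \<open>g\<close>, as \<open>K\<close> fixes \<open>P f\<close> and both \<open>g\<close> and \<open>K g\<close> are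
  orthogonal to it. If \<open>\<Delta>\<close> is the lost squared norm, then
  \<open>\<parallel>g\<parallel> - \<surd>\<Delta> \<le> \<parallel>K g\<parallel> \<le> \<parallel>G g\<parallel> + 2 \<surd>\<Delta> \<le> (1 - \<tau>) \<parallel>g\<parallel> + 2 \<surd>\<Delta>\<close>, that is \<open>\<tau> \<parallel>g\<parallel> \<le> 3 \<surd>\<Delta>\<close>.
\<close>
lemma K_gap:
  assumes f: "bounded_borel f"
  shows "\<tau>\<^sup>2 / 9 * Pi.ip (\<lambda>x. f x - Gibbs f x) (\<lambda>x. f x - Gibbs f x) \<le> Pi.ip f f - Pi.ip (K f) (K f)"
proof -
  define g where "g = (\<lambda>x. f x - Gibbs f x)"
  have bP: "bounded_borel (Gibbs f)" and bg: "bounded_borel g"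
    unfolding g_def by (intro bounded_borel_op bounded_borel_diff f)+
  have Kg: "K g = (\<lambda>x. K f x - Gibbs f x)" unfolding g_def K_diff[OF f bP] K_Gibbs ..
  have bK: "bounded_borel (K f)" by (rule bounded_borel_K[OF f])
  have pyth: "Pi.ip k k = Pi.ip (\<lambda>x. k x - Gibbs f x) (\<lambda>x. k x - Gibbs f x) + 2 * Pi.ip (\<lambda>x. k x - Gibbs f x) (Gibbs f) + Pi.ip (Gibbs f) (Gibbs f)"
    if k: "bounded_borel k" for k
    using Pi.ip_commute[of "Gibbs f" k] by (simp add: Pi.ip_diff_left Pi.ip_diff_right k bP bounded_borel_diff)
  have o1: "Pi.ip g (Gibbs f) = 0" unfolding g_def by (rule Gibbs_orthogonal[OF f f])
  have o2: "Pi.ip (K g) (Gibbs f) = 0"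
  proof -
    have "K (\<lambda>x. g x * Gibbs f x) = (\<lambda>x. K g x * Gibbs f x)"
    proof
      fix x
      have "K (\<lambda>x. g x * Gibbs f x) x = (\<integral>\<xi>. (acc x \<xi> * g (propose x \<xi>) + (1 - acc x \<xi>) * g x) * Gibbs f x \<partial>std_gauss)"
        unfolding K_def Gibbs_propose by (rule Bochner_Integration.integral_cong) (auto simp: algebra_simps)
      then show "K (\<lambda>x. g x * Gibbs f x) x = K g x * Gibbs f x" by (simp add: K_def)
    qed
    then have "Pi.ip (K g) (Gibbs f) = (\<integral>x. K (\<lambda>x. g x * Gibbs f x) x \<partial>gauss_measure \<mu> Q)" by (simp add: Pi.ip_def)
    also have "\<dots> = Pi.ip g (Gibbs f)" unfolding K_invariant[OF bounded_borel_mult[OF bg bP]] by (simp add: Pi.ip_def)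
    finally show ?thesis using o1 by simp
  qed
  have \<Delta>: "Pi.ip f f - Pi.ip (K f) (K f) = Pi.ip g g - Pi.ip (K g) (K g)"
    using pyth[OF f] pyth[OF bK] o1 o2 by (simp add: g_def[symmetric] Kg[symmetric])
  define \<Delta> where "\<Delta> = Pi.ip g g - Pi.ip (K g) (K g)"
  have close: "Pi.ip (\<lambda>x. OU h g x - K g x) (\<lambda>x. OU h g x - K g x) \<le> 4 * \<Delta>"
    unfolding \<Delta>_def by (rule OU_K_close[OF bg])
  have "0 \<le> 4 * \<Delta>" using close Pi.ip_nonneg order_trans by blast
  then have \<Delta>0: "0 \<le> \<Delta>" by simp
  have "Pi.nm (\<lambda>x. OU h g x - K g x) \<le> sqrt (4 * \<Delta>)" using close by (simp add: Pi.nm_def)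
  then have c2: "Pi.nm (\<lambda>x. K g x - OU h g x) \<le> 2 * sqrt \<Delta>" by (simp add: real_sqrt_mult Pi.nm_diff_commute[of "K g"])
  have "Pi.nm (OU h g) \<le> (1 - \<tau>) * Pi.nm g"
  proof -
    have "h * a i \<le> 1" if "i \<in> I" for i using ha[OF that] by simp
    then show ?thesis unfolding g_def using \<tau> f by (intro OU_contraction[OF h_pos]) auto
  qed
  then have Kg_le: "Pi.nm (K g) \<le> (1 - \<tau>) * Pi.nm g + 2 * sqrt \<Delta>"
    using Pi.nm_triangle_le[OF bounded_borel_K[OF bg] bounded_borel_op[OF bg, of "\<lambda>_. h" "\<lambda>i. sqrt (2 * h - a i * h\<^sup>2)"]] c2 by linarith
  have sq: "(Pi.nm (K g))\<^sup>2 = (Pi.nm g)\<^sup>2 - (sqrt \<Delta>)\<^sup>2" using \<Delta>0 by (simp add: Pi.nm_power2 \<Delta>_def)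
  have "(sqrt \<Delta>)\<^sup>2 \<le> (Pi.nm g)\<^sup>2" using sq zero_le_power2[of "Pi.nm (K g)"] by linarith
  then have s_le: "sqrt \<Delta> \<le> Pi.nm g" by (rule power2_le_imp_le) simp
  have "(Pi.nm g - sqrt \<Delta>)\<^sup>2 \<le> (Pi.nm (K g))\<^sup>2"
  proof -
    have "sqrt \<Delta> * sqrt \<Delta> \<le> sqrt \<Delta> * Pi.nm g" using s_le \<Delta>0 by (intro mult_left_mono) auto
    then show ?thesis unfolding sq by (simp add: power2_eq_square algebra_simps)
  qed
  then have "Pi.nm g - sqrt \<Delta> \<le> Pi.nm (K g)" by (rule power2_le_imp_le) simp
  then have "\<tau> * Pi.nm g \<le> 3 * sqrt \<Delta>" using Kg_le by (simp add: left_diff_distrib)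
  then have "(\<tau> * Pi.nm g)\<^sup>2 \<le> (3 * sqrt \<Delta>)\<^sup>2" using \<tau> by (intro power_mono) auto
  then have "\<tau>\<^sup>2 * Pi.ip g g \<le> 9 * \<Delta>" using \<Delta>0 by (simp add: power_mult_distrib Pi.nm_power2)
  then show ?thesis unfolding \<Delta> \<Delta>_def[symmetric] g_def[symmetric] by simp
qed

end

section \<open>The random-scan Gibbs sampler\<close>

context eigenblock begin

text \<open>
  Two Gibbs updates with the same noise, started with difference \<open>v\<close>, end with the difference that is
  left of \<open>v\<close> after subtracting its \<open>Q\<close>-orthogonal projection onto the block.
\<close>
lemma Gibbs_shift:
  "step (\<lambda>i. 1 / a i) (\<lambda>i. 1 / sqrt (a i)) (x + v) \<xi>
   = step (\<lambda>i. 1 / a i) (\<lambda>i. 1 / sqrt (a i)) x \<xi> + (v + comb (\<lambda>i. - (e i \<bullet> (Q *v v)) / a i))"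
proof -
  have "w i (x + v) = w i x + e i \<bullet> (Q *v v)" for i
    by (simp add: w_def matrix_vector_right_distrib matrix_vector_mult_diff_distrib inner_diff_right inner_add_right)
  then have "step (\<lambda>i. 1 / a i) (\<lambda>i. 1 / sqrt (a i)) (x + v) \<xi>
     = x + v + comb (\<lambda>i. (1 / sqrt (a i) * (e i \<bullet> \<xi>) - 1 / a i * w i x) + (- (e i \<bullet> (Q *v v)) / a i))"
    unfolding step_def by (intro arg_cong[where f = "\<lambda>z. x + v + z"] comb_cong) (simp add: add_divide_distrib)
  then show ?thesis unfolding comb_add[symmetric] step_def by (simp add: add_ac)
qed

lemma Gibbs_shift_energy:
  "(v + comb (\<lambda>i. - (e i \<bullet> (Q *v v)) / a i)) \<bullet> (Q *v (v + comb (\<lambda>i. - (e i \<bullet> (Q *v v)) / a i)))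
   = v \<bullet> (Q *v v) - (\<Sum>i\<in>I. (e i \<bullet> (Q *v v))\<^sup>2 / a i)"
proof -
  have "(v + comb (\<lambda>i. - (e i \<bullet> (Q *v v)) / a i)) \<bullet> (Q *v (v + comb (\<lambda>i. - (e i \<bullet> (Q *v v)) / a i)))
    = v \<bullet> (Q *v v) + (\<Sum>i\<in>I. 2 * (- (e i \<bullet> (Q *v v)) / a i) * (e i \<bullet> (Q *v v)) + a i * (- (e i \<bullet> (Q *v v)) / a i)\<^sup>2)"
    using quad_comb[of "\<mu> + v" "\<lambda>i. - (e i \<bullet> (Q *v v)) / a i"] by (simp add: w_def)
  also have "(\<Sum>i\<in>I. 2 * (- (e i \<bullet> (Q *v v)) / a i) * (e i \<bullet> (Q *v v)) + a i * (- (e i \<bullet> (Q *v v)) / a i)\<^sup>2)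
     = (\<Sum>i\<in>I. - ((e i \<bullet> (Q *v v))\<^sup>2 / a i))"
    by (intro sum.cong refl) (simp add: I_def power2_eq_square)
  finally show ?thesis by (simp add: sum_negf)
qed

lemma Gibbs_lipschitz:
  assumes k: "\<And>x v. \<bar>k (x + v) - k x\<bar> \<le> L * sqrt (v \<bullet> (Q *v v))" and bk: "bounded_borel k"
  shows "\<bar>Gibbs k (x + v) - Gibbs k x\<bar> \<le> L * sqrt (v \<bullet> (Q *v v) - (\<Sum>i\<in>I. (e i \<bullet> (Q *v v))\<^sup>2 / a i))"
proof -
  let ?s = "step (\<lambda>i. 1 / a i) (\<lambda>i. 1 / sqrt (a i)) x"
  define v' where "v' = v + comb (\<lambda>i. - (e i \<bullet> (Q *v v)) / a i)"
  define R where "R = L * sqrt (v \<bullet> (Q *v v) - (\<Sum>i\<in>I. (e i \<bullet> (Q *v v))\<^sup>2 / a i))"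
  have "(\<lambda>\<xi>. ?s \<xi> + v') \<in> borel_measurable borel" by measurable
  note int = integrable_std_bounded[OF bk this] integrable_std_step[OF bk, of "\<lambda>i. 1 / a i" "\<lambda>i. 1 / sqrt (a i)" x]
  have eq: "Gibbs k (x + v) - Gibbs k x = (\<integral>\<xi>. k (?s \<xi> + v') - k (?s \<xi>) \<partial>std_gauss)"
    unfolding op_def Gibbs_shift v'_def[symmetric]
    by (rule Bochner_Integration.integral_diff[OF int, symmetric])
  have "\<bar>Gibbs k (x + v) - Gibbs k x\<bar> \<le> (\<integral>\<xi>. \<bar>k (?s \<xi> + v') - k (?s \<xi>)\<bar> \<partial>std_gauss)"
    unfolding eq by (rule integral_abs_bound)
  also have "\<dots> \<le> (\<integral>\<xi>. R \<partial>(std_gauss :: (real ^ 'n) measure))"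
  proof (rule Bochner_Integration.integral_mono)
    show "integrable std_gauss (\<lambda>\<xi>. \<bar>k (?s \<xi> + v') - k (?s \<xi>)\<bar>)"
      by (rule integrable_abs[OF Bochner_Integration.integrable_diff[OF int]])
    fix \<xi>
    show "\<bar>k (?s \<xi> + v') - k (?s \<xi>)\<bar> \<le> R"
      using k[of "?s \<xi>" v'] unfolding v'_def Gibbs_shift_energy R_def .
  qed simp
  finally show ?thesis by (simp add: R_def)
qed

end

lemma one_minus_sqrt_ge: "0 \<le> s \<Longrightarrow> s \<le> 1 \<Longrightarrow> s / 2 \<le> 1 - sqrt (1 - s)" for s :: real
proof -
  assume s: "0 \<le> s" "s \<le> 1"
  have "1 - s \<le> (1 - s / 2)\<^sup>2" by (simp add: power2_eq_square field_simps)
  then have "sqrt (1 - s) \<le> 1 - s / 2" using s by (intro real_le_lsqrt) auto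
  then show ?thesis by simp
qed

text \<open>
  Averaging the projections over the blocks, \<open>T = (1/d) \<Sum>\<^sub>j P\<^sub>j\<close> multiplies Lipschitz constants in the
  norm \<open>\<surd>q\<close>, \<open>q v = v \<bullet> Q v\<close>, by \<open>r = \<surd>(1 - \<psi>/d)\<close>: the average of \<open>\<surd>(q v - s\<^sub>j v)\<close> is at most
  \<open>\<surd>(q v - \<psi>/d q v)\<close>, by convexity of the square. Hence \<open>\<parallel>T F\<parallel> \<le> r \<parallel>F\<parallel>\<close> for the centred function \<open>F\<close>,
  and \<open>\<Sum>\<^sub>j \<parallel>f - P\<^sub>j f\<parallel>\<^sup>2 = d (\<parallel>F\<parallel>\<^sup>2 - \<langle>T F, F\<rangle>) \<ge> d (1 - r) \<parallel>F\<parallel>\<^sup>2\<close>. Here \<open>s\<^sub>j v\<close> is the part of the energy of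
  \<open>v\<close> that the projection of block \<open>j\<close> removes.
\<close>
lemma random_scan_gap:
  fixes \<mu> :: "real ^ 'n" and Q :: "real ^ 'n ^ 'n" and P :: "nat \<Rightarrow> (real ^ 'n \<Rightarrow> real) \<Rightarrow> real ^ 'n \<Rightarrow> real"
    and s :: "nat \<Rightarrow> real ^ 'n \<Rightarrow> real" and \<psi> :: real
  defines "M \<equiv> gauss_measure \<mu> Q"
  assumes Q: "sym_pos_def Q" and d: "0 < d"
    and P: "\<And>j f. j \<in> {1..d} \<Longrightarrow> bounded_borel f \<Longrightarrow> bounded_borel (P j f)"
    and P_diff: "\<And>j f g. j \<in> {1..d} \<Longrightarrow> bounded_borel f \<Longrightarrow> bounded_borel g \<Longrightarrow> P j (\<lambda>x. f x - g x) = (\<lambda>x. P j f x - P j g x)"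
    and P_const: "\<And>j c. j \<in> {1..d} \<Longrightarrow> P j (\<lambda>_. c) = (\<lambda>_. c)"
    and P_idem: "\<And>j f. j \<in> {1..d} \<Longrightarrow> bounded_borel f \<Longrightarrow> P j (P j f) = P j f"
    and P_sa: "\<And>j f g. j \<in> {1..d} \<Longrightarrow> bounded_borel f \<Longrightarrow> bounded_borel g \<Longrightarrow> borel_prob.ip M (P j f) g = borel_prob.ip M f (P j g)"
    and P_nm: "\<And>j f. j \<in> {1..d} \<Longrightarrow> bounded_borel f \<Longrightarrow> borel_prob.nm M (P j f) \<le> borel_prob.nm M f"
    and P_lip: "\<And>j k L x v. j \<in> {1..d} \<Longrightarrow> bounded_borel k \<Longrightarrow> 0 \<le> L \<Longrightarrow> (\<And>x v. \<bar>k (x + v) - k x\<bar> \<le> L * sqrt (v \<bullet> (Q *v v)))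
       \<Longrightarrow> \<bar>P j k (x + v) - P j k x\<bar> \<le> L * sqrt (v \<bullet> (Q *v v) - s j v)"
    and s_le: "\<And>j v. j \<in> {1..d} \<Longrightarrow> s j v \<le> v \<bullet> (Q *v v)"
    and \<psi>: "0 \<le> \<psi>" "\<And>v. \<psi> * (v \<bullet> (Q *v v)) \<le> (\<Sum>j\<in>{1..d}. s j v)"
    and f: "bounded_borel f"
  shows "\<psi> / 2 * borel_prob.ip M (\<lambda>x. f x - (\<integral>y. f y \<partial>M)) (\<lambda>x. f x - (\<integral>y. f y \<partial>M))
       \<le> (\<Sum>j\<in>{1..d}. borel_prob.ip M (\<lambda>x. f x - P j f x) (\<lambda>x. f x - P j f x))"
proof -
  interpret M: polish_prob M unfolding M_def by (rule polish_prob_gauss[OF Q])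
  interpret pair: pair_prob_space M M ..
  define q where "q v = v \<bullet> (Q *v v)" for v
  have q0: "0 \<le> q v" for v using Q by (cases "v = 0") (auto simp: q_def sym_pos_def_def less_imp_le)
  define T where "T g x = (1 / real d) * (\<Sum>j\<in>{1..d}. P j g x)" for g x
  define E where "E g = (\<lambda>_::real ^ 'n. \<integral>y. g y \<partial>M)" for g :: "real ^ 'n \<Rightarrow> real"
  define r where "r = sqrt (1 - \<psi> / real d)"
  have \<psi>d: "\<psi> \<le> real d"
  proof -
    have "axis undefined 1 \<noteq> (0 :: real ^ 'n)" by (simp add: axis_eq_0_iff)
    then have pos: "0 < q (axis undefined 1)" using Q by (simp add: q_def sym_pos_def_def)
    have "\<psi> * q (axis undefined 1) \<le> (\<Sum>j\<in>{1..d}. q (axis undefined 1))"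
      using \<psi>(2)[of "axis undefined 1"] sum_mono[of "{1..d}" "\<lambda>j. s j (axis undefined 1)" "\<lambda>_. q (axis undefined 1)"] s_le
      by (simp add: q_def)
    then show ?thesis using pos by simp
  qed
  have r: "0 \<le> r" "r\<^sup>2 = 1 - \<psi> / real d" using \<psi>d d by (simp_all add: r_def)
  have bT: "bounded_borel (T g)" if "bounded_borel g" for g
    unfolding T_def using P that by (intro bounded_borel_cmult bounded_borel_sum)
  have T_diff: "T (\<lambda>x. g x - k x) = (\<lambda>x. T g x - T k x)" if "bounded_borel g" "bounded_borel k" for g k
    using P_diff that by (simp add: T_def fun_eq_iff sum_subtractf right_diff_distrib diff_divide_distrib)
  have T_ip: "M.ip (T g) k = (1 / real d) * (\<Sum>j\<in>{1..d}. M.ip (P j g) k)" if "bounded_borel g" "bounded_borel k" for g k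
    unfolding T_def M.ip_cmult_left by (subst M.ip_sum_left) (use P that in auto)
  have T_sa: "M.ip (T g) k = M.ip g (T k)" if "bounded_borel g" "bounded_borel k" for g k
  proof -
    have "M.ip (T g) k = (1 / real d) * (\<Sum>j\<in>{1..d}. M.ip (P j k) g)"
      unfolding T_ip[OF that]
    proof (intro arg_cong2[where f = "(*)"] sum.cong refl)
      fix j assume "j \<in> {1..d}"
      then show "M.ip (P j g) k = M.ip (P j k) g"
        using P_sa[OF _ that] M.ip_commute[of g "P j k"] by simp
    qed
    then show ?thesis using T_ip[OF that(2,1)] M.ip_commute[of "T k" g] by simp
  qed
  have T_nm: "M.nm (T g) \<le> M.nm g" if g: "bounded_borel g" for g
  proof -
    have "M.ip (T g) (T g) = (1 / real d) * (\<Sum>j\<in>{1..d}. M.ip (P j g) (T g))" using T_ip g bT by simp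
    also have "\<dots> \<le> (1 / real d) * (\<Sum>j\<in>{1..d}. M.nm g * M.nm (T g))"
    proof (intro mult_left_mono sum_mono)
      fix j assume j: "j \<in> {1..d}"
      have "(M.ip (P j g) (T g))\<^sup>2 \<le> (M.nm (P j g) * M.nm (T g))\<^sup>2"
        using M.ip_cauchy_schwarz[OF P[OF j g] bT[OF g]] by (simp add: power_mult_distrib M.nm_power2)
      then have "M.ip (P j g) (T g) \<le> M.nm (P j g) * M.nm (T g)" by (rule power2_le_imp_le) simp
      also have "\<dots> \<le> M.nm g * M.nm (T g)" using P_nm[OF j g] by (rule mult_right_mono) simp
      finally show "M.ip (P j g) (T g) \<le> M.nm g * M.nm (T g)" .
    qed simp
    also have "\<dots> = M.nm g * M.nm (T g)" using d by simp
    finally have "M.nm (T g) * M.nm (T g) \<le> M.nm g * M.nm (T g)" by (simp add: M.nm_power2[symmetric] power2_eq_square)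
    then show ?thesis using M.nm_nonneg[of "T g"] M.nm_nonneg[of g] by (cases "M.nm (T g) = 0") auto
  qed
  have T1: "T (\<lambda>_. c) = (\<lambda>_. c)" for c using P_const d by (simp add: T_def fun_eq_iff)
  have E_ip: "(\<integral>y. g y \<partial>M) = M.ip g (\<lambda>_. 1)" for g by (simp add: M.ip_def)
  have T_mean: "(\<integral>y. T g y \<partial>M) = (\<integral>y. g y \<partial>M)" if "bounded_borel g" for g
    unfolding E_ip T_sa[OF that bounded_borel_const] T1 ..
  have E_nm: "M.nm (E g) \<le> M.nm g" if g: "bounded_borel g" for g
  proof -
    have "(M.ip g (\<lambda>_. 1))\<^sup>2 \<le> M.ip g g * M.ip (\<lambda>_. 1) (\<lambda>_. 1)" by (rule M.ip_cauchy_schwarz[OF g]) simp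
    moreover have "M.ip (\<lambda>_. 1) (\<lambda>_. 1) = 1" "M.ip (E g) (E g) = (M.ip g (\<lambda>_. 1))\<^sup>2"
      by (simp_all add: M.ip_def E_def M.prob_space power2_eq_square)
    ultimately have "M.ip (E g) (E g) \<le> M.ip g g" by simp
    then show ?thesis by (simp only: M.nm_def real_sqrt_le_iff)
  qed
  have energy: "integrable M (\<lambda>x. q (x - \<mu>))" unfolding M_def q_def by (rule integrable_gauss_energy[OF Q])
  define C where "C = (\<integral>x. q (x - \<mu>) \<partial>M)"
  have lip_bound: "M.ip k k \<le> L\<^sup>2 * (4 * C)"
    if bk: "bounded_borel k" and L: "0 \<le> L" and k: "\<And>x v. \<bar>k (x + v) - k x\<bar> \<le> L * sqrt (q v)" and mean: "(\<integral>y. k y \<partial>M) = 0" for k L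
  proof -
    note [measurable] = bounded_borel_measurable[OF bk]
    have [measurable]: "q \<in> borel_measurable borel" unfolding q_def by measurable
    have mult: "(k x)\<^sup>2 - 2 * k x * k y + (k y)\<^sup>2 = (k x - k y)\<^sup>2" for x y by (simp add: power2_eq_square algebra_simps)
    have kk: "(k x - k y)\<^sup>2 \<le> L\<^sup>2 * (2 * q (x - \<mu>) + 2 * q (y - \<mu>))" for x y
    proof -
      have "\<bar>k x - k y\<bar> \<le> L * sqrt (q (x - y))" using k[of y "x - y"] by simp
      then have "\<bar>k x - k y\<bar>\<^sup>2 \<le> (L * sqrt (q (x - y)))\<^sup>2" by (rule power_mono) simp
      then have "(k x - k y)\<^sup>2 \<le> L\<^sup>2 * q (x - y)" using q0 by (simp add: power_mult_distrib)
      also have "L\<^sup>2 * q (x - y) \<le> L\<^sup>2 * (2 * q (x - \<mu>) + 2 * q (y - \<mu>))"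
        using gauss_energy_diff[OF Q, of "x - \<mu>" "y - \<mu>"] by (intro mult_left_mono) (simp_all add: q_def)
      finally show ?thesis .
    qed
    have int: "integrable M k" "integrable M (\<lambda>x. (k x)\<^sup>2)"
      by (intro M.integrable_bounded_borel bounded_borel_power2 bk)+
    have key: "(k x)\<^sup>2 + M.ip k k \<le> L\<^sup>2 * (2 * q (x - \<mu>) + 2 * C)" for x
    proof -
      have "(\<integral>y. (k x)\<^sup>2 - 2 * k x * k y + (k y)\<^sup>2 \<partial>M) \<le> (\<integral>y. L\<^sup>2 * (2 * q (x - \<mu>) + 2 * q (y - \<mu>)) \<partial>M)"
        unfolding mult
      proof (rule Bochner_Integration.integral_mono)
        show "integrable M (\<lambda>y. (k x - k y)\<^sup>2)"
          by (intro M.integrable_bounded_borel bounded_borel_power2 bounded_borel_diff bk bounded_borel_const)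
        show "integrable M (\<lambda>y. L\<^sup>2 * (2 * q (x - \<mu>) + 2 * q (y - \<mu>)))" using energy by simp
      qed (rule kk)
      moreover have "(\<integral>y. (k x)\<^sup>2 - 2 * k x * k y + (k y)\<^sup>2 \<partial>M) = (k x)\<^sup>2 + M.ip k k"
        using int mean by (simp add: M.ip_def power2_eq_square M.prob_space)
      moreover have "(\<integral>y. L\<^sup>2 * (2 * q (x - \<mu>) + 2 * q (y - \<mu>)) \<partial>M) = L\<^sup>2 * (2 * q (x - \<mu>) + 2 * C)"
        using energy by (simp add: C_def M.prob_space)
      ultimately show ?thesis by linarith
    qed
    have "(\<integral>x. (k x)\<^sup>2 + M.ip k k \<partial>M) \<le> (\<integral>x. L\<^sup>2 * (2 * q (x - \<mu>) + 2 * C) \<partial>M)"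
    proof (rule Bochner_Integration.integral_mono)
      show "integrable M (\<lambda>x. (k x)\<^sup>2 + M.ip k k)" using int by simp
      show "integrable M (\<lambda>x. L\<^sup>2 * (2 * q (x - \<mu>) + 2 * C))" using energy by simp
    qed (rule key)
    then have "2 * M.ip k k \<le> L\<^sup>2 * (4 * C)"
    proof -
      have "(\<integral>x. (k x)\<^sup>2 \<partial>M) = M.ip k k" by (simp add: M.ip_def power2_eq_square)
      then have "(\<integral>x. (k x)\<^sup>2 + M.ip k k \<partial>M) = 2 * M.ip k k" using int by (simp add: M.prob_space)
      moreover have "(\<integral>x. L\<^sup>2 * (2 * q (x - \<mu>) + 2 * C) \<partial>M) = L\<^sup>2 * (\<integral>x. 2 * q (x - \<mu>) + 2 * C \<partial>M)"
        by (rule integral_mult_right_zero)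
      moreover have "(\<integral>x. 2 * q (x - \<mu>) + 2 * C \<partial>M) = 4 * C" using energy by (simp add: C_def M.prob_space)
      ultimately show ?thesis using \<open>(\<integral>x. (k x)\<^sup>2 + M.ip k k \<partial>M) \<le> _\<close> by simp
    qed
    then show ?thesis using M.ip_nonneg[of k] by linarith
  qed
  have T_lip: "\<bar>T k (x + v) - T k x\<bar> \<le> L * r * sqrt (q v)"
    if bk: "bounded_borel k" and L: "0 \<le> L" and k: "\<And>x v. \<bar>k (x + v) - k x\<bar> \<le> L * sqrt (q v)" for k L x v
  proof -
    define t where "t j = sqrt (q v - s j v)" for j
    have t2: "(t j)\<^sup>2 = q v - s j v" if "j \<in> {1..d}" for j using s_le[OF that, of v] by (simp add: t_def q_def)
    have "(\<Sum>j\<in>{1..d}. (t j)\<^sup>2) = real d * q v - (\<Sum>j\<in>{1..d}. s j v)" using t2 by (simp add: sum_subtractf)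
    also have "\<dots> \<le> real d * q v - \<psi> * q v" using \<psi>(2)[of v] by (simp add: q_def)
    also have "\<dots> = real d * (r\<^sup>2 * q v)" using d by (simp add: r(2) field_simps)
    finally have "(\<Sum>j\<in>{1..d}. (t j)\<^sup>2) * real d \<le> real d * (r\<^sup>2 * q v) * real d" by (rule mult_right_mono) simp
    moreover have "(\<Sum>j\<in>{1..d}. t j)\<^sup>2 \<le> (\<Sum>j\<in>{1..d}. (t j)\<^sup>2) * real (card {1..d})"
      by (rule sum_squared_le_sum_of_squares)
    moreover have "real d * (r\<^sup>2 * q v) * real d = (real d * (r * sqrt (q v)))\<^sup>2"
      using q0[of v] by (simp add: power_mult_distrib power2_eq_square mult_ac)
    ultimately have "(\<Sum>j\<in>{1..d}. t j)\<^sup>2 \<le> (real d * (r * sqrt (q v)))\<^sup>2" by simp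
    then have sum_t: "(\<Sum>j\<in>{1..d}. t j) \<le> real d * (r * sqrt (q v))"
      by (rule power2_le_imp_le) (use r q0 in simp)
    have "T k (x + v) - T k x = (1 / real d) * (\<Sum>j\<in>{1..d}. P j k (x + v) - P j k x)"
      by (simp add: T_def sum_subtractf right_diff_distrib diff_divide_distrib)
    then have "\<bar>T k (x + v) - T k x\<bar> = (1 / real d) * \<bar>\<Sum>j\<in>{1..d}. P j k (x + v) - P j k x\<bar>"
      by (simp add: abs_mult)
    also have "\<dots> \<le> (1 / real d) * (\<Sum>j\<in>{1..d}. L * t j)"
    proof (intro mult_left_mono order_trans[OF sum_abs] sum_mono)
      fix j assume "j \<in> {1..d}"
      then show "\<bar>P j k (x + v) - P j k x\<bar> \<le> L * t j"
        using P_lip[OF _ bk L, of j x v] k by (simp add: t_def q_def)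
    qed simp
    also have "\<dots> = (L / real d) * (\<Sum>j\<in>{1..d}. t j)" by (simp add: sum_distrib_left[symmetric])
    also have "\<dots> \<le> (L / real d) * (real d * (r * sqrt (q v)))" using sum_t L by (intro mult_left_mono) auto
    also have "\<dots> = L * r * sqrt (q v)" using d by simp
    finally show ?thesis .
  qed
  have "M.nm (T (\<lambda>x. f x - E f x)) \<le> r * M.nm (\<lambda>x. f x - E f x)"
  proof (rule M.contraction_from_lipschitz_rate[OF bT _ T_diff _ T_nm E_nm T_sa r(1) _ f])
    show "bounded_borel (E g)" if "bounded_borel g" for g by (simp add: E_def)
    show "E (\<lambda>x. g x - k x) = (\<lambda>x. E g x - E k x)" if "bounded_borel g" "bounded_borel k" for g k
      using that by (simp add: E_def M.integrable_bounded_borel)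
    fix g :: "real ^ 'n \<Rightarrow> real" assume g: "bounded_lipschitz g"
    have bg: "bounded_borel g" by (rule bounded_lipschitz_borel[OF g])
    obtain e a where ea: "orthonormal e" "\<And>i. Q *v e i = a i *\<^sub>R e i" "\<And>i. 0 < a i"
      using sym_pos_def_eigenbasis[OF Q] by blast
    interpret eb: eigenblock \<mu> Q e a
      using ea by unfold_locales (auto simp: Q less_imp_le orthonormal_inner)
    obtain L where L: "0 \<le> L" "\<And>x v. \<bar>g (x + v) - g x\<bar> \<le> L * sqrt (q v)"
      using eb.lipschitz_imp_energy_lipschitz[OF g] unfolding q_def by blast
    define k where "k n = (T ^^ n) (\<lambda>x. g x - E g x)" for n
    have bk: "bounded_borel (k n)" for n
      by (induction n) (auto simp: k_def E_def intro: bT bounded_borel_diff bg)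
    have lip: "\<bar>k n (x + v) - k n x\<bar> \<le> L * r ^ n * sqrt (q v)" for n x v
    proof (induction n arbitrary: x v)
      case 0 show ?case using L(2) by (simp add: k_def E_def)
    next
      case (Suc n)
      have "\<bar>T (k n) (x + v) - T (k n) x\<bar> \<le> (L * r ^ n) * r * sqrt (q v)"
        by (rule T_lip[OF bk _ Suc]) (use L r in simp)
      then show ?case by (simp add: k_def mult_ac)
    qed
    have mean: "(\<integral>y. k n y \<partial>M) = 0" for n
    proof (induction n)
      case 0 show ?case using bg by (simp add: k_def E_def M.integrable_bounded_borel M.prob_space)
    next
      case (Suc n) then show ?case using T_mean[OF bk[of n]] by (simp add: k_def)
    qed
    have "M.ip (k n) (k n) \<le> (L\<^sup>2 * (4 * C)) * (r\<^sup>2) ^ n" for n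
    proof -
      have "M.ip (k n) (k n) \<le> (L * r ^ n)\<^sup>2 * (4 * C)"
        by (rule lip_bound[OF bk _ lip mean]) (use L r in simp)
      then show ?thesis by (simp add: power_mult_distrib power_mult[symmetric] mult_ac)
    qed
    then show "\<exists>C. \<forall>n. M.ip ((T ^^ n) (\<lambda>x. g x - E g x)) ((T ^^ n) (\<lambda>x. g x - E g x)) \<le> C * (r\<^sup>2) ^ n"
      unfolding k_def by blast
  qed
  define F where "F = (\<lambda>x. f x - E f x)"
  have bF: "bounded_borel F" unfolding F_def E_def by (intro bounded_borel_diff f bounded_borel_const)
  have TF: "M.nm (T F) \<le> r * M.nm F" unfolding F_def by fact
  have each: "M.ip (\<lambda>x. f x - P j f x) (\<lambda>x. f x - P j f x) = M.ip F F - M.ip (P j F) F" if j: "j \<in> {1..d}" for j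
  proof -
    have PF: "P j F = (\<lambda>x. P j f x - E f x)"
      unfolding F_def using P_diff[OF j f, of "E f"] P_const[OF j] by (simp add: E_def)
    have eq: "(\<lambda>x. f x - P j f x) = (\<lambda>x. F x - P j F x)" unfolding PF by (simp add: F_def)
    have "M.ip (P j F) (P j F) = M.ip (P j F) F" using P_sa[OF j P[OF j bF] bF] P_idem[OF j bF] by simp
    then show ?thesis unfolding eq using P[OF j bF] bF M.ip_commute[of F "P j F"]
      by (simp add: M.ip_diff_left M.ip_diff_right bounded_borel_diff)
  qed
  have "(M.ip (T F) F)\<^sup>2 \<le> (M.nm (T F) * M.nm F)\<^sup>2"
    using M.ip_cauchy_schwarz[OF bT[OF bF] bF] by (simp add: power_mult_distrib M.nm_power2)
  then have "M.ip (T F) F \<le> M.nm (T F) * M.nm F" by (rule power2_le_imp_le) simp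
  also have "\<dots> \<le> r * M.nm F * M.nm F" using TF by (rule mult_right_mono) simp
  finally have TFF: "M.ip (T F) F \<le> r * M.ip F F" by (simp add: M.nm_power2[symmetric] power2_eq_square mult.assoc)
  have "\<psi> / real d / 2 \<le> 1 - r" unfolding r_def using \<psi>d \<psi>(1) d by (intro one_minus_sqrt_ge) auto
  then have "\<psi> / real d / 2 * M.ip F F \<le> (1 - r) * M.ip F F" by (rule mult_right_mono) simp
  also have "\<dots> \<le> M.ip F F - M.ip (T F) F" using TFF by (simp add: algebra_simps)
  also have "\<dots> = (1 / real d) * (\<Sum>j\<in>{1..d}. M.ip F F - M.ip (P j F) F)"
    using T_ip[OF bF bF] d by (simp add: sum_subtractf right_diff_distrib diff_divide_distrib)
  also have "\<dots> = (1 / real d) * (\<Sum>j\<in>{1..d}. M.ip (\<lambda>x. f x - P j f x) (\<lambda>x. f x - P j f x))"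
    using each by simp
  finally have "\<psi> / 2 * M.ip F F \<le> (\<Sum>j\<in>{1..d}. M.ip (\<lambda>x. f x - P j f x) (\<lambda>x. f x - P j f x))"
    using d by (simp add: field_simps)
  then show ?thesis by (simp add: F_def E_def)
qed

section \<open>Zero-padded blocks and Gaussian coordinates\<close>

definition restr :: "'n::finite set \<Rightarrow> real ^ 'n \<Rightarrow> real ^ 'n" where
  "restr J x = (\<chi> k. if k \<in> J then x $ k else 0)"

lemma restr_nth [simp]: "restr J x $ k = (if k \<in> J then x $ k else 0)" by (simp add: restr_def)

lemma inner_restr: "restr J x \<bullet> y = x \<bullet> restr J y"
  by (simp add: inner_vec_def if_distrib[of "\<lambda>z. z * _"] if_distrib[of "\<lambda>z. _ * z"])
     (auto intro!: sum.cong)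

lemma block_mult_vec: "block J J Q *v x = restr J (Q *v restr J x)"
  by (auto simp: vec_eq_iff matrix_vector_mult_def block_def intro!: sum.cong)

text \<open>
  Eigenvectors for nonzero eigenvalues lie in the range of the padded block, hence are supported in
  \<open>J\<close>. Eigenvectors for the eigenvalue 0 vanish on \<open>J\<close>, since \<open>Q\<close> is positive definite there.
\<close>
lemma block_eigenbasis:
  fixes Q :: "real ^ 'n ^ 'n"
  assumes Q: "sym_pos_def Q"
  obtains e a where "eigenblock Q e a" "\<And>i. block J J Q *v e i = a i *\<^sub>R e i"
    "\<And>i. 0 < a i \<Longrightarrow> restr J (e i) = e i" "\<And>i. a i = 0 \<Longrightarrow> restr J (e i) = 0"
proof -
  define A where "A = block J J Q"
  have Qs: "transpose Q = Q" using Q by (simp add: sym_pos_def_def)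
  then have "Q $ i $ k = Q $ k $ i" for i k by (metis transpose_def vec_lambda_beta)
  then have tA: "transpose A = A" by (auto simp: A_def block_def transpose_def vec_eq_iff)
  have "\<exists>e a. orthonormal e \<and> (\<forall>i. A *v e i = a i *\<^sub>R e i)"
    unfolding orthonormal_def by (rule spectral_theorem[OF tA]) blast
  then obtain e a where e: "orthonormal e" "\<And>i. A *v e i = a i *\<^sub>R e i" by blast
  have A: "A *v x = restr J (Q *v restr J x)" for x by (simp add: A_def block_mult_vec)
  have ee: "e i \<bullet> e k = (if i = k then 1 else 0)" for i k using e(1) by (simp add: orthonormal_def)
  have a: "restr J (e i) \<bullet> (Q *v restr J (e k)) = (if i = k then a i else 0)" for i k
    using e(2)[of k] ee[of i k] by (simp add: A inner_restr)
  have a0: "0 \<le> a i" for i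
    using a[of i i] Q by (cases "restr J (e i) = 0") (auto simp: sym_pos_def_def less_imp_le)
  have pos: "restr J (e i) = e i" if "0 < a i" for i
  proof -
    have "e i = (1 / a i) *\<^sub>R restr J (Q *v restr J (e i))" using e(2)[of i] that by (simp add: A)
    then have "restr J (e i) = restr J ((1 / a i) *\<^sub>R restr J (Q *v restr J (e i)))" by simp
    also have "\<dots> = (1 / a i) *\<^sub>R restr J (Q *v restr J (e i))" by (simp add: vec_eq_iff)
    finally show ?thesis using \<open>e i = _\<close> by simp
  qed
  have zero: "restr J (e i) = 0" if "a i = 0" for i
    using a[of i i] that Q by (auto simp: sym_pos_def_def less_le)
  have "eigenblock Q e a"
  proof
    show "sym_pos_def Q" by (rule Q)
    show "orthonormal e" by (rule e(1))
    show "0 \<le> a i" for i by (rule a0)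
    show "e i \<bullet> (Q *v e k) = (if i = k then a i else 0)" if "0 < a i" "0 < a k" for i k
      using a[of i k] unfolding pos[OF that(1)] pos[OF that(2)] .
  qed
  then show ?thesis using that e(2) pos zero unfolding A_def by blast
qed

lemma density_PiM:
  fixes f :: "'n::finite \<Rightarrow> real \<Rightarrow> ennreal"
  assumes [measurable]: "\<And>i. f i \<in> borel_measurable borel" and p: "\<And>i. prob_space (density lborel (f i))"
  shows "density (\<Pi>\<^sub>M i\<in>J. lborel) (\<lambda>z. \<Prod>i\<in>J. f i (z i)) = (\<Pi>\<^sub>M i\<in>J. density lborel (f i))"
proof -
  interpret L: product_sigma_finite "\<lambda>_::'n. lborel :: real measure" by unfold_locales
  interpret D: product_prob_space "\<lambda>i. density lborel (f i)" UNIV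
    using p by (intro product_prob_spaceI)
  show ?thesis
  proof (rule D.PiM_eqI)
    show "finite J" by simp
    show "sets (density (\<Pi>\<^sub>M i\<in>J. lborel) (\<lambda>z. \<Prod>i\<in>J. f i (z i))) = sets (\<Pi>\<^sub>M i\<in>J. density lborel (f i))"
      unfolding sets_density sets_distr by (rule sets_PiM_cong) auto
    fix A :: "'n \<Rightarrow> real set" assume "\<And>i. i \<in> J \<Longrightarrow> A i \<in> sets (density lborel (f i))"
    then have A: "\<And>i. i \<in> J \<Longrightarrow> A i \<in> sets borel" by simp
    define A' where "A' i = (if i \<in> J then A i else {})" for i
    have [measurable]: "A' i \<in> sets borel" for i using A by (simp add: A'_def)
    have PA: "Pi\<^sub>E J A = Pi\<^sub>E J A'" by (intro PiE_cong) (simp add: A'_def)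
    have "emeasure (density (\<Pi>\<^sub>M i\<in>J. lborel) (\<lambda>z. \<Prod>i\<in>J. f i (z i))) (Pi\<^sub>E J A)
       = (\<integral>\<^sup>+z. (\<Prod>i\<in>J. f i (z i)) * indicator (Pi\<^sub>E J A') z \<partial>(\<Pi>\<^sub>M i\<in>J. lborel))"
      unfolding PA by (rule emeasure_density) measurable
    also have "\<dots> = (\<integral>\<^sup>+z. (\<Prod>i\<in>J. f i (z i) * indicator (A' i) (z i)) \<partial>(\<Pi>\<^sub>M i\<in>J. lborel))"
    proof (rule nn_integral_cong)
      fix z assume "z \<in> space (\<Pi>\<^sub>M i\<in>J. lborel :: real measure)"
      then have "z \<in> extensional J" by (simp add: space_PiM PiE_def)
      then have "indicator (Pi\<^sub>E J A') z = (\<Prod>i\<in>J. indicator (A' i) (z i) :: ennreal)"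
        by (auto simp: indicator_def PiE_def prod_zero_iff Pi_iff)
      then show "(\<Prod>i\<in>J. f i (z i)) * indicator (Pi\<^sub>E J A') z = (\<Prod>i\<in>J. f i (z i) * indicator (A' i) (z i))"
        by (simp add: prod.distrib)
    qed
    also have "\<dots> = (\<Prod>i\<in>J. \<integral>\<^sup>+z. f i z * indicator (A' i) z \<partial>lborel)"
      by (rule L.product_nn_integral_prod) auto
    also have "\<dots> = (\<Prod>i\<in>J. emeasure (density lborel (f i)) (A i))"
      using A by (intro prod.cong refl) (simp add: A'_def emeasure_density)
    finally show "emeasure (density (\<Pi>\<^sub>M i\<in>J. lborel) (\<lambda>z. \<Prod>i\<in>J. f i (z i))) (Pi\<^sub>E J A)
       = (\<Prod>i\<in>J. emeasure (density lborel (f i)) (A i))" .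
  qed
qed

lemma orthonormal_axis: "orthonormal (\<lambda>i. axis i 1 :: real ^ 'n)"
  by (simp add: orthonormal_def inner_axis_axis)

lemma distr_std_gauss_coordinates:
  fixes J :: "'n::finite set" and m :: "'n \<Rightarrow> real"
  assumes s: "0 < s"
  shows "distr std_gauss (\<Pi>\<^sub>M i\<in>J. lborel) (\<lambda>\<xi>. \<lambda>i\<in>J. m i + s * \<xi> $ i)
     = (\<Pi>\<^sub>M i\<in>J. density lborel (\<lambda>z. ennreal (normal_density (m i) s z)))"
proof -
  have p: "prob_space (density lborel (\<lambda>z. ennreal (normal_density (m i) s z)))" for i
    by (rule prob_space_normal_density[OF s])
  interpret D: product_prob_space "\<lambda>i::'n. density lborel (\<lambda>z. ennreal (normal_density (m i) s z))" UNIV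
    using p by (intro product_prob_spaceI)
  have meas [measurable]: "(\<lambda>\<xi>. \<lambda>i\<in>J. m i + s * \<xi> $ i) \<in> borel \<rightarrow>\<^sub>M (\<Pi>\<^sub>M i\<in>J. lborel)"
    by (rule measurable_restrict) simp
  show ?thesis
  proof (rule D.PiM_eqI)
    show "finite J" by simp
    show "sets (distr std_gauss (\<Pi>\<^sub>M i\<in>J. lborel) (\<lambda>\<xi>. \<lambda>i\<in>J. m i + s * \<xi> $ i)) = sets (\<Pi>\<^sub>M i\<in>J. density lborel (\<lambda>z. ennreal (normal_density (m i) s z)))"
      unfolding sets_density sets_distr by (rule sets_PiM_cong) auto
    fix A :: "'n \<Rightarrow> real set" assume "\<And>i. i \<in> J \<Longrightarrow> A i \<in> sets (density lborel (\<lambda>z. ennreal (normal_density (m i) s z)))"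
    then have A: "\<And>i. i \<in> J \<Longrightarrow> A i \<in> sets borel" by simp
    define A' where "A' i = (if i \<in> J then A i else UNIV)" for i
    have mA [measurable]: "A' i \<in> sets borel" for i using A by (simp add: A'_def)
    have PA: "Pi\<^sub>E J A = Pi\<^sub>E J A'" by (intro PiE_cong) (simp add: A'_def)
    define \<phi> where "\<phi> i z = (indicator (A' i) (m i + s * z) :: ennreal)" for i z
    have [measurable]: "\<phi> i \<in> borel_measurable borel" for i unfolding \<phi>_def by measurable
    have set: "Pi\<^sub>E J A' \<in> sets (\<Pi>\<^sub>M i\<in>J. lborel)" by (intro sets_PiM_I_finite) auto
    have "emeasure (distr std_gauss (\<Pi>\<^sub>M i\<in>J. lborel) (\<lambda>\<xi>. \<lambda>i\<in>J. m i + s * \<xi> $ i)) (Pi\<^sub>E J A)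
      = (\<integral>\<^sup>+z. indicator (Pi\<^sub>E J A') z \<partial>distr std_gauss (\<Pi>\<^sub>M i\<in>J. lborel) (\<lambda>\<xi>. \<lambda>i\<in>J. m i + s * \<xi> $ i))"
      unfolding PA using set by simp
    also have "\<dots> = (\<integral>\<^sup>+\<xi>. indicator (Pi\<^sub>E J A') (\<lambda>i\<in>J. m i + s * \<xi> $ i) \<partial>std_gauss)"
      using set by (intro nn_integral_distr) auto
    also have "\<dots> = (\<integral>\<^sup>+\<xi>. (\<Prod>i\<in>UNIV. \<phi> i (axis i 1 \<bullet> \<xi>)) \<partial>std_gauss)"
    proof (rule nn_integral_cong)
      fix \<xi> :: "real ^ 'n"
      show "indicator (Pi\<^sub>E J A') (\<lambda>i\<in>J. m i + s * \<xi> $ i) = (\<Prod>i\<in>UNIV. \<phi> i (axis i 1 \<bullet> \<xi>))"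
      proof (cases "\<forall>i. m i + s * \<xi> $ i \<in> A' i")
        case True
        then show ?thesis by (simp add: \<phi>_def inner_axis' PiE_def Pi_def)
      next
        case False
        then obtain i where i: "m i + s * \<xi> $ i \<notin> A' i" by blast
        then have "i \<in> J" by (simp add: A'_def split: if_split_asm)
        then have "(\<lambda>i\<in>J. m i + s * \<xi> $ i) \<notin> Pi\<^sub>E J A'" using i by (auto simp: PiE_def Pi_def)
        moreover have "(\<Prod>i\<in>UNIV. \<phi> i (axis i 1 \<bullet> \<xi>)) = 0"
          using i by (simp add: \<phi>_def inner_axis' prod_zero_iff) (rule exI[of _ i], simp)
        ultimately show ?thesis by simp
      qed
    qed
    also have "\<dots> = (\<Prod>i\<in>UNIV. \<integral>\<^sup>+z. ennreal (std_normal_density z) * \<phi> i z \<partial>lborel)"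
      by (rule nn_integral_std_gauss_prod[OF orthonormal_axis]) measurable
    also have "\<dots> = (\<Prod>i\<in>UNIV. emeasure (density lborel (\<lambda>z. ennreal (normal_density (m i) s z))) (A' i))"
    proof (rule prod.cong[OF refl])
      fix i
      have sd: "s * normal_density (m i) s (m i + s * z) = std_normal_density z" for z
        using s by (simp add: normal_density_def real_sqrt_mult power_mult_distrib)
      have "emeasure (density lborel (\<lambda>z. ennreal (normal_density (m i) s z))) (A' i)
         = (\<integral>\<^sup>+z. ennreal (normal_density (m i) s z) * indicator (A' i) z \<partial>lborel)"
        by (rule emeasure_density) auto
      also have "\<dots> = ennreal \<bar>s\<bar> * (\<integral>\<^sup>+z. ennreal (normal_density (m i) s (m i + s * z)) * indicator (A' i) (m i + s * z) \<partial>lborel)"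
        using s by (intro nn_integral_real_affine) auto
      also have "\<dots> = (\<integral>\<^sup>+z. ennreal \<bar>s\<bar> * (ennreal (normal_density (m i) s (m i + s * z)) * indicator (A' i) (m i + s * z)) \<partial>lborel)"
        by (rule nn_integral_cmult[symmetric]) measurable
      also have "\<dots> = (\<integral>\<^sup>+z. ennreal (std_normal_density z) * \<phi> i z \<partial>lborel)"
        using s by (intro nn_integral_cong) (simp add: \<phi>_def sd[symmetric] ennreal_mult mult.assoc)
      finally show "(\<integral>\<^sup>+z. ennreal (std_normal_density z) * \<phi> i z \<partial>lborel)
         = emeasure (density lborel (\<lambda>z. ennreal (normal_density (m i) s z))) (A' i)" by simp
    qed
    also have "\<dots> = (\<Prod>i\<in>J. emeasure (density lborel (\<lambda>z. ennreal (normal_density (m i) s z))) (A' i))"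
    proof (rule prod.mono_neutral_right)
      show "\<forall>i\<in>UNIV - J. emeasure (density lborel (\<lambda>z. ennreal (normal_density (m i) s z))) (A' i) = 1"
        using prob_space.emeasure_space_1[OF p] by (simp add: A'_def)
    qed auto
    also have "\<dots> = (\<Prod>i\<in>J. emeasure (density lborel (\<lambda>z. ennreal (normal_density (m i) s z))) (A i))"
      by (intro prod.cong) (auto simp: A'_def)
    finally show "emeasure (distr std_gauss (\<Pi>\<^sub>M i\<in>J. lborel) (\<lambda>\<xi>. \<lambda>i\<in>J. m i + s * \<xi> $ i)) (Pi\<^sub>E J A)
       = (\<Prod>i\<in>J. emeasure (density lborel (\<lambda>z. ennreal (normal_density (m i) s z))) (A i))" .
  qed
qed

lemma measurable_upd_block [measurable]:
  fixes x :: "real ^ 'n"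
  shows "upd_block J x \<in> (\<Pi>\<^sub>M i\<in>J. lborel) \<rightarrow>\<^sub>M borel"
proof -
  have "upd_block J x z = x - restr J x + (\<Sum>i\<in>J. z i *\<^sub>R axis i 1)" for z
    by (auto simp: vec_eq_iff upd_block_def axis_def if_distrib[of "\<lambda>r. _ * r"] cong: if_cong)
  then have "upd_block J x = (\<lambda>z. x - restr J x + (\<Sum>i\<in>J. z i *\<^sub>R axis i 1))" by blast
  then show ?thesis by simp
qed

lemma grad_log_gauss:
  fixes Q :: "real ^ 'n ^ 'n"
  assumes Q: "sym_pos_def Q"
  shows "grad (\<lambda>z. ln (gauss_density \<mu> Q z)) x = - (Q *v (x - \<mu>))"
proof -
  define c where "c = ln (sqrt (det Q / (2 * pi) ^ CARD('n)))"
  have ln: "ln (gauss_density \<mu> Q z) = c - ((z - \<mu>) \<bullet> (Q *v (z - \<mu>))) / 2" for z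
    using sym_pos_def_det_pos[OF Q] by (simp add: gauss_density_def c_def ln_mult)
  have sym: "transpose Q = Q" using Q by (simp add: sym_pos_def_def)
  have lin: "((*v) Q has_derivative (*v) Q) F" for F
    by (intro bounded_linear_imp_has_derivative) (simp add: linear_linear[symmetric] matrix_vector_mul_linear)
  have "((\<lambda>z. c - ((z - \<mu>) \<bullet> (Q *v (z - \<mu>))) / 2) has_derivative
      (\<lambda>v. 0 - ((x - \<mu>) \<bullet> (Q *v v) + v \<bullet> (Q *v (x - \<mu>))) / 2)) (at x)"
    by (auto intro!: derivative_eq_intros has_derivative_compose[OF _ lin])
  moreover have "(\<lambda>v. 0 - ((x - \<mu>) \<bullet> (Q *v v) + v \<bullet> (Q *v (x - \<mu>))) / 2) = (\<lambda>v. v \<bullet> (- (Q *v (x - \<mu>))))"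
    using inner_matrix_sym[OF sym, of "x - \<mu>"] by (simp add: fun_eq_iff inner_commute)
  ultimately have D: "GDERIV (\<lambda>z. ln (gauss_density \<mu> Q z)) x :> - (Q *v (x - \<mu>))"
    unfolding gderiv_def ln by simp
  show ?thesis unfolding grad_def
  proof (rule the_equality)
    show "GDERIV (\<lambda>z. ln (gauss_density \<mu> Q z)) x :> - (Q *v (x - \<mu>))" by (rule D)
    fix g assume "GDERIV (\<lambda>z. ln (gauss_density \<mu> Q z)) x :> g"
    then have "(\<lambda>v. v \<bullet> g) = (\<lambda>v. v \<bullet> (- (Q *v (x - \<mu>))))"
      using D unfolding gderiv_def by (rule has_derivative_unique)
    then show "g = - (Q *v (x - \<mu>))" by (metis vector_eq_ldot)
  qed
qed

section \<open>The block MALA kernel\<close>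

lemma measurable_vec_nth_compose:
  fixes f :: "'a \<Rightarrow> real ^ 'n"
  assumes [measurable]: "f \<in> N \<rightarrow>\<^sub>M borel" shows "(\<lambda>x. f x $ i) \<in> borel_measurable N"
  unfolding cart_eq_inner_axis by measurable

lemma measurable_mala_prop_density [measurable (raw)]:
  fixes Q :: "real ^ 'n ^ 'n"
  assumes Q: "sym_pos_def Q" and [measurable]: "f \<in> N \<rightarrow>\<^sub>M borel" "g \<in> N \<rightarrow>\<^sub>M borel"
  shows "(\<lambda>z. mala_prop_density (gauss_density \<mu> Q) J h (f z) (g z)) \<in> borel_measurable N"
proof -
  have [measurable]: "(\<lambda>z. f z $ i) \<in> borel_measurable N" "(\<lambda>z. g z $ i) \<in> borel_measurable N"
    "(\<lambda>z. (- (Q *v (f z - \<mu>))) $ i) \<in> borel_measurable N" for i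
    by (rule measurable_vec_nth_compose, measurable)+
  show ?thesis unfolding mala_prop_density_def grad_log_gauss[OF Q] normal_density_def by measurable
qed

lemma measurable_mala_accept:
  fixes Q :: "real ^ 'n ^ 'n"
  assumes Q: "sym_pos_def Q" and fg [measurable]: "f \<in> N \<rightarrow>\<^sub>M borel" "g \<in> N \<rightarrow>\<^sub>M borel"
  shows "(\<lambda>z. mala_accept (gauss_density \<mu> Q) J h (f z) (g z)) \<in> borel_measurable N"
  unfolding mala_accept_def
  by (intro borel_measurable_min borel_measurable_const borel_measurable_divide borel_measurable_times
      measurable_mala_prop_density[OF Q] measurable_compose[OF _ measurable_gauss_density] fg)

lemma mala_accept_range:
  fixes Q :: "real ^ 'n ^ 'n"
  assumes Q: "sym_pos_def Q"
  shows "0 \<le> mala_accept (gauss_density \<mu> Q) J h x y" "mala_accept (gauss_density \<mu> Q) J h x y \<le> 1"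
  using gauss_density_pos[OF Q] unfolding mala_accept_def mala_prop_density_def
  by (auto intro!: divide_nonneg_nonneg mult_nonneg_nonneg prod_nonneg less_imp_le[OF gauss_density_pos[OF Q]])

text \<open>
  In addition to the step size conditions, the block is the set \<open>J\<close> of coordinates on which the
  eigenvectors in \<open>I\<close> live.
\<close>
locale mala_block = eigenblock_step \<mu> Q e a h \<tau> for \<mu> :: "real ^ 'n" and Q e a h \<tau> +
  fixes J :: "'n set"
  assumes eJ: "\<And>i. 0 < a i \<Longrightarrow> restr J (e i) = e i" "\<And>i. a i = 0 \<Longrightarrow> restr J (e i) = 0"
begin

lemma inner_restr_e: "e i \<bullet> restr J u = (if i \<in> I then e i \<bullet> u else 0)"
  using eJ[of i] a_nonneg[of i] unfolding inner_restr[symmetric] by (auto simp: I_def less_le)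

lemma comb_inner: "comb (\<lambda>i. e i \<bullet> u) = restr J u"
proof -
  have "restr J u = (\<Sum>i\<in>UNIV. (e i \<bullet> restr J u) *\<^sub>R e i)" by (rule orthonormal_expansion[OF on, symmetric])
  also have "\<dots> = comb (\<lambda>i. e i \<bullet> u)"
    unfolding comb_def by (rule sum.mono_neutral_cong_right) (auto simp: inner_restr_e)
  finally show ?thesis ..
qed

lemma propose_eq: "propose x \<xi> = x + restr J (sqrt (2 * h) *\<^sub>R \<xi> - h *\<^sub>R (Q *v (x - \<mu>)))"
  unfolding propose_def step_def w_def comb_inner[symmetric] by (simp add: inner_diff_right)

lemma sum_w_square: "(\<Sum>i\<in>I. (w i x)\<^sup>2) = (\<Sum>k\<in>J. ((Q *v (x - \<mu>)) $ k)\<^sup>2)"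
proof -
  define u where "u = Q *v (x - \<mu>)"
  have "(\<Sum>i\<in>I. (w i x)\<^sup>2) = (\<Sum>i\<in>UNIV. (e i \<bullet> restr J u) * (e i \<bullet> restr J u))"
    by (rule sum.mono_neutral_cong_left) (auto simp: inner_restr_e w_def u_def power2_eq_square)
  also have "\<dots> = restr J u \<bullet> restr J u" by (rule orthonormal_parseval[OF on, symmetric])
  also have "\<dots> = (\<Sum>k\<in>J. (u $ k)\<^sup>2)"
    unfolding inner_vec_def by (rule sum.mono_neutral_cong_right) (auto simp: power2_eq_square)
  finally show ?thesis unfolding u_def .
qed

text \<open>
  The proposal is given by a product density on the coordinates in \<open>J\<close>; here it is realised as a
  function of a standard normal vector on the full space. Its coordinates outside \<open>J\<close> are discarded.
\<close>
lemma mala_proposal_eq: "mala_proposal (gauss_density \<mu> Q) J h x = distr std_gauss borel (propose x)"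
proof -
  define m where "m k = x $ k + h * grad (\<lambda>z. ln (gauss_density \<mu> Q z)) x $ k" for k
  define s where "s = sqrt (2 * h)"
  have s: "0 < s" using h_pos by (simp add: s_def)
  have m: "m k = x $ k - h * (Q *v (x - \<mu>)) $ k" for k by (simp add: m_def grad_log_gauss[OF Q])
  have "ennreal (mala_prop_density (gauss_density \<mu> Q) J h x (upd_block J x z))
      = (\<Prod>i\<in>J. ennreal (normal_density (m i) s (z i)))" for z
  proof -
    have "mala_prop_density (gauss_density \<mu> Q) J h x (upd_block J x z) = (\<Prod>i\<in>J. normal_density (m i) s (z i))"
      unfolding mala_prop_density_def m_def[symmetric] s_def[symmetric]
      by (rule prod.cong) (simp_all add: upd_block_def)
    then show ?thesis by (simp add: prod_ennreal)
  qed
  then have "mala_proposal (gauss_density \<mu> Q) J h x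
     = distr (density (\<Pi>\<^sub>M i\<in>J. lborel) (\<lambda>z. \<Prod>i\<in>J. ennreal (normal_density (m i) s (z i)))) borel (upd_block J x)"
    unfolding mala_proposal_def by simp
  also have "density (\<Pi>\<^sub>M i\<in>J. lborel) (\<lambda>z. \<Prod>i\<in>J. ennreal (normal_density (m i) s (z i)))
     = (\<Pi>\<^sub>M i\<in>J. density lborel (\<lambda>z. ennreal (normal_density (m i) s z)))"
    by (rule density_PiM) (simp_all add: prob_space_normal_density[OF s])
  also have "\<dots> = distr std_gauss (\<Pi>\<^sub>M i\<in>J. lborel) (\<lambda>\<xi>. \<lambda>i\<in>J. m i + s * \<xi> $ i)"
    by (rule distr_std_gauss_coordinates[OF s, symmetric])
  also have "distr \<dots> borel (upd_block J x) = distr std_gauss borel (upd_block J x \<circ> (\<lambda>\<xi>. \<lambda>i\<in>J. m i + s * \<xi> $ i))"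
    by (rule distr_distr) (auto intro!: measurable_restrict measurable_upd_block)
  also have "upd_block J x \<circ> (\<lambda>\<xi>. \<lambda>i\<in>J. m i + s * \<xi> $ i) = propose x"
    by (auto simp: fun_eq_iff vec_eq_iff propose_eq upd_block_def m s_def)
  finally show ?thesis .
qed

text \<open>
  The terms of the log-ratio that are bilinear in the increment \<open>y - x\<close> and the gradients cancel
  against the difference of the energies of \<open>y\<close> and \<open>x\<close>. What is left is \<open>h/4\<close> times the difference of
  the squared block gradients.
\<close>
lemma mala_accept_eq: "mala_accept (gauss_density \<mu> Q) J h x (propose x \<xi>) = acc x \<xi>"
proof -
  define y where "y = propose x \<xi>"
  define g where "g z = Q *v (z - \<mu>)" for z
  define E where "E z = (z - \<mu>) \<bullet> g z" for z
  define C where "C = sqrt (det Q / (2 * pi) ^ CARD('n))"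
  define c where "c = 1 / sqrt (2 * pi * (sqrt (2 * h))\<^sup>2)"
  define S where "S u v = (\<Sum>k\<in>J. (v $ k - u $ k + h * g u $ k)\<^sup>2 / (4 * h))" for u v
  have pos: "0 < C" "0 < c" using sym_pos_def_det_pos[OF Q] h_pos by (simp_all add: C_def c_def)
  have p: "gauss_density \<mu> Q z = C * exp (- E z / 2)" for z
    by (simp add: gauss_density_def C_def E_def g_def)
  have r: "mala_prop_density (gauss_density \<mu> Q) J h u v = c ^ card J * exp (- S u v)" for u v
  proof -
    have "mala_prop_density (gauss_density \<mu> Q) J h u v = (\<Prod>k\<in>J. c * exp (- ((v $ k - u $ k + h * g u $ k)\<^sup>2 / (4 * h))))"
      unfolding mala_prop_density_def grad_log_gauss[OF Q]
      using h_pos by (intro prod.cong refl) (simp add: normal_density_def c_def g_def algebra_simps)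
    also have "\<dots> = c ^ card J * exp (- S u v)"
      by (simp add: prod.distrib exp_sum[symmetric] S_def sum_negf)
    finally show ?thesis .
  qed
  define \<delta> where "\<delta> = y - x"
  have \<delta>: "\<delta> = restr J \<delta>" by (simp add: \<delta>_def y_def propose_eq vec_eq_iff)
  have E_diff: "E y - E x = (\<Sum>k\<in>J. \<delta> $ k * (g x $ k + g y $ k))"
  proof -
    have "E y - E x = \<delta> \<bullet> (g x + g y)"
    proof -
      have "(x - \<mu>) \<bullet> g y = (y - \<mu>) \<bullet> g x" unfolding g_def by (subst Q_sym) (simp add: inner_commute)
      then show ?thesis by (simp add: E_def \<delta>_def inner_diff_left inner_add_right)
    qed
    also have "\<dots> = restr J \<delta> \<bullet> (g x + g y)" using \<delta> by simp
    also have "\<dots> = (\<Sum>k\<in>J. \<delta> $ k * (g x $ k + g y $ k))"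
      unfolding inner_vec_def by (rule sum.mono_neutral_cong_right) auto
    finally show ?thesis .
  qed
  have dr: "nlratio x \<xi> = h / 4 * ((\<Sum>k\<in>J. (g y $ k)\<^sup>2) - (\<Sum>k\<in>J. (g x $ k)\<^sup>2))"
    by (simp add: nlratio_def sum_subtractf sum_w_square y_def g_def)
  have "S x y - S y x = (\<Sum>k\<in>J. \<delta> $ k * (g x $ k + g y $ k) / 2 + h / 4 * ((g x $ k)\<^sup>2 - (g y $ k)\<^sup>2))"
    unfolding S_def sum_subtractf[symmetric] \<delta>_def using h_pos
    by (intro sum.cong refl) (simp add: field_simps power2_eq_square)
  also have "\<dots> = (E y - E x) / 2 - nlratio x \<xi>"
    unfolding E_diff dr by (simp add: sum.distrib sum_divide_distrib sum_subtractf right_diff_distrib sum_distrib_left)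
  finally have ex: "- E y / 2 - S y x - (- E x / 2 - S x y) = - nlratio x \<xi>" by (simp add: field_simps)
  have "(gauss_density \<mu> Q y * mala_prop_density (gauss_density \<mu> Q) J h y x) / (gauss_density \<mu> Q x * mala_prop_density (gauss_density \<mu> Q) J h x y)
     = (C * c ^ card J * exp (- E y / 2 - S y x)) / (C * c ^ card J * exp (- E x / 2 - S x y))"
  proof -
    have "exp (u - v) = exp u * exp (- v)" for u v :: real by (simp add: exp_diff exp_minus divide_inverse)
    then show ?thesis unfolding p r by (simp only: ac_simps)
  qed
  also have "\<dots> = exp (- E y / 2 - S y x) / exp (- E x / 2 - S x y)"
  proof -
    have "C * c ^ card J \<noteq> 0" using pos by simp
    then show ?thesis by (rule mult_divide_mult_cancel_left)
  qed
  also have "\<dots> = exp (- nlratio x \<xi>)" unfolding exp_diff[symmetric] ex ..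
  finally show ?thesis unfolding mala_accept_def acc_def y_def by simp
qed

end

lemma measurable_accept_reject:
  fixes Q :: "real ^ 'n ^ 'n"
  assumes Q: "sym_pos_def Q"
  shows "(\<lambda>(x, y). distr (measure_pmf (bernoulli_pmf (mala_accept (gauss_density \<mu> Q) J h x y))) borel
      (\<lambda>accept. if accept then y else x)) \<in> borel \<Otimes>\<^sub>M borel \<rightarrow>\<^sub>M prob_algebra borel" (is "?N \<in> _")
proof (rule measurable_prob_algebraI)
  note range = mala_accept_range[OF Q, of \<mu> J h]
  have meas: "(\<lambda>b. if b then y else x) \<in> measure_pmf p \<rightarrow>\<^sub>M borel" for x y :: "real ^ 'n" and p by simp
  show ps: "prob_space (?N z)" for z
    by (cases z) (simp add: prob_space.prob_space_distr[OF measure_pmf.prob_space_axioms meas])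
  show "?N \<in> borel \<Otimes>\<^sub>M borel \<rightarrow>\<^sub>M subprob_algebra borel"
  proof (rule measurable_subprob_algebra)
    show "subprob_space (?N z)" for z by (rule prob_space_imp_subprob_space[OF ps])
    show "sets (?N z) = sets borel" for z by (cases z) simp
    fix A :: "(real ^ 'n) set" assume A [measurable]: "A \<in> sets borel"
    have "emeasure (?N z) A = indicator A (snd z) * ennreal (mala_accept (gauss_density \<mu> Q) J h (fst z) (snd z))
        + indicator A (fst z) * ennreal (1 - mala_accept (gauss_density \<mu> Q) J h (fst z) (snd z))" for z
    proof -
      have "emeasure (?N z) A = (\<integral>\<^sup>+b. indicator A (if b then snd z else fst z)
          \<partial>measure_pmf (bernoulli_pmf (mala_accept (gauss_density \<mu> Q) J h (fst z) (snd z))))"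
      proof -
        have "emeasure (?N z) A = (\<integral>\<^sup>+y. indicator A y \<partial>?N z)" using A by (cases z) simp
        also have "\<dots> = (\<integral>\<^sup>+b. indicator A (if b then snd z else fst z)
          \<partial>measure_pmf (bernoulli_pmf (mala_accept (gauss_density \<mu> Q) J h (fst z) (snd z))))"
          unfolding case_prod_beta by (rule nn_integral_distr) auto
        finally show ?thesis .
      qed
      then show ?thesis using range by simp
    qed
    moreover have "(\<lambda>z. indicator A (snd z) * ennreal (mala_accept (gauss_density \<mu> Q) J h (fst z) (snd z))
        + indicator A (fst z) * ennreal (1 - mala_accept (gauss_density \<mu> Q) J h (fst z) (snd z))) \<in> borel_measurable (borel \<Otimes>\<^sub>M borel)"
    proof -
      have [measurable]: "(\<lambda>z. mala_accept (gauss_density \<mu> Q) J h (fst z) (snd z)) \<in> borel_measurable (borel \<Otimes>\<^sub>M borel)"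
        by (rule measurable_mala_accept[OF Q]) measurable
      show ?thesis by measurable
    qed
    ultimately show "(\<lambda>z. emeasure (?N z) A) \<in> borel_measurable (borel \<Otimes>\<^sub>M borel)" by simp
  qed
qed

context mala_block begin

lemma measurable_mala_kernel:
  "mala_kernel (gauss_density \<mu> Q) J h \<in> borel \<rightarrow>\<^sub>M prob_algebra borel"
  unfolding mala_kernel_def[abs_def] mala_proposal_eq
proof (rule measurable_bind_prob_space2[OF measurable_distr_prob_space2 measurable_accept_reject[OF Q]])
  show "(\<lambda>_. std_gauss) \<in> borel \<rightarrow>\<^sub>M prob_algebra (borel :: (real ^ 'n) measure)"
    by (rule measurable_const) (simp add: space_prob_algebra std.prob_space_axioms)
  show "(\<lambda>(x, y). propose x y) \<in> borel \<Otimes>\<^sub>M borel \<rightarrow>\<^sub>M borel" by measurable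
qed

lemma kernel_op_mala:
  assumes f: "bounded_borel f"
  shows "kernel_op (mala_kernel (gauss_density \<mu> Q) J h) f = K f"
proof
  fix x
  let ?N = "\<lambda>y. distr (measure_pmf (bernoulli_pmf (mala_accept (gauss_density \<mu> Q) J h x y))) borel (\<lambda>accept. if accept then y else x)"
  note [measurable] = bounded_borel_measurable[OF f]
  obtain B where B: "\<And>x. \<bar>f x\<bar> \<le> B" using f unfolding bounded_borel_def by blast
  have N: "?N \<in> borel \<rightarrow>\<^sub>M prob_algebra borel"
    using measurable_compose[OF _ measurable_accept_reject[OF Q], of "\<lambda>y. (x, y)" borel] by simp
  have Nint: "(\<integral>z. f z \<partial>?N y) = mala_accept (gauss_density \<mu> Q) J h x y * f y + (1 - mala_accept (gauss_density \<mu> Q) J h x y) * f x" for y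
    by (subst integral_distr) (auto simp: mala_accept_range[OF Q])
  have mp [measurable]: "propose x \<in> std_gauss \<rightarrow>\<^sub>M borel" by measurable
  have "kernel_op (mala_kernel (gauss_density \<mu> Q) J h) f x = (\<integral>y. (\<integral>z. f z \<partial>?N y) \<partial>distr std_gauss borel (propose x))"
    unfolding kernel_op_def mala_kernel_def mala_proposal_eq
  proof (rule integral_bind)
    show "?N \<in> distr std_gauss borel (propose x) \<rightarrow>\<^sub>M subprob_algebra borel"
      using measurable_prob_algebraD[OF N] by simp
    show "finite_measure (distr std_gauss borel (propose x))"
      by (intro prob_space.finite_measure std.prob_space_distr mp)
    have "prob_space (?N y)" for y
      using measurable_space[OF N, of y] by (simp add: space_prob_algebra)
    then show "AE y in distr std_gauss borel (propose x). emeasure (?N y) (space (?N y)) \<le> ennreal 1"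
      by (intro AE_I2) (simp only: prob_space.emeasure_space_1 ennreal_1)
  qed (simp, rule B)
  also have "\<dots> = (\<integral>\<xi>. (\<integral>z. f z \<partial>?N (propose x \<xi>)) \<partial>std_gauss)"
  proof (rule integral_distr[OF mp])
    have ma: "(\<lambda>y. mala_accept (gauss_density \<mu> Q) J h x y) \<in> borel_measurable borel"
      by (rule measurable_mala_accept[OF Q, of "\<lambda>_. x" borel "\<lambda>y. y"]) simp_all
    show "(\<lambda>y. \<integral>z. f z \<partial>?N y) \<in> borel_measurable borel" unfolding Nint
      by (intro borel_measurable_add borel_measurable_times borel_measurable_diff borel_measurable_const ma
          bounded_borel_measurable[OF f])
  qed
  also have "\<dots> = K f x" unfolding Nint unfolding mala_accept_eq K_def ..
  finally show "kernel_op (mala_kernel (gauss_density \<mu> Q) J h) f x = K f x" .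
qed

end

section \<open>Eigenvalues and inverses of blocks\<close>

lemma eigenvalues_pos_def:
  fixes Q :: "real ^ 'n ^ 'n"
  assumes Q: "sym_pos_def Q" and J: "J \<noteq> {}"
  shows "0 < psi_min_on J (block J J Q)" "psi_min_on J (block J J Q) \<le> psi_max_on J (block J J Q)"
    and "\<And>u. restr J u = u \<Longrightarrow> u \<bullet> (block J J Q *v u) \<le> psi_max_on J (block J J Q) * (u \<bullet> u)"
    and "\<And>u. restr J u = u \<Longrightarrow> psi_min_on J (block J J Q) * (u \<bullet> u) \<le> u \<bullet> (block J J Q *v u)"
proof -
  define A where "A = block J J Q"
  have Qs: "x \<bullet> (Q *v y) = (Q *v x) \<bullet> y" for x y
    using Q by (intro inner_matrix_sym) (simp add: sym_pos_def_def)
  have A: "A *v x = restr J (Q *v restr J x)" for x by (simp add: A_def block_mult_vec)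
  have AJ: "i \<notin> J \<Longrightarrow> (A *v v) $ i = 0" for v i by (simp add: A)
  have sa: "(A *v u) \<bullet> (mat 1 *v v) = u \<bullet> (mat 1 *v (A *v v))" for u v
  proof -
    have "(A *v u) \<bullet> v = (Q *v restr J u) \<bullet> restr J v" "u \<bullet> (A *v v) = restr J u \<bullet> (Q *v restr J v)"
      by (simp_all add: A inner_restr)
    then show ?thesis using Qs[of "restr J u" "restr J v"] by simp
  qed
  have supp: "restr J u = u \<longleftrightarrow> (\<forall>i. i \<notin> J \<longrightarrow> u $ i = 0)" for u by (auto simp: vec_eq_iff)
  note bounds = eigenvalue_on_bounds[OF sym_pos_def_one J AJ sa, simplified]
  show *: "\<And>u. restr J u = u \<Longrightarrow> u \<bullet> (block J J Q *v u) \<le> psi_max_on J (block J J Q) * (u \<bullet> u)"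
    "\<And>u. restr J u = u \<Longrightarrow> psi_min_on J (block J J Q) * (u \<bullet> u) \<le> u \<bullet> (block J J Q *v u)"
    using bounds(1,2) unfolding supp A_def by blast+
  obtain j where j: "j \<in> J" using J by blast
  define x :: "real ^ 'n" where "x = axis j 1"
  have "restr J x = x" using j by (auto simp: x_def vec_eq_iff axis_def)
  moreover have "x \<bullet> x = 1" by (simp add: x_def inner_axis_axis)
  ultimately have xx: "restr J x = x" "x \<bullet> x = 1" .
  show "psi_min_on J (block J J Q) \<le> psi_max_on J (block J J Q)"
    using *(1)[OF xx(1)] *(2)[OF xx(1)] unfolding xx(2) by linarith
  have "eigenvalue_on J A (psi_min_on J A)" by (rule bounds(4)[of 0]) simp
  then obtain v where v: "v \<noteq> 0" "restr J v = v" "A *v v = psi_min_on J A *\<^sub>R v"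
    unfolding eigenvalue_on_def supp by blast
  have "0 < v \<bullet> (Q *v v)" using Q v(1) by (simp add: sym_pos_def_def)
  also have "v \<bullet> (Q *v v) = v \<bullet> (A *v v)" unfolding A inner_restr[symmetric] v(2) ..
  also have "\<dots> = psi_min_on J A * (v \<bullet> v)" unfolding v(3) by simp
  finally have "0 < psi_min_on J A * (v \<bullet> v)" .
  then show "0 < psi_min_on J (block J J Q)" unfolding A_def
    using inner_ge_zero[of v] by (simp add: zero_less_mult_iff)
qed

text \<open>Both sides are the squared Frobenius norm of \<open>A\<close>.\<close>
lemma trace_square:
  fixes A :: "real ^ 'n ^ 'n"
  assumes tA: "transpose A = A" and e: "orthonormal e" "\<And>i. A *v e i = a i *\<^sub>R e i"
  shows "trace (A ** A) = (\<Sum>i\<in>UNIV. (a i)\<^sup>2)"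
proof -
  have ee: "e i \<bullet> e k = (if i = k then 1 else 0)" for i k using e(1) by (simp add: orthonormal_def)
  have sym: "x \<bullet> (A *v y) = (A *v x) \<bullet> y" for x y by (rule inner_matrix_sym[OF tA])
  have "trace (A ** A) = (\<Sum>k\<in>UNIV. axis k 1 \<bullet> ((A ** A) *v axis k 1))"
    unfolding trace_def by (intro sum.cong refl) (simp add: matrix_vector_mult_basis column_def inner_axis')
  also have "\<dots> = (\<Sum>k\<in>UNIV. (A *v axis k 1) \<bullet> (A *v axis k 1))"
    by (simp add: sym matrix_vector_mul_assoc[symmetric])
  also have "\<dots> = (\<Sum>k\<in>UNIV. \<Sum>i\<in>UNIV. (e i \<bullet> (A *v axis k 1)) * (e i \<bullet> (A *v axis k 1)))"
    by (intro sum.cong refl orthonormal_parseval[OF e(1)])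
  also have "\<dots> = (\<Sum>i\<in>UNIV. \<Sum>k\<in>UNIV. (axis k 1 \<bullet> (A *v e i)) * (axis k 1 \<bullet> (A *v e i)))"
  proof -
    have "e i \<bullet> (A *v axis k 1) = axis k 1 \<bullet> (A *v e i)" for i k
      using sym[of "e i" "axis k 1"] by (simp only: inner_commute)
    then show ?thesis by (simp only:) (rule sum.swap)
  qed
  also have "\<dots> = (\<Sum>i\<in>UNIV. (A *v e i) \<bullet> (A *v e i))"
    by (intro sum.cong refl orthonormal_parseval[OF orthonormal_axis, symmetric])
  also have "\<dots> = (\<Sum>i\<in>UNIV. (a i)\<^sup>2)" by (simp add: e(2) ee power2_eq_square)
  finally show ?thesis .
qed

context eigenblock begin

text \<open>
  The right-hand side satisfies the three defining equations, and a second solution \<open>B'\<close> agrees with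
  it, because \<open>B' x = B' (A (B x)) = B x\<close> for \<open>x\<close> supported in \<open>J\<close>.
\<close>
lemma inverse_on_block:
  assumes e: "\<And>i. block J J Q *v e i = a i *\<^sub>R e i"
    and eJ: "\<And>i. 0 < a i \<Longrightarrow> restr J (e i) = e i" "\<And>i. a i = 0 \<Longrightarrow> restr J (e i) = 0"
  shows "inverse_on J (block J J Q) *v x = comb (\<lambda>i. (e i \<bullet> x) / a i)"
proof -
  define A where "A = block J J Q"
  define B where "B = matrix (\<lambda>x. comb (\<lambda>i. (e i \<bullet> x) / a i))"
  have lin: "linear (\<lambda>x. comb (\<lambda>i. (e i \<bullet> x) / a i))"
    by (rule linearI) (simp_all add: comb_add comb_scale inner_add_right add_divide_distrib)
  have B: "B *v x = comb (\<lambda>i. (e i \<bullet> x) / a i)" for x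
    unfolding B_def by (rule fun_cong[OF matrix_vector_mul(2)[OF lin]])
  have eI: "i \<in> I \<Longrightarrow> restr J (e i) = e i" for i by (simp add: eJ(1) I_def)
  have eR: "e i \<bullet> restr J x = (if i \<in> I then e i \<bullet> x else 0)" for i x
    using eJ[of i] a_nonneg[of i] unfolding inner_restr[symmetric] by (auto simp: I_def less_le)
  have A: "A *v x = restr J (Q *v restr J x)" for x by (simp add: A_def block_mult_vec)
  have mult_sum: "M *v comb c = (\<Sum>i\<in>I. c i *\<^sub>R (M *v e i))" for M :: "real ^ 'n ^ 'n" and c
    unfolding comb_def by (simp add: matrix_vector_mult_scaleR linear_sum[OF matrix_vector_mul_linear])
  have restr_idem: "restr J (restr J x) = restr J x" for x by (simp add: vec_eq_iff)
  have one: "block J J (mat 1) *v x = restr J x" for x by (simp add: block_mult_vec restr_idem)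
  have restr_comb: "restr J (comb c) = comb c" for c
    using mult_sum[of "block J J (mat 1)" c] eI unfolding one by (simp add: comb_def)
  have AB: "A *v (B *v x) = restr J x" for x
  proof -
    have "A *v (B *v x) = (\<Sum>i\<in>I. (e i \<bullet> restr J x) *\<^sub>R e i)"
      unfolding B mult_sum A_def e by (intro sum.cong refl) (simp add: eR I_def)
    also have "\<dots> = (\<Sum>i\<in>UNIV. (e i \<bullet> restr J x) *\<^sub>R e i)"
      by (rule sum.mono_neutral_left) (auto simp: eR)
    finally show ?thesis by (simp add: orthonormal_expansion[OF on])
  qed
  have sA: "e i \<bullet> (A *v x) = a i * (e i \<bullet> x)" if "i \<in> I" for i x
  proof -
    have "e i \<bullet> (A *v x) = restr J (e i) \<bullet> (Q *v restr J x)" by (simp add: A inner_restr)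
    also have "\<dots> = (Q *v restr J (e i)) \<bullet> restr J x" by (rule Q_sym)
    also have "\<dots> = (A *v e i) \<bullet> x" by (simp add: A inner_restr)
    finally show ?thesis using e[of i] by (simp add: A_def)
  qed
  have BA: "B *v (A *v x) = restr J x" for x
  proof -
    have "B *v (A *v x) = (\<Sum>i\<in>I. (e i \<bullet> restr J x) *\<^sub>R e i)"
      unfolding B comb_def by (intro sum.cong refl) (simp add: eR sA, simp add: I_def)
    also have "\<dots> = (\<Sum>i\<in>UNIV. (e i \<bullet> restr J x) *\<^sub>R e i)"
      by (rule sum.mono_neutral_left) (auto simp: eR)
    finally show ?thesis by (simp add: orthonormal_expansion[OF on])
  qed
  have BR: "B *v restr J x = B *v x" for x
    unfolding B by (rule comb_cong) (simp add: eR)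
  have "inverse_on J A = B" unfolding inverse_on_def
  proof (rule the_equality)
    show "block J J B = B \<and> A ** B = block J J (mat 1) \<and> B ** A = block J J (mat 1)"
    proof (intro conjI)
      have "block J J B *v x = B *v x" for x unfolding block_mult_vec BR unfolding B restr_comb ..
      then show "block J J B = B" by (simp add: matrix_eq)
      show "A ** B = block J J (mat 1)" "B ** A = block J J (mat 1)"
        by (simp_all add: matrix_eq matrix_vector_mul_assoc[symmetric] AB BA one)
    qed
    fix B' assume B': "block J J B' = B' \<and> A ** B' = block J J (mat 1) \<and> B' ** A = block J J (mat 1)"
    have "B' *v x = B *v x" for x
    proof -
      have B'A: "B' *v (A *v y) = restr J y" for y
        unfolding matrix_vector_mul_assoc using B' by (simp add: one)
      have "B' *v x = restr J (B' *v restr J x)" using B' block_mult_vec[of J B' x] by simp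
      also have "\<dots> = restr J (B' *v (A *v (B *v x)))" by (simp add: AB)
      also have "\<dots> = B *v x" unfolding B'A restr_idem unfolding B restr_comb ..
      finally show ?thesis .
    qed
    then show "B' = B" by (simp add: matrix_eq)
  qed
  then show ?thesis by (simp add: A_def B)
qed

lemma inner_comb_quotient: "x \<bullet> comb (\<lambda>i. (e i \<bullet> y) / a i) = (\<Sum>i\<in>I. (e i \<bullet> x) * (e i \<bullet> y) / a i)"
  by (simp add: comb_def inner_sum_right inner_commute[of x] mult.commute)

end

text \<open>
  Every \<open>a i\<close> in the block lies between the extreme eigenvalues of the block, and the trace of its
  square is the sum of the squares. Positivity of that trace is needed to read the bound on \<open>h\<^sup>2\<close>
  without division by zero.
\<close>
lemma mala_block_exists:
  fixes Q :: "real ^ 'n ^ 'n"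
  assumes Q: "sym_pos_def Q" and J: "J \<noteq> {}" and h: "0 < h"
    and h_max: "h \<le> 1 / (2 * psi_max_on J (block J J Q))"
    and h_tr: "h\<^sup>2 \<le> 1 / (10 * trace (block J J Q ** block J J Q))"
  shows "\<exists>e a. mala_block Q e a h (h * psi_min_on J (block J J Q)) J \<and> (\<forall>i. block J J Q *v e i = a i *\<^sub>R e i)"
    and "0 < h * psi_min_on J (block J J Q)" "h * psi_min_on J (block J J Q) \<le> 1 / 2"
proof -
  define A where "A = block J J Q"
  define m M where "m = psi_min_on J A" and "M = psi_max_on J A"
  note ev = eigenvalues_pos_def[OF Q J, folded A_def, folded m_def M_def]
  have M: "0 < M" using ev(1,2) by linarith
  have hM: "h * M \<le> 1 / 2" using h_max M by (simp add: A_def[symmetric] M_def[symmetric] field_simps)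
  show hm: "0 < h * psi_min_on J (block J J Q)" "h * psi_min_on J (block J J Q) \<le> 1 / 2"
    unfolding A_def[symmetric] m_def[symmetric] using mult_pos_pos[OF h ev(1)] mult_left_mono[OF ev(2) less_imp_le[OF h]] hM by linarith+
  obtain e a where eb: "eigenblock Q e a" and e: "\<And>i. A *v e i = a i *\<^sub>R e i"
    and eJ: "\<And>i. 0 < a i \<Longrightarrow> restr J (e i) = e i" "\<And>i. a i = 0 \<Longrightarrow> restr J (e i) = 0"
    using block_eigenbasis[OF Q, of J] unfolding A_def by blast
  interpret eigenblock 0 Q e a by (rule eb)
  have ee: "e i \<bullet> e i = 1" for i using on by (simp add: orthonormal_def)
  have I: "i \<in> I \<longleftrightarrow> 0 < a i" for i by (simp add: I_def)
  have aM: "a i \<le> M" "m \<le> a i" if "i \<in> I" for i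
    using ev(3)[of "e i"] ev(4)[of "e i"] eJ(1)[of i] that unfolding e I by (simp_all add: ee)
  have Qt: "transpose Q = Q" using Q by (simp add: sym_pos_def_def)
  then have "Q $ i $ k = Q $ k $ i" for i k by (metis transpose_def vec_lambda_beta)
  then have tA: "transpose A = A" by (auto simp: A_def block_def transpose_def vec_eq_iff)
  have tr: "trace (A ** A) = (\<Sum>i\<in>UNIV. (a i)\<^sup>2)" by (rule trace_square[OF tA on e])
  have tr0: "0 < trace (A ** A)"
  proof -
    have "trace (A ** A) \<noteq> 0"
    proof
      assume "trace (A ** A) = 0"
      then have "a i = 0" for i unfolding tr by (simp add: sum_nonneg_eq_0_iff)
      then have "restr J (e i) = 0" for i by (rule eJ(2))
      then have "e i \<bullet> restr J x = 0" for i x unfolding inner_restr[symmetric] by simp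
      then have "restr J x = 0" for x using orthonormal_expansion[OF on, of "restr J x"] by simp
      then have z: "restr J (axis j 1 :: real ^ 'n) $ j = 0" for j by simp
      obtain j where "j \<in> J" using J by blast
      then show False using z[of j] by (simp add: axis_def)
    qed
    moreover have "0 \<le> trace (A ** A)" unfolding tr by (rule sum_nonneg) simp
    ultimately show ?thesis by simp
  qed
  have "mala_block Q e a h (h * m) J"
  proof
    show "0 < h" by (rule h)
    show "h * a i \<le> 1 / 2" if "i \<in> I" for i using mult_left_mono[OF aM(1)[OF that] less_imp_le[OF h]] hM by linarith
    show "(\<Sum>i\<in>I. (h * a i)\<^sup>2) \<le> 1 / 10"
    proof -
      have "(\<Sum>i\<in>I. (h * a i)\<^sup>2) \<le> (\<Sum>i\<in>UNIV. (h * a i)\<^sup>2)" by (rule sum_mono2) auto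
      also have "\<dots> = h\<^sup>2 * trace (A ** A)" by (simp add: tr power_mult_distrib sum_distrib_left)
      also have "\<dots> \<le> 1 / 10" using h_tr tr0 by (simp add: A_def[symmetric] field_simps)
      finally show ?thesis .
    qed
    show "0 < h * m" "h * m \<le> 1" using hm by (simp_all add: m_def A_def)
    show "h * m \<le> h * a i" if "i \<in> I" for i using aM(2)[OF that] h by simp
    show "0 < a i \<Longrightarrow> restr J (e i) = e i" "a i = 0 \<Longrightarrow> restr J (e i) = 0" for i by (rule eJ; assumption)+
  qed
  then show "\<exists>e a. mala_block Q e a h (h * psi_min_on J (block J J Q)) J \<and> (\<forall>i. block J J Q *v e i = a i *\<^sub>R e i)"
    using e by (auto simp: m_def A_def)
qed

text \<open>
  The matrix \<open>I - DQ\<close> is selfadjoint for the inner product of \<open>Q\<close>, so its largest eigenvalue is the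
  maximal Rayleigh quotient \<open>1 - (Q v \<bullet> D Q v) / (v \<bullet> Q v)\<close>.
\<close>
lemma preconditioned_gap:
  fixes Q D :: "real ^ 'n ^ 'n"
  assumes Q: "sym_pos_def Q" and D_sym: "\<And>u v. (D *v u) \<bullet> v = u \<bullet> (D *v v)" and D_nonneg: "\<And>u. 0 \<le> u \<bullet> (D *v u)"
  defines "\<psi> \<equiv> 1 - psi_max_on UNIV (mat 1 - D ** Q)"
  shows "0 \<le> \<psi>" "\<psi> * (v \<bullet> (Q *v v)) \<le> (Q *v v) \<bullet> (D *v (Q *v v))"
proof -
  define A where "A = mat 1 - D ** Q"
  have Qs: "x \<bullet> (Q *v y) = (Q *v x) \<bullet> y" for x y
    using Q by (intro inner_matrix_sym) (simp add: sym_pos_def_def)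
  have A: "A *v v = v - D *v (Q *v v)" for v
    by (simp add: A_def matrix_vector_mult_diff_rdistrib matrix_vector_mul_assoc)
  have sa: "(A *v u) \<bullet> (Q *v v) = u \<bullet> (Q *v (A *v v))" for u v
  proof -
    have "(A *v u) \<bullet> (Q *v v) = u \<bullet> (Q *v v) - (D *v (Q *v u)) \<bullet> (Q *v v)"
      "u \<bullet> (Q *v (A *v v)) = u \<bullet> (Q *v v) - u \<bullet> (Q *v (D *v (Q *v v)))"
      by (simp_all only: A inner_diff_left inner_diff_right matrix_vector_mult_diff_distrib)
    then show ?thesis using D_sym[of "Q *v u" "Q *v v"] Qs[of u "D *v (Q *v v)"] by simp
  qed
  note bounds = eigenvalue_on_bounds[OF Q UNIV_not_empty _ sa, simplified]
  have "v \<bullet> (Q *v (A *v v)) \<le> psi_max_on UNIV A * (v \<bullet> (Q *v v))" by (rule bounds(1))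
  moreover have "v \<bullet> (Q *v (A *v v)) = v \<bullet> (Q *v v) - (Q *v v) \<bullet> (D *v (Q *v v))"
    by (simp add: A matrix_vector_mult_diff_distrib inner_diff_right Qs)
  ultimately show "\<psi> * (v \<bullet> (Q *v v)) \<le> (Q *v v) \<bullet> (D *v (Q *v v))"
    by (simp add: \<psi>_def A_def[symmetric] left_diff_distrib)
  have "eigenvalue_on UNIV A (psi_max_on UNIV A)" by (rule bounds(3))
  then obtain u where u: "u \<noteq> 0" "A *v u = psi_max_on UNIV A *\<^sub>R u" unfolding eigenvalue_on_def by blast
  have "D *v (Q *v u) = u - A *v u" by (simp add: A)
  also have "\<dots> = \<psi> *\<^sub>R u" unfolding u(2) by (simp add: \<psi>_def A_def[symmetric] scaleR_left_diff_distrib)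
  finally have "D *v (Q *v u) = \<psi> *\<^sub>R u" .
  then have "(Q *v u) \<bullet> (D *v (Q *v u)) = \<psi> * (u \<bullet> (Q *v u))"
    by (simp only: inner_scaleR_right inner_commute[of "Q *v u" u])
  moreover have "0 < u \<bullet> (Q *v u)" using Q u(1) by (simp add: sym_pos_def_def)
  ultimately show "0 \<le> \<psi>" using D_nonneg[of "Q *v u"] by (simp add: zero_le_mult_iff)
qed

section \<open>Scans and operator norms\<close>

lemma bounded_borel_kernel_op:
  fixes f :: "'a::polish_space \<Rightarrow> real"
  assumes P: "P \<in> borel \<rightarrow>\<^sub>M prob_algebra borel" and f: "bounded_borel f"
  shows "bounded_borel (kernel_op P f)"
proof -
  obtain B where B: "\<And>x. \<bar>f x\<bar> \<le> B" using f unfolding bounded_borel_def by blast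
  note fm [measurable] = bounded_borel_measurable[OF f]
  show ?thesis
  proof (rule bounded_borelI)
    show "kernel_op P f \<in> borel_measurable borel"
      using measurable_compose[OF measurable_prob_algebraD[OF P] integral_measurable_subprob_algebra[OF fm]]
      unfolding kernel_op_def[abs_def] .
    fix x
    have "P x \<in> space (prob_algebra borel)" using measurable_space[OF P, of x] by simp
    then have ps: "prob_space (P x)" and sets: "sets (P x) = sets borel" by (auto simp: space_prob_algebra)
    interpret prob_space "P x" by (rule ps)
    have fP: "f \<in> borel_measurable (P x)" using fm by (simp cong: measurable_cong_sets add: sets)
    have "\<bar>kernel_op P f x\<bar> \<le> (\<integral>y. \<bar>f y\<bar> \<partial>P x)" unfolding kernel_op_def by (rule integral_abs_bound)
    also have "\<dots> \<le> (\<integral>y. B \<partial>P x)"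
      by (rule Bochner_Integration.integral_mono) (use fP B in \<open>auto intro!: integrable_const_bound[where B = B]\<close>)
    finally show "\<bar>kernel_op P f x\<bar> \<le> B" by (simp add: prob_space)
  qed
qed

lemma measurable_scan_kernel:
  assumes "\<And>j. j \<in> {1..n} \<Longrightarrow> K j \<in> borel \<rightarrow>\<^sub>M prob_algebra borel"
  shows "scan_kernel K n \<in> borel \<rightarrow>\<^sub>M prob_algebra borel"
  using assms
proof (induction n)
  case 0
  have "scan_kernel K 0 = return borel" by (rule ext) simp
  then show ?case by simp
next
  case (Suc n)
  have "scan_kernel K (Suc n) = (\<lambda>x. bind (K (Suc n) x) (scan_kernel K n))" by (rule ext) simp
  moreover have "scan_kernel K n \<in> borel \<rightarrow>\<^sub>M prob_algebra borel" using Suc by simp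
  ultimately show ?case using Suc.prems[of "Suc n"] by (simp add: measurable_bind_prob_space)
qed

lemma kernel_op_scan_0:
  assumes f: "bounded_borel f" shows "kernel_op (scan_kernel K 0) f = f"
  using bounded_borel_measurable[OF f] by (simp add: fun_eq_iff kernel_op_def integral_return)

text \<open>The kernel of update \<open>Suc n\<close> is applied to the state first, hence its operator comes last.\<close>
lemma kernel_op_scan_Suc:
  fixes f :: "'a::polish_space \<Rightarrow> real"
  assumes K: "K (Suc n) \<in> borel \<rightarrow>\<^sub>M prob_algebra borel" and S: "scan_kernel K n \<in> borel \<rightarrow>\<^sub>M prob_algebra borel"
    and f: "bounded_borel f"
  shows "kernel_op (scan_kernel K (Suc n)) f = kernel_op (K (Suc n)) (kernel_op (scan_kernel K n) f)"
proof
  fix x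
  obtain B where B: "\<And>x. \<bar>f x\<bar> \<le> B" using f unfolding bounded_borel_def by blast
  have Kx: "prob_space (K (Suc n) x)" "sets (K (Suc n) x) = sets borel"
    using measurable_space[OF K, of x] by (simp_all add: space_prob_algebra)
  have "(\<integral>y. f y \<partial>bind (K (Suc n) x) (scan_kernel K n)) = (\<integral>z. (\<integral>y. f y \<partial>scan_kernel K n z) \<partial>K (Suc n) x)"
  proof (rule integral_bind[OF bounded_borel_measurable[OF f]])
    show "scan_kernel K n \<in> K (Suc n) x \<rightarrow>\<^sub>M subprob_algebra borel"
      using measurable_prob_algebraD[OF S] by (simp cong: measurable_cong_sets add: Kx(2))
    show "finite_measure (K (Suc n) x)" by (rule prob_space.finite_measure[OF Kx(1)])
    have "prob_space (scan_kernel K n z)" for z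
      using measurable_space[OF S, of z] by (simp add: space_prob_algebra)
    then show "AE z in K (Suc n) x. emeasure (scan_kernel K n z) (space (scan_kernel K n z)) \<le> ennreal 1"
      by (intro AE_I2) (simp only: prob_space.emeasure_space_1 ennreal_1)
  qed (rule B)
  then show "kernel_op (scan_kernel K (Suc n)) f x = kernel_op (K (Suc n)) (kernel_op (scan_kernel K n) f) x"
    by (simp add: kernel_op_def)
qed

text \<open>
  For \<open>f\<close> in \<open>L\<^sup>2\<close> the truncations \<open>fn n\<close> converge to \<open>f\<close>. Since \<open>M\<close> is invariant, \<open>f\<close> is integrable for
  almost every measure \<open>P x\<close>, so the images of the truncations converge almost everywhere by dominated
  convergence. Fatou's lemma then transfers the bound.
\<close>
lemma L2_op_norm_kernel_le:
  fixes M :: "'a::polish_space measure"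
  assumes M: "prob_space M" and sets_M: "sets M = sets borel"
    and P: "P \<in> borel \<rightarrow>\<^sub>M prob_algebra borel"
    and inv: "\<And>f. bounded_borel f \<Longrightarrow> (\<integral>x. kernel_op P f x \<partial>M) = (\<integral>x. f x \<partial>M)"
    and c: "0 \<le> c"
    and bound: "\<And>f. bounded_borel f \<Longrightarrow> (\<integral>x. (kernel_op P f x - (\<integral>y. f y \<partial>M))\<^sup>2 \<partial>M) \<le> c\<^sup>2 * (\<integral>x. (f x)\<^sup>2 \<partial>M)"
  shows "L2_op_norm M (\<lambda>f x. kernel_op P f x - mean_op M f x) \<le> ereal c"
proof -
  interpret M: prob_space M by (rule M)
  note [measurable_cong] = sets_M
  have Px: "prob_space (P x)" "sets (P x) = sets borel" for x
    using measurable_space[OF P, of x] by (simp_all add: space_prob_algebra)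
  have PM: "P \<in> M \<rightarrow>\<^sub>M subprob_algebra borel"
    using measurable_prob_algebraD[OF P] by (simp cong: measurable_cong_sets add: sets_M)
  have spaceM: "space M = UNIV" using sets_eq_imp_space_eq[OF sets_M] by simp
  have int_b: "integrable M f" if f: "bounded_borel f" for f
  proof -
    obtain B where B: "\<And>x. \<bar>f x\<bar> \<le> B" using f unfolding bounded_borel_def by blast
    show ?thesis using bounded_borel_measurable[OF f] B
      by (intro M.integrable_const_bound[where B = B]) (auto cong: measurable_cong_sets simp: sets_M)
  qed
  have bind: "bind M P = M"
  proof (rule measure_eqI)
    show sb: "sets (bind M P) = sets M" using sets_bind[OF Px(2), of M] spaceM sets_M by simp
    fix A assume "A \<in> sets (bind M P)"
    then have A [measurable]: "A \<in> sets borel" using sb sets_M by simp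
    have ind: "bounded_borel (indicator A :: 'a \<Rightarrow> real)"
      by (rule bounded_borelI[where B = 1]) (auto simp: indicator_def)
    have kop: "kernel_op P (indicator A) x = measure (P x) A" for x
      unfolding kernel_op_def using A Px(2) by (simp add: sets_eq_imp_space_eq[OF Px(2)])
    have "emeasure (bind M P) A = (\<integral>\<^sup>+x. emeasure (P x) A \<partial>M)"
      by (rule emeasure_bind[OF M.not_empty PM A])
    also have "\<dots> = (\<integral>\<^sup>+x. ennreal (kernel_op P (indicator A) x) \<partial>M)"
    proof (rule nn_integral_cong)
      fix x
      interpret Px: prob_space "P x" by (rule Px)
      show "emeasure (P x) A = ennreal (kernel_op P (indicator A) x)" by (simp add: kop Px.emeasure_eq_measure)
    qed
    also have "\<dots> = ennreal (\<integral>x. kernel_op P (indicator A) x \<partial>M)"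
      by (rule nn_integral_eq_integral[OF int_b[OF bounded_borel_kernel_op[OF P ind]]]) (simp add: kop)
    also have "\<dots> = emeasure M A"
      unfolding inv[OF ind] using A sets_M by (simp add: M.emeasure_eq_measure spaceM)
    finally show "emeasure (bind M P) A = emeasure M A" .
  qed
  show ?thesis unfolding L2_op_norm_def
  proof (rule SUP_least)
    fix f assume "f \<in> {f \<in> L2 M. L2_norm M f \<le> 1}"
    then have fM [measurable]: "f \<in> borel_measurable M" and f2: "integrable M (\<lambda>x. (f x)\<^sup>2)" and le1: "(\<integral>x. (f x)\<^sup>2 \<partial>M) \<le> 1"
      by (auto simp: L2_def L2_norm_def split: if_split_asm)
    have fb [measurable]: "f \<in> borel_measurable borel" using fM by (simp cong: measurable_cong_sets add: sets_M)
    have f1: "integrable M f"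
    proof (rule Bochner_Integration.integrable_bound[where f = "\<lambda>x. 1 + (f x)\<^sup>2"])
      show "AE x in M. norm (f x) \<le> norm (1 + (f x)\<^sup>2)"
      proof (rule AE_I2)
        fix x
        have "0 \<le> (\<bar>f x\<bar> - 1)\<^sup>2" by simp
        then have "2 * \<bar>f x\<bar> \<le> 1 + (f x)\<^sup>2" by (simp add: power2_diff)
        then show "norm (f x) \<le> norm (1 + (f x)\<^sup>2)" by simp
      qed
    qed (use f2 in auto)
    define fn where "fn n x = max (- real n) (min (real n) (f x))" for n x
    have bfn: "bounded_borel (fn n)" for n
    proof (rule bounded_borelI)
      show "fn n \<in> borel_measurable borel" unfolding fn_def by measurable
      show "\<bar>fn n x\<bar> \<le> real n" for x unfolding fn_def by linarith
    qed
    note fnm [measurable] = bounded_borel_measurable[OF bfn]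
    have fn_le: "\<bar>fn n x\<bar> \<le> \<bar>f x\<bar>" for n x unfolding fn_def by linarith
    have fn_lim: "(\<lambda>n. fn n x) \<longlonglongrightarrow> f x" for x
    proof (rule tendsto_eventually)
      have "eventually (\<lambda>n. real n \<ge> \<bar>f x\<bar>) sequentially"
        using eventually_ge_at_top[of "nat \<lceil>\<bar>f x\<bar>\<rceil>"] by eventually_elim linarith
      then show "eventually (\<lambda>n. fn n x = f x) sequentially"
        by eventually_elim (simp add: fn_def)
    qed
    have int_P: "AE x in M. integrable (P x) f"
    proof -
      have m: "(\<lambda>x. \<integral>\<^sup>+y. ennreal \<bar>f y\<bar> \<partial>P x) \<in> borel_measurable M"
        by (rule measurable_compose[OF PM nn_integral_measurable_subprob_algebra]) measurable
      have "(\<integral>\<^sup>+x. \<integral>\<^sup>+y. ennreal \<bar>f y\<bar> \<partial>P x \<partial>M) = (\<integral>\<^sup>+y. ennreal \<bar>f y\<bar> \<partial>bind M P)"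
        by (rule nn_integral_bind[symmetric, OF _ PM]) measurable
      also have "\<dots> \<noteq> \<infinity>" unfolding bind using f1 by (auto simp: integrable_iff_bounded)
      finally have "AE x in M. (\<integral>\<^sup>+y. ennreal \<bar>f y\<bar> \<partial>P x) \<noteq> \<infinity>" by (rule nn_integral_PInf_AE[OF m])
      then show ?thesis
      proof (rule AE_mp, intro AE_I2 impI)
        fix x assume "(\<integral>\<^sup>+y. ennreal \<bar>f y\<bar> \<partial>P x) \<noteq> \<infinity>"
        then show "integrable (P x) f"
          using fb by (intro integrableI_bounded) (auto cong: measurable_cong_sets simp: Px(2) less_top)
      qed
    qed
    define Tn where "Tn n x = kernel_op P (fn n) x - (\<integral>y. fn n y \<partial>M)" for n x
    define T where "T x = kernel_op P f x - mean_op M f x" for x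
    have bTn: "bounded_borel (Tn n)" for n
      unfolding Tn_def by (intro bounded_borel_diff bounded_borel_kernel_op[OF P bfn] bounded_borel_const)
    have Tn_m [measurable]: "Tn n \<in> borel_measurable M" for n
      using bounded_borel_measurable[OF bTn[of n]] by (simp cong: measurable_cong_sets add: sets_M)
    have "kernel_op P f \<in> borel_measurable borel"
      using measurable_compose[OF measurable_prob_algebraD[OF P] integral_measurable_subprob_algebra[OF fb]]
      unfolding kernel_op_def[abs_def] .
    then have [measurable]: "kernel_op P f \<in> borel_measurable M" by (simp cong: measurable_cong_sets add: sets_M)
    have Tm [measurable]: "T \<in> borel_measurable M" unfolding T_def mean_op_def by measurable
    have lim_mean: "(\<lambda>n. \<integral>y. fn n y \<partial>M) \<longlonglongrightarrow> (\<integral>y. f y \<partial>M)"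
      by (rule integral_dominated_convergence[where w = "\<lambda>y. \<bar>f y\<bar>"]) (use f1 fn_lim fn_le in auto)
    have lim_T: "AE x in M. (\<lambda>n. Tn n x) \<longlonglongrightarrow> T x"
      using int_P
    proof (rule AE_mp, intro AE_I2 impI)
      fix x assume i: "integrable (P x) f"
      have "(\<lambda>n. \<integral>y. fn n y \<partial>P x) \<longlonglongrightarrow> (\<integral>y. f y \<partial>P x)"
      proof (rule integral_dominated_convergence[where w = "\<lambda>y. \<bar>f y\<bar>"])
        show "fn n \<in> borel_measurable (P x)" for n using fnm[of n] by (simp cong: measurable_cong_sets add: Px(2))
        show "integrable (P x) (\<lambda>y. \<bar>f y\<bar>)" using i by (rule integrable_abs)
      qed (use fn_lim fn_le i in auto)
      then show "(\<lambda>n. Tn n x) \<longlonglongrightarrow> T x"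
        unfolding Tn_def T_def kernel_op_def mean_op_def by (rule tendsto_diff[OF _ lim_mean])
    qed
    define C where "C = c\<^sup>2 * (\<integral>x. (f x)\<^sup>2 \<partial>M)"
    have C0: "0 \<le> C" by (simp add: C_def)
    have each: "(\<integral>\<^sup>+x. ennreal ((Tn n x)\<^sup>2) \<partial>M) \<le> ennreal C" for n
    proof -
      have "(\<integral>\<^sup>+x. ennreal ((Tn n x)\<^sup>2) \<partial>M) = ennreal (\<integral>x. (Tn n x)\<^sup>2 \<partial>M)"
        by (rule nn_integral_eq_integral[OF int_b[OF bounded_borel_power2[OF bTn]]]) simp
      also have "(\<integral>x. (Tn n x)\<^sup>2 \<partial>M) \<le> c\<^sup>2 * (\<integral>x. (fn n x)\<^sup>2 \<partial>M)" unfolding Tn_def by (rule bound[OF bfn])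
      also have "\<dots> \<le> C" unfolding C_def
      proof (rule mult_left_mono)
        show "(\<integral>x. (fn n x)\<^sup>2 \<partial>M) \<le> (\<integral>x. (f x)\<^sup>2 \<partial>M)"
          by (rule Bochner_Integration.integral_mono[OF int_b[OF bounded_borel_power2[OF bfn]] f2]) (use fn_le in \<open>simp add: abs_le_square_iff[symmetric]\<close>)
      qed simp
      finally show ?thesis by (simp add: ennreal_leI)
    qed
    have "(\<integral>\<^sup>+x. ennreal ((T x)\<^sup>2) \<partial>M) = (\<integral>\<^sup>+x. liminf (\<lambda>n. ennreal ((Tn n x)\<^sup>2)) \<partial>M)"
    proof (rule nn_integral_cong_AE, use lim_T in eventually_elim)
      fix x assume "(\<lambda>n. Tn n x) \<longlonglongrightarrow> T x"
      then have "(\<lambda>n. ennreal ((Tn n x)\<^sup>2)) \<longlonglongrightarrow> ennreal ((T x)\<^sup>2)" by (intro tendsto_ennrealI tendsto_power)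
      then show "ennreal ((T x)\<^sup>2) = liminf (\<lambda>n. ennreal ((Tn n x)\<^sup>2))"
        by (intro lim_imp_Liminf[symmetric]) auto
    qed
    also have "\<dots> \<le> liminf (\<lambda>n. \<integral>\<^sup>+x. ennreal ((Tn n x)\<^sup>2) \<partial>M)" by (rule nn_integral_liminf) measurable
    also have "\<dots> \<le> ennreal C"
      by (rule order_trans[OF Liminf_le_Limsup Limsup_bounded]) (use each in auto)
    finally have nnT: "(\<integral>\<^sup>+x. ennreal ((T x)\<^sup>2) \<partial>M) \<le> ennreal C" .
    have intT: "integrable M (\<lambda>x. (T x)\<^sup>2)"
    proof (rule integrableI_bounded)
      show "(\<integral>\<^sup>+x. ennreal (norm ((T x)\<^sup>2)) \<partial>M) < \<infinity>" using nnT ennreal_less_top[of C] by (auto intro: le_less_trans)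
    qed measurable
    have "(\<integral>x. (T x)\<^sup>2 \<partial>M) \<le> C"
      using nnT C0 unfolding nn_integral_eq_integral[OF intT AE_I2[OF zero_le_power2]] by (simp add: ennreal_le_iff)
    also have "\<dots> \<le> c\<^sup>2" unfolding C_def using le1 by (simp add: mult_left_le)
    finally have "sqrt (\<integral>x. (T x)\<^sup>2 \<partial>M) \<le> c" using c by (rule real_le_lsqrt[rotated])
    then have "L2_norm M T \<le> ereal c" using intT by (simp add: L2_norm_def L2_def)
    then show "L2_norm M (\<lambda>x. kernel_op P f x - mean_op M f x) \<le> ereal c" unfolding T_def .
  qed
qed

section \<open>The deterministic scan\<close>

text \<open>
  With \<open>N\<^sub>n = \<parallel>F\<^sub>n - P F\<^sub>n\<parallel>\<close>, where \<open>P\<close> is the projection of the block updated next, the step from \<open>F\<^sub>n\<close> to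
  \<open>F\<^sub>n\<^sub>+\<^sub>1\<close> has length at most \<open>2 N\<^sub>n\<close>. So \<open>\<parallel>F\<^sub>0 - P F\<^sub>0\<parallel>\<close> is at most \<open>2 \<Sum> N\<^sub>k\<close> for each block, while the
  total loss is at least \<open>\<kappa> \<Sum> N\<^sub>k\<^sup>2\<close>; the factor \<open>d\<^sup>2\<close> comes from Cauchy--Schwarz and from summing over the
  blocks.
\<close>
lemma (in borel_prob) cyclic_scan_gap:
  fixes P K :: "nat \<Rightarrow> ('a \<Rightarrow> real) \<Rightarrow> 'a \<Rightarrow> real" and F :: "nat \<Rightarrow> 'a \<Rightarrow> real" and \<kappa> \<psi> :: real
  assumes d: "0 < d" and \<kappa>: "0 < \<kappa>"
    and bP: "\<And>j f. j \<in> {1..d} \<Longrightarrow> bounded_borel f \<Longrightarrow> bounded_borel (P j f)"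
    and bK: "\<And>j f. j \<in> {1..d} \<Longrightarrow> bounded_borel f \<Longrightarrow> bounded_borel (K j f)"
    and P_diff: "\<And>j f g. j \<in> {1..d} \<Longrightarrow> bounded_borel f \<Longrightarrow> bounded_borel g \<Longrightarrow> P j (\<lambda>x. f x - g x) = (\<lambda>x. P j f x - P j g x)"
    and K_diff: "\<And>j f g. j \<in> {1..d} \<Longrightarrow> bounded_borel f \<Longrightarrow> bounded_borel g \<Longrightarrow> K j (\<lambda>x. f x - g x) = (\<lambda>x. K j f x - K j g x)"
    and KP: "\<And>j f. j \<in> {1..d} \<Longrightarrow> bounded_borel f \<Longrightarrow> K j (P j f) = P j f"
    and P_orth: "\<And>j f. j \<in> {1..d} \<Longrightarrow> bounded_borel f \<Longrightarrow> ip (\<lambda>x. f x - P j f x) (P j f) = 0"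
    and gap: "\<And>j f. j \<in> {1..d} \<Longrightarrow> bounded_borel f \<Longrightarrow>
        \<kappa> * ip (\<lambda>x. f x - P j f x) (\<lambda>x. f x - P j f x) \<le> ip f f - ip (K j f) (K j f)"
    and F0: "bounded_borel (F 0)" and F: "\<And>n. n < d \<Longrightarrow> F (Suc n) = K (Suc n) (F n)"
    and \<psi>: "\<psi> / 2 * ip (F 0) (F 0) \<le> (\<Sum>j\<in>{1..d}. ip (\<lambda>x. F 0 x - P j (F 0) x) (\<lambda>x. F 0 x - P j (F 0) x))"
  shows "ip (F d) (F d) \<le> (1 - \<kappa> * \<psi> / (8 * (real d)\<^sup>2)) * ip (F 0) (F 0)"
proof -
  have bF: "bounded_borel (F n)" if "n \<le> d" for n
    using that by (induction n) (auto simp: F0 F intro!: bK)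
  have P_le: "nm (\<lambda>x. f x - P j f x) \<le> nm f" if j: "j \<in> {1..d}" and f: "bounded_borel f" for j f
  proof -
    define g where "g = (\<lambda>x. f x - P j f x)"
    have bg: "bounded_borel g" unfolding g_def by (rule bounded_borel_diff[OF f bP[OF j f]])
    have "(\<lambda>x. f x - P j f x) = g" by (simp add: g_def)
    have "ip f f = ip (\<lambda>x. g x + P j f x) (\<lambda>x. g x + P j f x)" by (simp add: g_def)
    also have "\<dots> = ip g g + 2 * ip g (P j f) + ip (P j f) (P j f)"
      using ip_commute[of "P j f" g] by (simp add: ip_add_left ip_add_right bg bP[OF j f] bounded_borel_add)
    also have "\<dots> \<ge> ip g g" using P_orth[OF j f] by (simp add: g_def)
    finally show ?thesis by (simp add: nm_def g_def)
  qed
  have step: "nm (\<lambda>x. f x - K j f x) \<le> 2 * nm (\<lambda>x. f x - P j f x)" if j: "j \<in> {1..d}" and f: "bounded_borel f" for j f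
  proof -
    define g where "g = (\<lambda>x. f x - P j f x)"
    have bg: "bounded_borel g" unfolding g_def by (rule bounded_borel_diff[OF f bP[OF j f]])
    have Kg: "K j g = (\<lambda>x. K j f x - P j f x)"
      unfolding g_def K_diff[OF j f bP[OF j f]] KP[OF j f] ..
    have "0 \<le> \<kappa> * ip (\<lambda>x. g x - P j g x) (\<lambda>x. g x - P j g x)" using \<kappa> by simp
    then have "ip (K j g) (K j g) \<le> ip g g" using gap[OF j bg] by linarith
    then have Kg_le: "nm (K j g) \<le> nm g" by (simp add: nm_def)
    have "nm (\<lambda>x. f x - K j f x) = nm (\<lambda>x. g x - K j g x)" by (simp add: Kg) (simp add: g_def)
    also have "\<dots> \<le> nm (\<lambda>x. g x - 0) + nm (\<lambda>x. 0 - K j g x)"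
      by (rule nm_triangle_diff[OF bg bounded_borel_const bK[OF j bg]])
    also have "\<dots> = nm g + nm (K j g)" using nm_diff_commute[of "\<lambda>_. 0" "K j g"] by simp
    finally show ?thesis using Kg_le by (simp add: g_def)
  qed
  define N where "N n = nm (\<lambda>x. F n x - P (Suc n) (F n) x)" for n
  have N0: "0 \<le> N n" for n by (simp add: N_def)
  have F_close: "nm (\<lambda>x. F 0 x - F n x) \<le> 2 * (\<Sum>k<n. N k)" if "n \<le> d" for n
    using that
  proof (induction n)
    case 0 show ?case by (simp add: nm_def ip_def)
  next
    case (Suc n)
    have "nm (\<lambda>x. F 0 x - F (Suc n) x) \<le> nm (\<lambda>x. F 0 x - F n x) + nm (\<lambda>x. F n x - F (Suc n) x)"
      using Suc.prems by (intro nm_triangle_diff bF) auto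
    also have "nm (\<lambda>x. F n x - F (Suc n) x) \<le> 2 * N n"
      unfolding N_def using F[of n] step[of "Suc n" "F n"] bF[of n] Suc.prems by simp
    finally show ?case using Suc by simp
  qed
  have loc: "nm (\<lambda>x. F 0 x - P (Suc n) (F 0) x) \<le> 2 * (\<Sum>k<d. N k)" if n: "n < d" for n
  proof -
    have j: "Suc n \<in> {1..d}" using n by simp
    have bn: "bounded_borel (F n)" using n by (intro bF) simp
    have bu: "bounded_borel (\<lambda>x. F 0 x - F n x)" by (rule bounded_borel_diff[OF F0 bn])
    have eq: "(\<lambda>x. F 0 x - P (Suc n) (F 0) x)
      = (\<lambda>x. ((F 0 x - F n x) - P (Suc n) (\<lambda>x. F 0 x - F n x) x) + (F n x - P (Suc n) (F n) x))"
      unfolding P_diff[OF j F0 bn] by (rule ext) simp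
    have "nm (\<lambda>x. F 0 x - P (Suc n) (F 0) x)
       \<le> nm (\<lambda>x. (F 0 x - F n x) - P (Suc n) (\<lambda>x. F 0 x - F n x) x) + N n"
      unfolding N_def by (subst eq, rule nm_triangle) (intro bounded_borel_diff F0 bn bP[OF j])+
    also have "nm (\<lambda>x. (F 0 x - F n x) - P (Suc n) (\<lambda>x. F 0 x - F n x) x) \<le> nm (\<lambda>x. F 0 x - F n x)"
      by (rule P_le[OF j bu])
    also have "nm (\<lambda>x. F 0 x - F n x) \<le> 2 * (\<Sum>k<n. N k)" using n by (intro F_close) simp
    finally have "nm (\<lambda>x. F 0 x - P (Suc n) (F 0) x) \<le> 2 * (\<Sum>k<Suc n. N k)" using N0[of n] by simp
    also have "\<dots> \<le> 2 * (\<Sum>k<d. N k)" using n N0 by (intro mult_left_mono sum_mono2) auto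
    finally show ?thesis .
  qed
  define \<Delta> where "\<Delta> = ip (F 0) (F 0) - ip (F d) (F d)"
  have tele: "\<kappa> * (\<Sum>k<n. (N k)\<^sup>2) \<le> ip (F 0) (F 0) - ip (F n) (F n)" if "n \<le> d" for n
    using that
  proof (induction n)
    case (Suc n)
    have "\<kappa> * (N n)\<^sup>2 \<le> ip (F n) (F n) - ip (F (Suc n)) (F (Suc n))"
      unfolding N_def nm_power2 using F[of n] gap[of "Suc n" "F n"] bF[of n] Suc.prems by simp
    then show ?case using Suc by (simp add: distrib_left)
  qed simp
  have sq: "(2 * (\<Sum>k<d. N k))\<^sup>2 \<le> 4 * real d * (\<Sum>k<d. (N k)\<^sup>2)"
  proof -
    have "(\<Sum>k<d. N k)\<^sup>2 \<le> (\<Sum>k<d. (N k)\<^sup>2) * real d"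
      using sum_squared_le_sum_of_squares[of N "{..<d}"] by simp
    then have "4 * (\<Sum>k<d. N k)\<^sup>2 \<le> 4 * ((\<Sum>k<d. (N k)\<^sup>2) * real d)" by simp
    then show ?thesis unfolding power_mult_distrib by (simp add: mult_ac)
  qed
  have "\<psi> / 2 * ip (F 0) (F 0) \<le> (\<Sum>j\<in>{1..d}. 4 * real d * (\<Sum>k<d. (N k)\<^sup>2))"
  proof (rule order_trans[OF \<psi>], rule sum_mono)
    fix j assume "j \<in> {1..d}"
    then obtain n where n: "j = Suc n" "n < d" by (cases j) auto
    have "ip (\<lambda>x. F 0 x - P j (F 0) x) (\<lambda>x. F 0 x - P j (F 0) x) \<le> (2 * (\<Sum>k<d. N k))\<^sup>2"
      unfolding nm_power2[symmetric] using loc[OF n(2)] unfolding n(1) by (rule power_mono) simp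
    then show "ip (\<lambda>x. F 0 x - P j (F 0) x) (\<lambda>x. F 0 x - P j (F 0) x) \<le> 4 * real d * (\<Sum>k<d. (N k)\<^sup>2)"
      using sq by linarith
  qed
  also have "\<dots> = 4 * (real d)\<^sup>2 * (\<Sum>k<d. (N k)\<^sup>2)" by (simp add: power2_eq_square)
  finally have "\<kappa> * (\<psi> / 2 * ip (F 0) (F 0)) \<le> \<kappa> * (4 * (real d)\<^sup>2 * (\<Sum>k<d. (N k)\<^sup>2))"
    using \<kappa> by (intro mult_left_mono) auto
  also have "\<dots> = 4 * (real d)\<^sup>2 * (\<kappa> * (\<Sum>k<d. (N k)\<^sup>2))" by simp
  also have "\<dots> \<le> 4 * (real d)\<^sup>2 * \<Delta>"
    unfolding \<Delta>_def by (rule mult_left_mono[OF tele]) auto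
  finally have "\<kappa> * \<psi> * ip (F 0) (F 0) \<le> \<Delta> * (8 * (real d)\<^sup>2)" by (simp add: mult_ac)
  then have "\<kappa> * \<psi> * ip (F 0) (F 0) / (8 * (real d)\<^sup>2) \<le> \<Delta>" using d by (subst pos_divide_le_eq) auto
  then show ?thesis by (simp add: \<Delta>_def left_diff_distrib)
qed

text \<open>
  Here \<open>t\<close> is the smallest \<open>\<tau>\<^sub>j\<close>, so that \<open>\<lambda>\<^sub>0 = 1 - c\<^sub>0 t\<close>. As \<open>c\<^sub>0\<close> is small, the cubic term
  \<open>(c\<^sub>0 t)\<^sup>3\<close> is far below \<open>t\<^sup>2/18\<close>, which leaves room for taking the square root of the contraction
  factor of the squared norm.
\<close>
lemma convergence_rate_le:
  fixes d \<psi> t c0 :: real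
  assumes d: "1 \<le> d" and \<psi>: "0 \<le> \<psi>" "\<psi> \<le> d" and t: "0 < t" "t \<le> 1 / 2" and c0: "0 < c0" "c0 \<le> 1 / 100"
  defines "c \<equiv> 1 - (c0 * t) ^ 3 / (8 * (d + 1) * (2 - c0 * t)) * (\<psi> / d)"
  shows "0 \<le> c" "1 - t\<^sup>2 / 9 * \<psi> / (8 * d\<^sup>2) \<le> c\<^sup>2"
proof -
  define g where "g = c0 * t"
  have g: "0 \<le> g" "g \<le> 1" "18 * g ^ 3 \<le> t\<^sup>2"
  proof -
    have gt: "g \<le> 1 / 100 * t" unfolding g_def using c0 t by (intro mult_right_mono) auto
    show g0: "0 \<le> g" using c0 t by (simp add: g_def)
    show "g \<le> 1" using gt t by linarith
    have "g ^ 3 \<le> (1 / 100 * t) ^ 3" using gt g0 by (rule power_mono)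
    also have "\<dots> = t\<^sup>2 * (t / 1000000)" by (simp add: power2_eq_square power3_eq_cube)
    also have "\<dots> \<le> t\<^sup>2 * (1 / 18)" using t by (intro mult_left_mono) auto
    finally show "18 * g ^ 3 \<le> t\<^sup>2" by simp
  qed
  define x where "x = g ^ 3 / (8 * (d + 1) * (2 - g)) * (\<psi> / d)"
  have c: "c = 1 - x" by (simp add: c_def x_def g_def)
  have x_le: "2 * x \<le> t\<^sup>2 / 9 * \<psi> / (8 * d\<^sup>2)"
  proof -
    have "x \<le> g ^ 3 / (8 * d * 1) * (\<psi> / d)" unfolding x_def
      using d \<psi> g by (intro mult_right_mono divide_left_mono mult_mono) auto
    also have "\<dots> \<le> (t\<^sup>2 / 18) / (8 * d * 1) * (\<psi> / d)"
      using d \<psi> g by (intro mult_right_mono divide_right_mono) auto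
    finally show ?thesis by (simp add: power2_eq_square)
  qed
  have "t\<^sup>2 / 9 * \<psi> / (8 * d\<^sup>2) \<le> 1"
  proof -
    have "t\<^sup>2 \<le> 1" using t by (simp add: power_le_one)
    then have "t\<^sup>2 / 9 * \<psi> \<le> 1 * d" using \<psi> t by (intro mult_mono) auto
    also have "\<dots> \<le> 8 * d\<^sup>2" using d mult_mono[of 1 d d d] by (simp add: power2_eq_square)
    finally show ?thesis using d by simp
  qed
  then show "0 \<le> c" using x_le by (simp add: c)
  have "1 - 2 * x \<le> c\<^sup>2" by (simp add: c power2_diff)
  then show "1 - t\<^sup>2 / 9 * \<psi> / (8 * d\<^sup>2) \<le> c\<^sup>2" using x_le by linarith
qed

lemma matrix_vector_mult_sum_left:
  fixes A :: "'i \<Rightarrow> real ^ 'n ^ 'm"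
  shows "(\<Sum>j\<in>S. A j) *v x = (\<Sum>j\<in>S. A j *v x)"
  by (induction S rule: infinite_finite_induct) (simp_all add: matrix_vector_mult_add_rdistrib)

theorem proposition5p2:
  fixes \<mu> :: "real ^ 'n" and Q :: "real ^ 'n ^ 'n"
    and b :: "'n \<Rightarrow> nat" and d :: nat and h :: "nat \<Rightarrow> real"
    and c0 lambda0 :: real and D :: "real ^ 'n ^ 'n"
  assumes Q: "sym_pos_def Q"
    and blocks: "range b = {1..d}"
    and c0: "c0 = 1 / (102400 * pi)"
    and h_pos: "\<forall>j\<in>{1..d}. 0 < h j"
    and h_max: "\<forall>j\<in>{1..d}. h j \<le> 1 / (2 * psi_max_on (b -` {j}) (diag_block b j Q))"
    and h_tr: "\<forall>j\<in>{1..d}. (h j)\<^sup>2 \<le> 1 / (10 * trace (diag_block b j Q ** diag_block b j Q))"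
    and lambda0: "lambda0 = Max ((\<lambda>j. 1 - c0 * h j * psi_min_on (b -` {j}) (diag_block b j Q)) ` {1..d})"
    and D: "D = diag_block_inverse b d Q"
  shows "L2_op_norm (gauss_measure \<mu> Q)
           (\<lambda>f x. kernel_op (dcw_mala_kernel (gauss_density \<mu> Q) b d h) f x
                 - mean_op (gauss_measure \<mu> Q) f x)
         \<le> ereal (1 - (1 - lambda0) ^ 3 / (8 * (real d + 1) * (1 + lambda0))
                      * ((1 - psi_max_on UNIV (mat 1 - D ** Q)) / real d))"
proof -
  define M where "M = gauss_measure \<mu> Q"
  interpret M: polish_prob M unfolding M_def by (rule polish_prob_gauss[OF Q])
  define J where "J j = b -` {j}" for j
  define \<tau> where "\<tau> j = h j * psi_min_on (J j) (block (J j) (J j) Q)" for j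
  have diag: "diag_block b j Q = block (J j) (J j) Q" for j by (simp add: diag_block_def J_def)
  have d: "0 < d" using blocks by (cases d) auto
  have J: "J j \<noteq> {}" if "j \<in> {1..d}" for j
  proof -
    have "j \<in> range b" using that unfolding blocks .
    then obtain i where "j = b i" by (rule rangeE)
    then have "i \<in> J j" by (simp add: J_def)
    then show ?thesis by auto
  qed
  have \<tau>: "0 < \<tau> j" "\<tau> j \<le> 1 / 2"
    and ex: "\<exists>e a. mala_block Q e a (h j) (\<tau> j) (J j) \<and> (\<forall>i. block (J j) (J j) Q *v e i = a i *\<^sub>R e i)" if j: "j \<in> {1..d}" for j
  proof -
    have hj: "0 < h j" "h j \<le> 1 / (2 * psi_max_on (J j) (block (J j) (J j) Q))"
      "(h j)\<^sup>2 \<le> 1 / (10 * trace (block (J j) (J j) Q ** block (J j) (J j) Q))"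
      using h_pos[rule_format, OF j] h_max[rule_format, OF j] h_tr[rule_format, OF j]
      unfolding diag J_def[symmetric] .
    note * = mala_block_exists[OF Q J[OF j] hj, folded \<tau>_def]
    show "0 < \<tau> j" "\<tau> j \<le> 1 / 2" by (rule *)+
    show "\<exists>e a. mala_block Q e a (h j) (\<tau> j) (J j) \<and> (\<forall>i. block (J j) (J j) Q *v e i = a i *\<^sub>R e i)"
      by (rule *(1))
  qed
  have "\<forall>j\<in>{1..d}. \<exists>q. mala_block Q (fst q) (snd q) (h j) (\<tau> j) (J j) \<and> (\<forall>i. block (J j) (J j) Q *v fst q i = snd q i *\<^sub>R fst q i)"
  proof
    fix j assume "j \<in> {1..d}"
    from ex[OF this] obtain e a where "mala_block Q e a (h j) (\<tau> j) (J j) \<and> (\<forall>i. block (J j) (J j) Q *v e i = a i *\<^sub>R e i)"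
      by (elim exE)
    then show "\<exists>q. mala_block Q (fst q) (snd q) (h j) (\<tau> j) (J j) \<and> (\<forall>i. block (J j) (J j) Q *v fst q i = snd q i *\<^sub>R fst q i)"
      by (intro exI[of _ "(e, a)"]) simp
  qed
  then obtain q where q: "\<forall>j\<in>{1..d}. mala_block Q (fst (q j)) (snd (q j)) (h j) (\<tau> j) (J j)
      \<and> (\<forall>i. block (J j) (J j) Q *v fst (q j) i = snd (q j) i *\<^sub>R fst (q j) i)"
    by (rule bchoice[THEN exE])
  define e where "e j = fst (q j)" for j
  define a where "a j = snd (q j)" for j
  have mb: "mala_block Q (e j) (a j) (h j) (\<tau> j) (J j)" and ea: "block (J j) (J j) Q *v e j i = a j i *\<^sub>R e j i"
    if "j \<in> {1..d}" for j i using q that by (simp_all add: e_def a_def)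

  \<comment> \<open>the bilinear form of the inverse of block \<open>j\<close>, in its eigenbasis\<close>
  define S where "S j u v = (\<Sum>i | 0 < a j i. (e j i \<bullet> u) * (e j i \<bullet> v) / a j i)" for j and u v :: "real ^ 'n"
  have inv: "u \<bullet> (inverse_on (J j) (block (J j) (J j) Q) *v v) = S j u v" if j: "j \<in> {1..d}" for j u v
  proof -
    interpret mala_block \<mu> Q "e j" "a j" "h j" "\<tau> j" "J j" by (rule mb[OF j])
    have "inverse_on (J j) (block (J j) (J j) Q) *v v = comb (\<lambda>i. (e j i \<bullet> v) / a j i)"
      by (rule inverse_on_block[OF ea[OF j]]) (erule eJ)+
    then show ?thesis by (simp only: inner_comb_quotient S_def I_def)
  qed
  have uDv: "u \<bullet> (D *v v) = (\<Sum>j\<in>{1..d}. S j u v)" for u v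
    unfolding D diag_block_inverse_def diag J_def[symmetric] matrix_vector_mult_sum_left inner_sum_right
    by (intro sum.cong refl inv)
  have S_commute: "S j u v = S j v u" for j u v by (simp add: S_def mult.commute)
  have D_sym: "(D *v u) \<bullet> v = u \<bullet> (D *v v)" for u v
    unfolding inner_commute[of "D *v u" v] uDv by (intro sum.cong refl S_commute)
  have D_nonneg: "0 \<le> u \<bullet> (D *v u)" for u
    unfolding uDv S_def by (intro sum_nonneg divide_nonneg_nonneg) auto
  define \<psi> where "\<psi> = 1 - psi_max_on UNIV (mat 1 - D ** Q)"
  note \<psi> = preconditioned_gap[OF Q D_sym D_nonneg, folded \<psi>_def]

  define P where "P j = eigenblock.op \<mu> Q (e j) (a j) (\<lambda>i. 1 / a j i) (\<lambda>i. 1 / sqrt (a j i))" for j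
  \<comment> \<open>the energy of \<open>v\<close> that resampling block \<open>j\<close> removes\<close>
  define s where "s j v = S j (Q *v v) (Q *v v)" for j v
  have sum_s: "\<psi> * (v \<bullet> (Q *v v)) \<le> (\<Sum>j\<in>{1..d}. s j v)" for v
    using \<psi>(2)[of v] unfolding uDv s_def .
  have s_eq: "s j v = (\<Sum>i | 0 < a j i. (e j i \<bullet> (Q *v v))\<^sup>2 / a j i)" for j v
    by (simp add: s_def S_def power2_eq_square)
  have s_le: "s j v \<le> v \<bullet> (Q *v v)" if j: "j \<in> {1..d}" for j v
  proof -
    interpret mala_block \<mu> Q "e j" "a j" "h j" "\<tau> j" "J j" by (rule mb[OF j])
    show ?thesis using Q_nonneg[of "v + comb (\<lambda>i. - (e j i \<bullet> (Q *v v)) / a j i)"]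
      unfolding Gibbs_shift_energy s_eq I_def by simp
  qed
  have bP: "bounded_borel (P j f)" if "j \<in> {1..d}" "bounded_borel f" for j f
  proof -
    interpret mala_block \<mu> Q "e j" "a j" "h j" "\<tau> j" "J j" by (rule mb[OF that(1)])
    show ?thesis unfolding P_def by (rule bounded_borel_op[OF that(2)])
  qed
  have P_diff: "P j (\<lambda>x. f x - g x) = (\<lambda>x. P j f x - P j g x)" if "j \<in> {1..d}" "bounded_borel f" "bounded_borel g" for j f g
  proof -
    interpret mala_block \<mu> Q "e j" "a j" "h j" "\<tau> j" "J j" by (rule mb[OF that(1)])
    show ?thesis unfolding P_def by (rule op_diff[OF that(2,3)])
  qed
  have P_const: "P j (\<lambda>_. c) = (\<lambda>_. c)" if "j \<in> {1..d}" for j c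
  proof -
    interpret mala_block \<mu> Q "e j" "a j" "h j" "\<tau> j" "J j" by (rule mb[OF that(1)])
    show ?thesis unfolding P_def by (rule ext, rule op_cong_const) simp
  qed
  have P_idem: "P j (P j f) = P j f" if "j \<in> {1..d}" for j f
  proof -
    interpret mala_block \<mu> Q "e j" "a j" "h j" "\<tau> j" "J j" by (rule mb[OF that(1)])
    show ?thesis unfolding P_def by (rule op_Gibbs)
  qed
  have P_sa: "M.ip (P j f) g = M.ip f (P j g)" if "j \<in> {1..d}" "bounded_borel f" "bounded_borel g" for j f g
  proof -
    interpret mala_block \<mu> Q "e j" "a j" "h j" "\<tau> j" "J j" by (rule mb[OF that(1)])
    show ?thesis unfolding P_def M_def by (rule op_selfadjoint[OF reversible_Gibbs that(2,3)])
  qed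
  have P_nm: "M.nm (P j f) \<le> M.nm f" if "j \<in> {1..d}" "bounded_borel f" for j f
  proof -
    interpret mala_block \<mu> Q "e j" "a j" "h j" "\<tau> j" "J j" by (rule mb[OF that(1)])
    show ?thesis unfolding P_def M_def by (rule op_nm[OF reversible_Gibbs that(2)])
  qed
  have P_lip: "\<bar>P j k (x + v) - P j k x\<bar> \<le> L * sqrt (v \<bullet> (Q *v v) - s j v)"
    if "j \<in> {1..d}" "bounded_borel k" "0 \<le> L" "\<And>x v. \<bar>k (x + v) - k x\<bar> \<le> L * sqrt (v \<bullet> (Q *v v))" for j k L x v
  proof -
    interpret mala_block \<mu> Q "e j" "a j" "h j" "\<tau> j" "J j" by (rule mb[OF that(1)])
    show ?thesis using Gibbs_lipschitz[OF that(4,2), of x v] unfolding P_def s_eq I_def .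
  qed
  have P_orth: "M.ip (\<lambda>x. f x - P j f x) (P j f) = 0" if "j \<in> {1..d}" "bounded_borel f" for j f
  proof -
    interpret mala_block \<mu> Q "e j" "a j" "h j" "\<tau> j" "J j" by (rule mb[OF that(1)])
    show ?thesis unfolding P_def M_def by (rule Gibbs_orthogonal[OF that(2) that(2)])
  qed

  define k where "k j = mala_kernel (gauss_density \<mu> Q) (J j) (h j)" for j
  have k: "k j \<in> borel \<rightarrow>\<^sub>M prob_algebra borel" if "j \<in> {1..d}" for j
  proof -
    interpret mala_block \<mu> Q "e j" "a j" "h j" "\<tau> j" "J j" by (rule mb[OF that(1)])
    show ?thesis unfolding k_def by (rule measurable_mala_kernel)
  qed
  define T where "T j = kernel_op (k j)" for j
  have bT: "bounded_borel (T j f)" if "j \<in> {1..d}" "bounded_borel f" for j f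
    unfolding T_def by (rule bounded_borel_kernel_op[OF k[OF that(1)] that(2)])
  have T_diff: "T j (\<lambda>x. f x - g x) = (\<lambda>x. T j f x - T j g x)" if "j \<in> {1..d}" "bounded_borel f" "bounded_borel g" for j f g
  proof -
    interpret mala_block \<mu> Q "e j" "a j" "h j" "\<tau> j" "J j" by (rule mb[OF that(1)])
    show ?thesis unfolding T_def k_def using K_diff[OF that(2,3)] that(2,3) by (simp add: kernel_op_mala bounded_borel_diff)
  qed
  have TP: "T j (P j f) = P j f" if "j \<in> {1..d}" "bounded_borel f" for j f
  proof -
    interpret mala_block \<mu> Q "e j" "a j" "h j" "\<tau> j" "J j" by (rule mb[OF that(1)])
    show ?thesis unfolding T_def k_def P_def kernel_op_mala[OF bounded_borel_op[OF that(2)]] by (rule K_Gibbs)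
  qed
  have T_inv: "(\<integral>x. T j f x \<partial>M) = (\<integral>x. f x \<partial>M)" if "j \<in> {1..d}" "bounded_borel f" for j f
  proof -
    interpret mala_block \<mu> Q "e j" "a j" "h j" "\<tau> j" "J j" by (rule mb[OF that(1)])
    show ?thesis unfolding T_def k_def M_def kernel_op_mala[OF that(2)] by (rule K_invariant[OF that(2)])
  qed
  have T_gap: "(\<tau> j)\<^sup>2 / 9 * M.ip (\<lambda>x. f x - P j f x) (\<lambda>x. f x - P j f x) \<le> M.ip f f - M.ip (T j f) (T j f)"
    if "j \<in> {1..d}" "bounded_borel f" for j f
  proof -
    interpret mala_block \<mu> Q "e j" "a j" "h j" "\<tau> j" "J j" by (rule mb[OF that(1)])
    show ?thesis unfolding T_def k_def P_def M_def kernel_op_mala[OF that(2)] by (rule K_gap[OF that(2)])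
  qed

  define R where "R n = kernel_op (scan_kernel k n)" for n
  have scan: "scan_kernel k n \<in> borel \<rightarrow>\<^sub>M prob_algebra borel" if "n \<le> d" for n
    using that by (intro measurable_scan_kernel k) auto
  have R_0: "R 0 f = f" if "bounded_borel f" for f unfolding R_def by (rule kernel_op_scan_0[OF that])
  have R_Suc: "R (Suc n) f = T (Suc n) (R n f)" if "n < d" "bounded_borel f" for n f
    unfolding R_def T_def using that by (intro kernel_op_scan_Suc k scan) auto
  have bR: "bounded_borel (R n f)" if "n \<le> d" "bounded_borel f" for n f
    unfolding R_def by (rule bounded_borel_kernel_op[OF scan[OF that(1)] that(2)])
  have R_inv: "(\<integral>x. R n f x \<partial>M) = (\<integral>x. f x \<partial>M)" if f: "bounded_borel f" and "n \<le> d" for f n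
    using that(2) by (induction n) (simp_all add: R_0 R_Suc f T_inv bR)
  have T_const: "T j (\<lambda>_. c) = (\<lambda>_. c)" if "j \<in> {1..d}" for j c
    using TP[OF that bounded_borel_const[of c]] unfolding P_const[OF that] .
  have R_shift: "R n (\<lambda>x. f x - c) = (\<lambda>x. R n f x - c)" if f: "bounded_borel f" and "n \<le> d" for f c n
    using that(2)
    by (induction n) (simp_all add: R_0 R_Suc f T_diff T_const bR bounded_borel_diff bounded_borel_const)

  have "lambda0 \<in> (\<lambda>j. 1 - c0 * h j * psi_min_on (b -` {j}) (diag_block b j Q)) ` {1..d}"
    unfolding lambda0 using d by (intro Max_in) auto
  then obtain m where m: "m \<in> {1..d}" "lambda0 = 1 - c0 * \<tau> m"
    by (auto simp: \<tau>_def diag J_def[symmetric] mult.assoc)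
  have c0': "0 < c0" "c0 \<le> 1 / 100"
    using pi_ge_two by (simp_all add: c0 field_simps)
  have \<tau>_min: "\<tau> m \<le> \<tau> j" if j: "j \<in> {1..d}" for j
  proof -
    have "1 - c0 * \<tau> j \<le> lambda0"
      unfolding lambda0 using j by (intro Max_ge) (auto simp: \<tau>_def diag J_def[symmetric] mult.assoc)
    then show ?thesis unfolding m(2) using c0' by simp
  qed
  \<comment> \<open>the block with the smallest \<open>\<tau>\<close> determines both \<open>lambda0\<close> and the common gap\<close>
  define \<kappa> where "\<kappa> = (\<tau> m)\<^sup>2 / 9"
  have \<kappa>: "0 < \<kappa>" using \<tau>(1)[OF m(1)] by (simp add: \<kappa>_def)
  have gap: "\<kappa> * M.ip (\<lambda>x. f x - P j f x) (\<lambda>x. f x - P j f x) \<le> M.ip f f - M.ip (T j f) (T j f)"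
    if j: "j \<in> {1..d}" and f: "bounded_borel f" for j f
  proof (rule order_trans[OF mult_right_mono T_gap[OF j f]])
    show "\<kappa> \<le> (\<tau> j)\<^sup>2 / 9" unfolding \<kappa>_def
      using \<tau>_min[OF j] \<tau>(1)[OF m(1)] by (intro divide_right_mono power_mono) auto
  qed simp

  have \<psi>d: "\<psi> \<le> real d"
  proof -
    define v :: "real ^ 'n" where "v = axis undefined 1"
    have "v \<noteq> 0" by (simp add: v_def axis_eq_0_iff)
    then have pos: "0 < v \<bullet> (Q *v v)" using Q by (simp add: sym_pos_def_def)
    have "\<psi> * (v \<bullet> (Q *v v)) \<le> (\<Sum>j\<in>{1..d}. v \<bullet> (Q *v v))"
      by (rule order_trans[OF sum_s sum_mono[OF s_le]])
    then show ?thesis using pos by simp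
  qed
  define c where "c = 1 - (c0 * \<tau> m) ^ 3 / (8 * (real d + 1) * (2 - c0 * \<tau> m)) * (\<psi> / real d)"
  have "1 \<le> real d" using d by simp
  note c = convergence_rate_le[OF this \<psi>(1) \<psi>d \<tau>[OF m(1)] c0', folded c_def, folded \<kappa>_def]

  have bound: "(\<integral>x. (R d f x - (\<integral>y. f y \<partial>M))\<^sup>2 \<partial>M) \<le> c\<^sup>2 * (\<integral>x. (f x)\<^sup>2 \<partial>M)" if f: "bounded_borel f" for f
  proof -
    define m where "m = (\<integral>y. f y \<partial>M)"
    \<comment> \<open>the scan fixes constants, so it suffices to treat the centred function\<close>
    define f0 where "f0 = (\<lambda>x. f x - m)"
    have bf0: "bounded_borel f0" unfolding f0_def by (intro bounded_borel_diff f bounded_borel_const)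
    have m0: "(\<integral>y. f0 y \<partial>M) = 0"
      unfolding f0_def using M.integrable_bounded_borel[OF f] by (simp add: m_def M.prob_space)
    have "\<psi> / 2 * M.ip (\<lambda>x. f0 x - (\<integral>y. f0 y \<partial>M)) (\<lambda>x. f0 x - (\<integral>y. f0 y \<partial>M))
      \<le> (\<Sum>j\<in>{1..d}. M.ip (\<lambda>x. f0 x - P j f0 x) (\<lambda>x. f0 x - P j f0 x))"
    proof (rule random_scan_gap[OF Q d, where P = P and s = s and \<psi> = \<psi> and f = f0 and \<mu> = \<mu>, folded M_def])
      show "bounded_borel (P j f)" if "j \<in> {1..d}" "bounded_borel f" for j f by (rule bP[OF that])
      show "P j (\<lambda>x. f x - g x) = (\<lambda>x. P j f x - P j g x)"
        if "j \<in> {1..d}" "bounded_borel f" "bounded_borel g" for j f g by (rule P_diff[OF that])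
      show "P j (\<lambda>_. c) = (\<lambda>_. c)" if "j \<in> {1..d}" for j c by (rule P_const[OF that])
      show "P j (P j f) = P j f" if "j \<in> {1..d}" for j f by (rule P_idem[OF that])
      show "M.ip (P j f) g = M.ip f (P j g)"
        if "j \<in> {1..d}" "bounded_borel f" "bounded_borel g" for j f g by (rule P_sa[OF that])
      show "M.nm (P j f) \<le> M.nm f" if "j \<in> {1..d}" "bounded_borel f" for j f by (rule P_nm[OF that])
      show "\<bar>P j k (x + v) - P j k x\<bar> \<le> L * sqrt (v \<bullet> (Q *v v) - s j v)"
        if "j \<in> {1..d}" "bounded_borel k" "0 \<le> L" "\<And>x v. \<bar>k (x + v) - k x\<bar> \<le> L * sqrt (v \<bullet> (Q *v v))" for j k L x v
        by (rule P_lip[OF that])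
      show "s j v \<le> v \<bullet> (Q *v v)" if "j \<in> {1..d}" for j v by (rule s_le[OF that])
      show "0 \<le> \<psi>" by (rule \<psi>(1))
      show "\<psi> * (v \<bullet> (Q *v v)) \<le> (\<Sum>j\<in>{1..d}. s j v)" for v by (rule sum_s)
      show "bounded_borel f0" by (rule bf0)
    qed
    then have rs: "\<psi> / 2 * M.ip f0 f0 \<le> (\<Sum>j\<in>{1..d}. M.ip (\<lambda>x. f0 x - P j f0 x) (\<lambda>x. f0 x - P j f0 x))"
      unfolding m0 by simp
    have "M.ip (R d f0) (R d f0) \<le> (1 - \<kappa> * \<psi> / (8 * (real d)\<^sup>2)) * M.ip (R 0 f0) (R 0 f0)"
    proof (rule M.cyclic_scan_gap[where P = P and K = T and F = "\<lambda>n. R n f0", OF d \<kappa>])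
      show "bounded_borel (P j f)" if "j \<in> {1..d}" "bounded_borel f" for j f by (rule bP[OF that])
      show "bounded_borel (T j f)" if "j \<in> {1..d}" "bounded_borel f" for j f by (rule bT[OF that])
      show "P j (\<lambda>x. f x - g x) = (\<lambda>x. P j f x - P j g x)"
        if "j \<in> {1..d}" "bounded_borel f" "bounded_borel g" for j f g by (rule P_diff[OF that])
      show "T j (\<lambda>x. f x - g x) = (\<lambda>x. T j f x - T j g x)"
        if "j \<in> {1..d}" "bounded_borel f" "bounded_borel g" for j f g by (rule T_diff[OF that])
      show "T j (P j f) = P j f" if "j \<in> {1..d}" "bounded_borel f" for j f by (rule TP[OF that])
      show "M.ip (\<lambda>x. f x - P j f x) (P j f) = 0" if "j \<in> {1..d}" "bounded_borel f" for j f by (rule P_orth[OF that])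
      show "\<kappa> * M.ip (\<lambda>x. f x - P j f x) (\<lambda>x. f x - P j f x) \<le> M.ip f f - M.ip (T j f) (T j f)"
        if "j \<in> {1..d}" "bounded_borel f" for j f by (rule gap[OF that])
      show "bounded_borel (R 0 f0)" unfolding R_0[OF bf0] by (rule bf0)
      show "R (Suc n) f0 = T (Suc n) (R n f0)" if "n < d" for n by (rule R_Suc[OF that bf0])
      show "\<psi> / 2 * M.ip (R 0 f0) (R 0 f0)
        \<le> (\<Sum>j\<in>{1..d}. M.ip (\<lambda>x. R 0 f0 x - P j (R 0 f0) x) (\<lambda>x. R 0 f0 x - P j (R 0 f0) x))"
        unfolding R_0[OF bf0] by (rule rs)
    qed
    also have "\<dots> \<le> c\<^sup>2 * M.ip f0 f0"
      unfolding R_0[OF bf0] by (rule mult_right_mono[OF c(2)]) simp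
    also have "\<dots> \<le> c\<^sup>2 * (\<integral>x. (f x)\<^sup>2 \<partial>M)"
    proof (rule mult_left_mono)
      have "M.ip f0 f0 = (\<integral>x. (f x)\<^sup>2 - 2 * m * f x + m\<^sup>2 \<partial>M)"
        unfolding M.ip_def f0_def by (rule Bochner_Integration.integral_cong) (auto simp: power2_eq_square algebra_simps)
      also have "\<dots> = (\<integral>x. (f x)\<^sup>2 \<partial>M) - m\<^sup>2"
        using M.integrable_bounded_borel[OF f] M.integrable_bounded_borel[OF bounded_borel_power2[OF f]]
        by (simp add: M.prob_space m_def[symmetric] power2_eq_square)
      finally show "M.ip f0 f0 \<le> (\<integral>x. (f x)\<^sup>2 \<partial>M)" by simp
    qed simp
    finally show ?thesis
      unfolding f0_def R_shift[OF f order_refl] by (simp add: M.ip_def m_def power2_eq_square)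
  qed
  have "L2_op_norm M (\<lambda>f x. kernel_op (scan_kernel k d) f x - mean_op M f x) \<le> ereal c"
  proof (rule L2_op_norm_kernel_le[OF M.prob_space_axioms M.sets_borel scan[OF order_refl] _ c(1)])
    show "(\<integral>x. kernel_op (scan_kernel k d) f x \<partial>M) = (\<integral>x. f x \<partial>M)" if "bounded_borel f" for f
      using R_inv[OF that order_refl] unfolding R_def .
    show "(\<integral>x. (kernel_op (scan_kernel k d) f x - (\<integral>y. f y \<partial>M))\<^sup>2 \<partial>M) \<le> c\<^sup>2 * (\<integral>x. (f x)\<^sup>2 \<partial>M)"
      if "bounded_borel f" for f using bound[OF that] unfolding R_def .
  qed
  moreover have "scan_kernel k d = dcw_mala_kernel (gauss_density \<mu> Q) b d h"
    by (simp add: dcw_mala_kernel_def k_def[abs_def] J_def fun_eq_iff)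
  moreover have "c = 1 - (1 - lambda0) ^ 3 / (8 * (real d + 1) * (1 + lambda0)) * ((1 - psi_max_on UNIV (mat 1 - D ** Q)) / real d)"
    by (simp add: c_def m(2) \<psi>_def)
  ultimately show ?thesis by (simp add: M_def)
qed

end
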